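(* Let $\gamma\in(0,1]$. Assume that $\mu$ is strictly contracting, admits a moment of order $3$ and almost admits an exponential moment of order $\gamma$. Let $s^2=\lim_{n\to+\infty}\frac1n\mathbb E[(\sigma(A_n,W_0)-n\lambda_\mu)^2]$, where $W_0$ has law $\nu$ and is independent of $(Y_n)_{n\in\mathbb N}$, and assume that $s^2>0$. Set $v_n=\frac{(\log n)^{1/\gamma}}{n^{1/2}}$. Then $$\sup_{t\in\mathbb R}\Big|\mathbb P\big(\log v(A_n)-n\lambda_\mu\le t\sqrt n\big)-\Phi(t/s)\Big|=O(v_n)$$ and $$\sup_{t\in\mathbb R}\Big|\mathbb P\big(\log\kappa(A_n)-n\lambda_\mu\le t\sqrt n\big)-\Phi(t/s)\Big|=O(v_n)$$ as $n\to+\infty$.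
   Context: Let $d\ge 2$ be an integer and $\mathbb N=\{1,2,\dots\}$. $\|\cdot\|$ denotes the $\ell^1$ norm on $\mathbb R^d$ and also the associated operator norm on $d\times d$ matrices. $G$ is the semigroup of $d\times d$ real matrices with nonnegative entries such that every row and every column contains a strictly positive entry, with the topology induced by the norm; $G^+\subset G$ is the set of matrices all of whose entries are strictly positive. $S^+=\{x\in\mathbb R^d:\|x\|=1,\ x_i\ge 0\ \forall i\}$, equipped with the metric $\mathbf d(x,y)=\varphi(m(x,y)m(y,x))$, where $\varphi(s)=\frac{1-s}{1+s}$ and $m(x,y)=\inf\{x_i/y_i: 1\le i\le d,\ y_i>0\}$; Borel sets of $S^+$ refer to $\mathbf d$. For $g\in G$: $v(g)=\inf_{x\in S^+}\|gx\|$, $N(g)=\max(\|g\|,1/v(g))$, $L(g)=\|g\|/v(g)$, and $\kappa(g)$ is the spectral radius of $g$. (The function $v(\cdot)$ on $G$ and the numerical sequence $v_n$ are unrelated.) For $(g,x)\in G\times S^+$, $g\cdot x=gx/\|gx\|$ and $\sigma(g,x)=\log\|gx\|$. $\mu$ is a Borel probability measure on $G$; $\mu^{*r}$ is its $r$-fold convolution (the law of a product of $r$ independent matrices of law $\mu$). $\mu$ is strictly contracting if $\mu^{*r}(G^+)>0$ for some $r\in\mathbb N$. $\mu$ admits a moment of order $p\ge1$ if $\int_G(\log N(g))^p\,d\mu(g)<\infty$. $\mu$ almost admits an exponential moment of order $\gamma$ if there exists $\delta>0$ with $\int_G e^{\delta(\log L(g))^\gamma}d\mu(g)<\infty$. When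 $\mu$ is strictly contracting there is a unique $\mu$-invariant Borel probability measure $\nu$ on $S^+$, i.e. $\int f(g\cdot x)\,d\mu(g)d\nu(x)=\int f\,d\nu$ for all nonnegative Borel $f$. $(Y_n)_{n\in\mathbb N}$ are iid with law $\mu$ and $A_n=Y_n\cdots Y_1$. $\lambda_\mu\in\mathbb R$ is the almost sure (and $L^1$) limit of $\frac1n\log\|A_n\|$, which exists and is constant as soon as $\int_G|\log\|g\||\,d\mu(g)<\infty$. If $\mu$ is strictly contracting and admits a moment of order $2$, the limit defining $s^2$ exists in $[0,\infty)$; $s=\sqrt{s^2}$. $\Phi$ is the standard normal distribution function. *)

theory Defs
  imports "HOL-Probability.Probability" "HOL-Library.Landau_Symbols"
begin

section \<open>Norms and nonnegative matrices\<close>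

text \<open>The library norm on \<open>real ^ 'n\<close> is the Euclidean one, so the \<open>\<ell>\<^sup>1\<close> norm and the associated
  operator norm are introduced separately.\<close>

definition l1norm :: "real ^ 'n::finite \<Rightarrow> real" where
  "l1norm x = (\<Sum>i\<in>UNIV. \<bar>x $ i\<bar>)"

definition l1_onorm :: "real ^ 'n::finite ^ 'n \<Rightarrow> real" where
  "l1_onorm g = (SUP x \<in> {x. l1norm x = 1}. l1norm (g *v x))"

definition Gmat :: "(real ^ 'n::finite ^ 'n) set" where
  "Gmat = {g. (\<forall>i j. 0 \<le> g $ i $ j) \<and> (\<forall>i. \<exists>j. 0 < g $ i $ j) \<and> (\<forall>j. \<exists>i. 0 < g $ i $ j)}"

definition Gplus :: "(real ^ 'n::finite ^ 'n) set" where
  "Gplus = {g. \<forall>i j. 0 < g $ i $ j}"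

text \<open>All norms being equivalent, the norm topology on \<open>Gmat\<close> is the subspace topology of the
  matrix space.\<close>

definition borel_G :: "(real ^ 'n::finite ^ 'n) measure" where
  "borel_G = restrict_space borel Gmat"

section \<open>The simplex with its projective metric\<close>

definition Splus :: "(real ^ 'n::finite) set" where
  "Splus = {x. l1norm x = 1 \<and> (\<forall>i. 0 \<le> x $ i)}"

definition phi :: "real \<Rightarrow> real" where
  "phi s = (1 - s) / (1 + s)"

definition mratio :: "real ^ 'n::finite \<Rightarrow> real ^ 'n \<Rightarrow> real" where
  "mratio x y = (INF i \<in> {i. 0 < y $ i}. x $ i / y $ i)"

text \<open>The value \<open>0\<close> outside \<open>Splus\<close> is only there because \<open>Metric_space\<close> requires
  symmetry and nonnegativity on the whole type.\<close>

definition dproj :: "real ^ 'n::finite \<Rightarrow> real ^ 'n \<Rightarrow> real" where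
  "dproj x y = (if x \<in> Splus \<and> y \<in> Splus then phi (mratio x y * mratio y x) else 0)"

lemma Splus_ex_pos:
  assumes "x \<in> Splus" shows "\<exists>i. 0 < x $ i"
proof (rule ccontr)
  assume "\<not> ?thesis"
  then have "x $ i = 0" for i
    using assms by (auto simp: Splus_def not_less intro: antisym)
  then show False using assms by (auto simp: Splus_def l1norm_def)
qed

lemma Splus_sum: "x \<in> Splus \<Longrightarrow> (\<Sum>i\<in>UNIV. x $ i) = 1"
  by (auto simp: Splus_def l1norm_def)

lemma Splus_nonneg: "x \<in> Splus \<Longrightarrow> 0 \<le> x $ i"
  by (auto simp: Splus_def)

lemma mratio_mult_le:
  assumes "x \<in> Splus" "y \<in> Splus" shows "mratio x y * y $ i \<le> x $ i"
proof (cases "0 < y $ i")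
  case True
  have "mratio x y \<le> x $ i / y $ i"
    unfolding mratio_def by (rule cINF_lower) (use True in auto)
  then show ?thesis using True by (simp add: field_simps)
next
  case False
  then have "y $ i = 0" using Splus_nonneg[OF assms(2), of i] by simp
  then show ?thesis using Splus_nonneg[OF assms(1)] by simp
qed

lemma le_mratio:
  assumes "y \<in> Splus" "\<And>i. c * y $ i \<le> x $ i" shows "c \<le> mratio x y"
  unfolding mratio_def
proof (rule cINF_greatest)
  show "{i. 0 < y $ i} \<noteq> {}" using Splus_ex_pos[OF assms(1)] by auto
  show "c \<le> x $ i / y $ i" if "i \<in> {i. 0 < y $ i}" for i
    using that assms(2)[of i] by (simp add: field_simps)
qed

lemma mratio_nonneg: "x \<in> Splus \<Longrightarrow> y \<in> Splus \<Longrightarrow> 0 \<le> mratio x y"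
  by (rule le_mratio) (auto simp: Splus_nonneg)

lemma mratio_le_1:
  assumes "x \<in> Splus" "y \<in> Splus" shows "mratio x y \<le> 1"
proof -
  have "(\<Sum>i\<in>UNIV. mratio x y * y $ i) \<le> (\<Sum>i\<in>UNIV. x $ i)"
    by (rule sum_mono) (rule mratio_mult_le[OF assms])
  then show ?thesis
    by (simp add: sum_distrib_left[symmetric] Splus_sum assms)
qed

lemma mratio_trans:
  assumes "x \<in> Splus" "y \<in> Splus" "z \<in> Splus"
  shows "mratio x y * mratio y z \<le> mratio x z"
proof (rule le_mratio[OF assms(3)])
  fix i
  have "mratio x y * (mratio y z * z $ i) \<le> mratio x y * y $ i"
    by (rule mult_left_mono[OF mratio_mult_le[OF assms(2,3)] mratio_nonneg[OF assms(1,2)]])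
  also have "\<dots> \<le> x $ i" by (rule mratio_mult_le[OF assms(1,2)])
  finally show "mratio x y * mratio y z * z $ i \<le> x $ i" by (simp add: mult.assoc)
qed

lemma phi_mult_le:
  assumes "0 \<le> s" "s \<le> 1" "0 \<le> t" "t \<le> 1" shows "phi (s * t) \<le> phi s + phi t"
proof -
  have st: "0 \<le> s * t" "1 + s * t \<noteq> 0"
    using assms mult_nonneg_nonneg[of s t] by linarith+
  have nn: "0 \<le> phi s" "0 \<le> phi t" "0 \<le> phi (s * t)"
    using assms by (auto simp: phi_def mult_le_one)
  have "phi s + phi t = phi (s * t) * (1 + phi s * phi t)"
    using assms st by (simp add: phi_def divide_simps) (auto simp: algebra_simps)
  moreover have "phi (s * t) * 1 \<le> phi (s * t) * (1 + phi s * phi t)"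
    by (rule mult_left_mono) (use nn in auto)
  ultimately show ?thesis by simp
qed

lemma phi_antimono: "0 \<le> s \<Longrightarrow> s \<le> t \<Longrightarrow> phi t \<le> phi s"
  by (auto simp: phi_def field_simps)

lemma Metric_space_dproj: "Metric_space Splus dproj"
proof
  fix x y :: "real ^ 'n"
  show "0 \<le> dproj x y"
    by (auto simp: dproj_def phi_def mratio_nonneg mratio_le_1 mult_le_one)
  show "dproj x y = dproj y x"
    by (auto simp: dproj_def mult.commute)
  assume xy: "x \<in> Splus" "y \<in> Splus"
  show "dproj x y = 0 \<longleftrightarrow> x = y"
  proof
    assume eq: "dproj x y = 0"
    let ?a = "mratio x y" and ?b = "mratio y x"
    have ab: "0 \<le> ?a" "?a \<le> 1" "0 \<le> ?b" "?b \<le> 1"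
      using xy by (auto simp: mratio_nonneg mratio_le_1)
    have "0 \<le> ?a * ?b" using ab by simp
    then have 1: "?a * ?b = 1" using eq xy by (auto simp: dproj_def phi_def)
    have "?a * ?b \<le> ?a" "?a * ?b \<le> ?b"
      using ab by (auto intro: mult_left_le mult_left_le_one_le)
    then have "?a = 1" "?b = 1" using 1 ab by auto
    then show "x = y"
      using mratio_mult_le[OF xy] mratio_mult_le[OF xy(2,1)]
      by (auto simp: vec_eq_iff intro!: antisym)
  next
    assume "x = y"
    moreover have "mratio x x = 1"
      by (rule antisym[OF mratio_le_1[OF xy(1) xy(1)] le_mratio[OF xy(1)]]) simp
    ultimately show "dproj x y = 0" by (simp add: dproj_def phi_def)
  qed
next
  fix x y z :: "real ^ 'n"
  assume xyz: "x \<in> Splus" "y \<in> Splus" "z \<in> Splus"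
  let ?p = "\<lambda>u w. mratio u w * mratio w u"
  have p: "0 \<le> ?p u w" "?p u w \<le> 1" if "u \<in> Splus" "w \<in> Splus" for u w :: "real ^ 'n"
    using that by (auto simp: mratio_nonneg mratio_le_1 mult_le_one)
  have "?p x y * ?p y z = (mratio x y * mratio y z) * (mratio z y * mratio y x)"
    by (simp add: mult_ac)
  also have "\<dots> \<le> ?p x z"
    by (intro mult_mono mratio_trans mult_nonneg_nonneg mratio_nonneg xyz)
  finally have le: "?p x y * ?p y z \<le> ?p x z" .
  have "phi (?p x z) \<le> phi (?p x y * ?p y z)"
    by (rule phi_antimono[OF _ le]) (intro mult_nonneg_nonneg p xyz)
  also have "\<dots> \<le> phi (?p x y) + phi (?p y z)"
    by (intro phi_mult_le p xyz)
  finally show "dproj x z \<le> dproj x y + dproj y z"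
    using xyz by (simp add: dproj_def)
qed

definition borel_Splus :: "(real ^ 'n::finite) measure" where
  "borel_Splus = sigma Splus {U. openin (Metric_space.mtopology Splus dproj) U}"

section \<open>Matrix functionals and the projective action\<close>

definition vmin :: "real ^ 'n::finite ^ 'n \<Rightarrow> real" where
  "vmin g = (INF x \<in> Splus. l1norm (g *v x))"

definition Nmat :: "real ^ 'n::finite ^ 'n \<Rightarrow> real" where
  "Nmat g = max (l1_onorm g) (1 / vmin g)"

definition Lmat :: "real ^ 'n::finite ^ 'n \<Rightarrow> real" where
  "Lmat g = l1_onorm g / vmin g"

text \<open>Spectral radius: the largest modulus of a complex eigenvalue.\<close>

definition kappa :: "real ^ 'n::finite ^ 'n \<Rightarrow> real" where
  "kappa g = (SUP z \<in> {z :: complex. \<exists>w :: complex ^ 'n. w \<noteq> 0 \<and>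
      (\<chi> i j. complex_of_real (g $ i $ j)) *v w = z *s w}. cmod z)"

definition act :: "real ^ 'n::finite ^ 'n \<Rightarrow> real ^ 'n \<Rightarrow> real ^ 'n" where
  "act g x = (1 / l1norm (g *v x)) *\<^sub>R (g *v x)"

definition cocycle :: "real ^ 'n::finite ^ 'n \<Rightarrow> real ^ 'n \<Rightarrow> real" where
  "cocycle g x = ln (l1norm (g *v x))"

section \<open>Probability measures on the semigroup\<close>

primrec conv_pow :: "(real ^ 'n::finite ^ 'n) measure \<Rightarrow> nat \<Rightarrow> (real ^ 'n ^ 'n) measure" where
  "conv_pow \<mu> 0 = return borel_G (mat 1)"
| "conv_pow \<mu> (Suc r) = distr (\<mu> \<Otimes>\<^sub>M conv_pow \<mu> r) borel_G (\<lambda>(g, h). g ** h)"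

definition strictly_contracting :: "(real ^ 'n::finite ^ 'n) measure \<Rightarrow> bool" where
  "strictly_contracting \<mu> \<longleftrightarrow> (\<exists>r\<ge>1. emeasure (conv_pow \<mu> r) Gplus > 0)"

text \<open>On \<open>Gmat\<close> one has \<open>1 \<le> Nmat g\<close> and \<open>1 \<le> Lmat g\<close>, so the bases of the real powers
  below are nonnegative.\<close>

definition has_moment :: "(real ^ 'n::finite ^ 'n) measure \<Rightarrow> real \<Rightarrow> bool" where
  "has_moment \<mu> p \<longleftrightarrow> (\<integral>\<^sup>+ g. ennreal (ln (Nmat g) powr p) \<partial>\<mu>) < \<infinity>"

definition almost_exp_moment :: "(real ^ 'n::finite ^ 'n) measure \<Rightarrow> real \<Rightarrow> bool" where
  "almost_exp_moment \<mu> \<gamma> \<longleftrightarrow>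
     (\<exists>\<delta>>0. (\<integral>\<^sup>+ g. ennreal (exp (\<delta> * ln (Lmat g) powr \<gamma>)) \<partial>\<mu>) < \<infinity>)"

definition invariant_measure ::
    "(real ^ 'n::finite ^ 'n) measure \<Rightarrow> (real ^ 'n) measure \<Rightarrow> bool" where
  "invariant_measure \<mu> \<nu> \<longleftrightarrow>
     (\<forall>f :: real ^ 'n \<Rightarrow> ennreal. f \<in> borel_measurable borel_Splus \<longrightarrow>
        (\<integral>\<^sup>+ x. (\<integral>\<^sup>+ g. f (act g x) \<partial>\<mu>) \<partial>\<nu>) = (\<integral>\<^sup>+ x. f x \<partial>\<nu>))"

text \<open>\<open>rprod Y n \<omega>\<close> is the left product of \<open>Y 1 \<omega>, \<dots>, Y n \<omega>\<close>; the variable \<open>Y 0\<close> is never used.\<close>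

primrec rprod :: "(nat \<Rightarrow> 'w \<Rightarrow> real ^ 'n::finite ^ 'n) \<Rightarrow> nat \<Rightarrow> 'w \<Rightarrow> real ^ 'n ^ 'n" where
  "rprod Y 0 \<omega> = mat 1"
| "rprod Y (Suc n) \<omega> = Y (Suc n) \<omega> ** rprod Y n \<omega>"

end

theory Submission
  imports Defs
begin

text \<open>Both \<open>ln (vmin h)\<close> and \<open>ln (kappa h)\<close> lie between \<open>ln (vmin h)\<close> and \<open>ln (l1_onorm h)\<close>, as does
  the cocycle at any starting vector, and these bounds differ by \<open>ln (Lmat h)\<close>. For a product of \<open>n\<close>
  factors this distortion has an exponential moment of order \<open>\<gamma>\<close> bounded uniformly in \<open>n\<close>, so it exceeds
  a constant times \<open>(ln n) powr (1 / \<gamma>)\<close> with probability \<open>O(1 / n)\<close> only, and it suffices to treat one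
  quantity between the two bounds up to a bounded error. The solution \<open>\<psi>\<close> of the Poisson equation of the
  projective Markov chain provides such a quantity: a martingale whose increments, given the current
  state, form a centered cocycle. Its characteristic function is controlled by iterating the twisted
  transfer operator on functions that are Lipschitz for a projective gauge which the chain contracts
  on average. Gaussian smoothing turns this into a Kolmogorov bound of order \<open>ln n / sqrt n\<close>, which the
  claimed rate absorbs because \<open>\<gamma> \<le> 1\<close>.\<close>

section \<open>Gaussian smoothing\<close>

text \<open>The two moment conditions do separate jobs. The log-norm increment is Lipschitz in the
  projective gauge with a constant affine in \<open>ln (Nmat g)\<close>, so three moments permit a
  third-order expansion of the twisted operator. The exponential moment controls only the passage
  from the martingale to \<open>vmin\<close> and \<open>kappa\<close>: a shift of size
  \<open>ln n powr (1 / \<gamma>)\<close> before division by \<open>sqrt n\<close>, which sets the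
  rate. The obstacle is the state-dependent drift of the log-norm: its first-order term would feed
  an oscillation of order \<bar>\<theta>\<bar> into the operator. The Poisson equation centers the
  increments at every state, so that an oscillation of order \<open>\<theta>\<^sup>2\<close>
  remains. A Gaussian smoothing kernel has explicit tails and transform; its price is a factor
  \<open>ln n\<close>, the product of a standard deviation of order \<open>sqrt (ln n / n)\<close>
  and a cut-off of order \<open>sqrt (ln n)\<close>. The open cone is the state space because all
  ratios of coordinates are positive there, which keeps the logarithm of \<open>1 - pgap x y\<close>
  finite. The constants of the construction are tied to the prescribed limits at the end, by a
  mean-square comparison along paths.\<close>

abbreviation stdN :: "real measure" where "stdN \<equiv> std_normal_distribution"

definition gauss_smooth :: "real measure \<Rightarrow> real \<Rightarrow> real measure" where
  "gauss_smooth N c = distr (N \<Otimes>\<^sub>M stdN) borel (\<lambda>p. fst p + c * snd p)"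

lemma stdN_singleton: "emeasure stdN {x} = 0"
proof -
  have "AE y in lborel. y \<noteq> x" by (rule AE_lborel_singleton)
  then show ?thesis
    by (subst emeasure_density) (auto simp: nn_integral_0_iff_AE split: split_indicator)
qed

context
  fixes N :: "real measure" and c :: real
  assumes N: "real_distribution N"
begin

interpretation N: real_distribution N by (rule N)
interpretation S: real_distribution stdN by (rule real_dist_normal_dist)
interpretation P: pair_prob_space N stdN ..

lemma pair_meas [measurable]:
  "(\<lambda>p. fst p + c * snd p) \<in> borel_measurable (N \<Otimes>\<^sub>M stdN)"
proof -
  have "sets (N \<Otimes>\<^sub>M stdN) = sets (borel \<Otimes>\<^sub>M borel)"
    by (intro sets_pair_measure_cong) simp_all
  then have "measurable (N \<Otimes>\<^sub>M stdN) borel = measurable (borel \<Otimes>\<^sub>M borel :: (real \<times> real) measure) (borel :: real measure)"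
    by (intro measurable_cong_sets) simp_all
  then show ?thesis by simp
qed

lemma real_distribution_gauss_smooth: "real_distribution (gauss_smooth N c)"
  unfolding gauss_smooth_def by (rule P.real_distribution_distr) simp

text \<open>Levy inversion asks for endpoints without mass. By Fubini an atom at \<open>a\<close>
  would be an average over \<open>x\<close> of the normal mass of the single point
  \<open>(a - x) / c\<close>.\<close>

lemma gauss_smooth_no_atom:
  assumes "c \<noteq> 0" shows "measure (gauss_smooth N c) {a} = 0"
proof -
  have "emeasure (gauss_smooth N c) {a} = emeasure (N \<Otimes>\<^sub>M stdN) ((\<lambda>p. fst p + c * snd p) -` {a} \<inter> space (N \<Otimes>\<^sub>M stdN))"
    unfolding gauss_smooth_def by (subst emeasure_distr) auto
  also have "\<dots> = (\<integral>\<^sup>+x. emeasure stdN (Pair x -` ((\<lambda>p. fst p + c * snd p) -` {a} \<inter> space (N \<Otimes>\<^sub>M stdN))) \<partial>N)"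
    by (rule S.emeasure_pair_measure_alt[OF measurable_sets[OF pair_meas]]) simp
  also have "\<dots> = (\<integral>\<^sup>+x. 0 \<partial>N)"
  proof (rule nn_integral_cong)
    fix x
    have "Pair x -` ((\<lambda>p. fst p + c * snd p) -` {a} \<inter> space (N \<Otimes>\<^sub>M stdN)) = {(a - x) / c}"
      using assms by (auto simp: space_pair_measure field_simps)
    then show "emeasure stdN (Pair x -` ((\<lambda>p. fst p + c * snd p) -` {a} \<inter> space (N \<Otimes>\<^sub>M stdN))) = 0"
      by (simp add: stdN_singleton)
  qed
  finally show ?thesis by (simp add: measure_def)
qed

lemma char_gauss_smooth:
  "char (gauss_smooth N c) t = char N t * exp (- (c * t)\<^sup>2 / 2)"
proof -
  have "char (gauss_smooth N c) t = (CLINT p|N \<Otimes>\<^sub>M stdN. iexp (t * (fst p + c * snd p)))"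
    unfolding gauss_smooth_def char_def by (subst integral_distr) auto
  also have "\<dots> = (CLINT p|N \<Otimes>\<^sub>M stdN. iexp (t * fst p) * iexp ((t * c) * snd p))"
    by (intro Bochner_Integration.integral_cong) (auto simp: exp_add[symmetric] algebra_simps)
  also have "\<dots> = (CLINT x|N. (CLINT y|stdN. iexp (t * x) * iexp ((t * c) * y)))"
    by (subst P.integral_fst'[symmetric])
       (auto intro!: P.P.integrable_const_bound[where B=1] simp: norm_mult)
  also have "\<dots> = char N t * char stdN (t * c)"
    by (simp add: char_def)
  finally show ?thesis by (simp add: char_std_normal_distribution mult.commute)
qed

text \<open>Unless the normal variable exceeds \<open>a\<close> in modulus, smoothing moves a point
  by at most \<open>c * a\<close>. Both inequalities compare events on the product space up to this
  exceptional strip.\<close>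

lemma cdf_le_cdf_gauss_smooth:
  assumes "c \<ge> 0"
  shows "cdf N x \<le> cdf (gauss_smooth N c) (x + c * a) + measure stdN {v. \<bar>v\<bar> > a}"
    and "cdf (gauss_smooth N c) x \<le> cdf N (x + c * a) + measure stdN {v. \<bar>v\<bar> > a}"
proof -
  have sp: "space (N \<Otimes>\<^sub>M stdN) = UNIV" by (simp add: space_pair_measure)
  have m1: "{p. fst p + c * snd p \<le> y} \<in> P.P.events" for y
    using measurable_sets[OF pair_meas, of "{..y}"] by (simp add: vimage_def sp)
  have r: "UNIV \<times> {v. \<bar>v\<bar> > a} \<in> P.P.events" "{..y} \<times> UNIV \<in> P.P.events" for y
    by (intro pair_measureI; auto)+
  have prodN: "measure (N \<Otimes>\<^sub>M stdN) ({..y} \<times> UNIV) = cdf N y" for y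
    by (simp add: cdf_def2 S.emeasure_pair_measure_Times measure_def S.emeasure_space_1[simplified])
  have prodS: "measure (N \<Otimes>\<^sub>M stdN) (UNIV \<times> {v. \<bar>v\<bar> > a}) = measure stdN {v. \<bar>v\<bar> > a}"
    by (simp add: S.emeasure_pair_measure_Times measure_def N.emeasure_space_1[simplified])
  have sm: "cdf (gauss_smooth N c) y = measure (N \<Otimes>\<^sub>M stdN) {p. fst p + c * snd p \<le> y}" for y
    unfolding cdf_def gauss_smooth_def by (subst measure_distr) (auto simp: vimage_def sp)
  have "measure (N \<Otimes>\<^sub>M stdN) ({..x} \<times> UNIV) \<le> measure (N \<Otimes>\<^sub>M stdN)
     ({p. fst p + c * snd p \<le> x + c * a} \<union> UNIV \<times> {v. \<bar>v\<bar> > a})"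
  proof (rule P.P.finite_measure_mono)
    show "{..x} \<times> UNIV \<subseteq> {p. fst p + c * snd p \<le> x + c * a} \<union> UNIV \<times> {v. \<bar>v\<bar> > a}"
      using assms by (force intro!: add_mono mult_left_mono)
  qed (use m1 r in auto)
  also have "\<dots> \<le> measure (N \<Otimes>\<^sub>M stdN) {p. fst p + c * snd p \<le> x + c * a} + measure (N \<Otimes>\<^sub>M stdN) (UNIV \<times> {v. \<bar>v\<bar> > a})"
    by (rule measure_Un_le) (use m1 r in auto)
  finally show "cdf N x \<le> cdf (gauss_smooth N c) (x + c * a) + measure stdN {v. \<bar>v\<bar> > a}"
    by (simp add: prodN prodS sm)
  have "measure (N \<Otimes>\<^sub>M stdN) {p. fst p + c * snd p \<le> x} \<le> measure (N \<Otimes>\<^sub>M stdN)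
     ({..x + c * a} \<times> UNIV \<union> UNIV \<times> {v. \<bar>v\<bar> > a})"
  proof (rule P.P.finite_measure_mono)
    have "u \<le> x + c * a" if "u + c * v \<le> x" "\<not> \<bar>v\<bar> > a" for u v
    proof -
      have "c * (- v) \<le> c * a" using that assms by (intro mult_left_mono) auto
      then show ?thesis using that by simp
    qed
    then show "{p. fst p + c * snd p \<le> x} \<subseteq> {..x + c * a} \<times> UNIV \<union> UNIV \<times> {v. \<bar>v\<bar> > a}"
      by auto
  qed (use r in auto)
  also have "\<dots> \<le> measure (N \<Otimes>\<^sub>M stdN) ({..x + c * a} \<times> UNIV) + measure (N \<Otimes>\<^sub>M stdN) (UNIV \<times> {v. \<bar>v\<bar> > a})"
    by (rule measure_Un_le) (use r in auto)
  finally show "cdf (gauss_smooth N c) x \<le> cdf N (x + c * a) + measure stdN {v. \<bar>v\<bar> > a}"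
    by (simp add: prodN prodS sm)
qed

end

section \<open>From characteristic functions to distribution functions\<close>

lemma cmod_Levy_kernel:
  assumes "t \<noteq> 0"
  shows "cmod ((iexp (-(t * a)) - iexp (-(t * b))) / (\<i> * t)) \<le> 2 / \<bar>t\<bar>"
proof -
  have "cmod (iexp (-(t * a)) - iexp (-(t * b))) \<le> cmod (iexp (-(t * a))) + cmod (iexp (-(t * b)))"
    by (rule norm_triangle_ineq4)
  also have "\<dots> = 2"
    by (metis norm_exp_i_times of_real_minus one_add_one)
  finally show ?thesis
    using assms by (simp add: norm_divide norm_mult divide_right_mono)
qed

text \<open>Levy inversion is applied to both laws and subtracted. The kernel bound
  \<open>2 / \<bar>t\<bar>\<close> does not depend on the interval, so the left endpoint can be sent
  to minus infinity. Working with a majorant \<open>H\<close> leaves its value at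
  \<open>t = 0\<close> free.\<close>

lemma cdf_diff_le_char_diff:
  fixes M1 M2 :: "real measure"
  assumes M1: "real_distribution M1" and M2: "real_distribution M2"
    and na: "\<And>x. measure M1 {x} = 0" "\<And>x. measure M2 {x} = 0"
    and H: "integrable lborel H" "\<And>t. t \<noteq> 0 \<Longrightarrow> cmod (char M1 t - char M2 t) / \<bar>t\<bar> \<le> H t"
  shows "\<bar>cdf M1 x - cdf M2 x\<bar> \<le> integral\<^sup>L lborel H / pi"
proof -
  interpret M1: real_distribution M1 by (rule M1)
  interpret M2: real_distribution M2 by (rule M2)
  have Hnn: "H t \<ge> 0" if "t \<noteq> 0" for t
    by (rule order_trans[OF _ H(2)[OF that]]) simp
  have AEH: "AE t in lborel. 0 \<le> H t"
    using AE_lborel_singleton[of 0] by eventually_elim (simp add: Hnn)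
  have fin: "\<bar>measure M1 {a<..b} - measure M2 {a<..b}\<bar> \<le> integral\<^sup>L lborel H / pi"
    if "a \<le> b" for a b
  proof -
    define K where "K t = (iexp (-(t * a)) - iexp (-(t * b))) / (\<i> * t)" for t :: real
    have [measurable]: "K \<in> borel_measurable borel"
      unfolding K_def by measurable
    \<comment> \<open>Unlike \<open>2 / \<bar>t\<bar>\<close>, this bound stays finite near 0. It
      serves for integrability on bounded intervals.\<close>
    have Kb: "cmod (K t) \<le> b - a" if "t \<noteq> 0" for t
    proof -
      have "cmod ((iexp (t * - a) - iexp (t * - b)) / (\<i> * t)) \<le> -a - (-b)"
        by (rule Levy_Inversion_aux2) (use \<open>a \<le> b\<close> \<open>t \<noteq> 0\<close> in auto)
      then show ?thesis by (simp add: K_def)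
    qed
    have int: "complex_interval_lebesgue_integrable lborel (ereal (- real T)) (ereal (real T)) (\<lambda>t. K t * char M t)"
      if "real_distribution M" for T :: nat and M
    proof -
      interpret M: real_distribution M by fact
      have [simp]: "cmod (K t * char M t) \<le> b - a" if "t \<noteq> 0" for t
        using mult_mono[OF Kb[OF that] M.cmod_char_le_1[of t]] \<open>a \<le> b\<close>
        by (simp add: norm_mult)
      show ?thesis
        apply (simp add: interval_lebesgue_integrable_def set_integrable_def)
        apply (intro integrableI_bounded_set_indicator[where B="b - a"] conjI impI)
        apply (auto intro!: AE_I [of _ _ "{0}"])
        done
    qed
    have bound: "cmod (1 / (2 * pi) * (CLBINT t=-real T..real T. K t * char M1 t) - 1 / (2 * pi) * (CLBINT t=-real T..real T. K t * char M2 t))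
        \<le> integral\<^sup>L lborel H / pi" for T :: nat
    proof -
      have "(CLBINT t=-real T..real T. K t * char M1 t) - (CLBINT t=-real T..real T. K t * char M2 t)
        = (CLBINT t=-real T..real T. K t * char M1 t - K t * char M2 t)"
        using interval_lebesgue_integral_diff(2)[OF int[OF M1, of T] int[OF M2, of T]] by simp
      also have "\<dots> = (CLBINT t. indicator {-real T<..<real T} t *\<^sub>R (K t * (char M1 t - char M2 t)))"
        by (simp add: interval_lebesgue_integral_def set_lebesgue_integral_def algebra_simps)
      finally have eq: "(CLBINT t=-real T..real T. K t * char M1 t) - (CLBINT t=-real T..real T. K t * char M2 t)
        = (CLBINT t. indicator {-real T<..<real T} t *\<^sub>R (K t * (char M1 t - char M2 t)))" .
      have "cmod (CLBINT t. indicator {-real T<..<real T} t *\<^sub>R (K t * (char M1 t - char M2 t)))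
         \<le> (LBINT t. 2 * H t)"
      proof -
        have *: "AE t in lborel. cmod (indicator {-real T<..<real T} t *\<^sub>R (K t * (char M1 t - char M2 t))) \<le> 2 * H t"
          using AE_lborel_singleton[of 0]
        proof eventually_elim
          case (elim t)
          have "cmod (K t * (char M1 t - char M2 t)) \<le> 2 / \<bar>t\<bar> * cmod (char M1 t - char M2 t)"
            unfolding norm_mult K_def by (intro mult_right_mono cmod_Levy_kernel elim) simp
          also have "\<dots> \<le> 2 * H t" using H(2)[OF elim] by simp
          finally show ?case using Hnn[OF elim] by (auto split: split_indicator)
        qed
        have iH: "integrable lborel (\<lambda>t. 2 * H t)" using H(1) by simp
        then have "complex_integrable lborel (\<lambda>t. indicator {-real T<..<real T} t *\<^sub>R (K t * (char M1 t - char M2 t)))"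
          by (rule Bochner_Integration.integrable_bound) (use AEH * in auto)
        then show ?thesis
          by (intro order_trans[OF integral_norm_bound] integral_mono_AE iH integrable_norm *)
      qed
      then have "cmod ((CLBINT t=-real T..real T. K t * char M1 t) - (CLBINT t=-real T..real T. K t * char M2 t)) \<le> 2 * integral\<^sup>L lborel H"
        unfolding eq by simp
      then show ?thesis
        by (simp add: right_diff_distrib[symmetric] norm_mult norm_divide field_simps)
    qed
    have L: "(\<lambda>T. 1 / (2 * pi) * (CLBINT t=-real T..real T. K t * char M1 t) - 1 / (2 * pi) * (CLBINT t=-real T..real T. K t * char M2 t))
      \<longlonglongrightarrow> measure M1 {a<..b} - measure M2 {a<..b}"
      using tendsto_diff[OF M1.Levy_Inversion[OF that na(1) na(1)] M2.Levy_Inversion[OF that na(2) na(2)]]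
      by (simp add: K_def)
    have "cmod (measure M1 {a<..b} - measure M2 {a<..b}) \<le> integral\<^sup>L lborel H / pi"
      by (rule Lim_norm_ubound[OF _ L]) (use bound in \<open>auto intro!: always_eventually\<close>)
    then show ?thesis
      by (metis norm_of_real of_real_diff)
  qed
  have "((\<lambda>a. \<bar>(cdf M1 x - cdf M1 a) - (cdf M2 x - cdf M2 a)\<bar>) \<longlongrightarrow> \<bar>(cdf M1 x - 0) - (cdf M2 x - 0)\<bar>) at_bot"
    by (intro tendsto_intros M1.cdf_lim_at_bot M2.cdf_lim_at_bot)
  moreover have "eventually (\<lambda>a. \<bar>(cdf M1 x - cdf M1 a) - (cdf M2 x - cdf M2 a)\<bar> \<le> integral\<^sup>L lborel H / pi) at_bot"
    using eventually_gt_at_bot[of x] eventually_le_at_bot[of x]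
  proof -
    have "eventually (\<lambda>a. a < x) at_bot" unfolding eventually_at_bot_linorder by (auto intro: exI[of _ "x - 1"])
    then show ?thesis
    proof eventually_elim
      case (elim a)
      then show ?case using fin[of a x] M1.cdf_diff_eq[of a x] M2.cdf_diff_eq[of a x] by simp
    qed
  qed
  ultimately show ?thesis
    by (intro tendsto_upperbound[of _ _ at_bot]) auto
qed

section \<open>Gaussian integrals, tails and the smoothing inequality\<close>

lemma has_bochner_integral_gauss:
  assumes "0 < b"
  shows "has_bochner_integral lborel (\<lambda>t. exp (- b * t\<^sup>2)) (sqrt (pi / b))"
proof -
  define \<sigma> where "\<sigma> = sqrt (1 / (2 * b))"
  have \<sigma>: "\<sigma> > 0" "\<sigma>\<^sup>2 = 1 / (2 * b)" using assms by (auto simp: \<sigma>_def)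
  have "has_bochner_integral lborel (\<lambda>t. sqrt (pi / b) * normal_density 0 \<sigma> t) (sqrt (pi / b) * 1)"
    using integral_normal_density[of \<sigma> 0] \<sigma>(1)
    by (intro has_bochner_integral_mult_right) (auto simp: has_bochner_integral_iff)
  moreover have "sqrt (pi / b) * normal_density 0 \<sigma> t = exp (- b * t\<^sup>2)" for t
    using assms by (simp add: normal_density_def \<sigma>(2) real_sqrt_divide)
  ultimately show ?thesis by simp
qed

lemma integrable_abs_power_gauss:
  assumes "0 < b"
  shows "integrable lborel (\<lambda>t::real. \<bar>t\<bar> ^ k * exp (- b * t\<^sup>2))"
proof -
  define \<sigma> where "\<sigma> = sqrt (1 / (2 * b))"
  have \<sigma>: "\<sigma> > 0" "\<sigma>\<^sup>2 = 1 / (2 * b)" using assms by (auto simp: \<sigma>_def)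
  have "integrable lborel (\<lambda>t. sqrt (pi / b) * (normal_density 0 \<sigma> t * \<bar>t - 0\<bar> ^ k))"
    using integrable_normal_moment_abs[OF \<sigma>(1), of 0 k] by simp
  moreover have "sqrt (pi / b) * (normal_density 0 \<sigma> t * \<bar>t - 0\<bar> ^ k) = \<bar>t\<bar> ^ k * exp (- b * t\<^sup>2)" for t
    using assms by (simp add: normal_density_def \<sigma>(2) real_sqrt_divide)
  ultimately show ?thesis by (simp only:)
qed

text \<open>Where \<open>\<bar>x\<bar> > a\<close>, half of the exponent pays for the factor
  \<open>exp (- a\<^sup>2 / 4)\<close>; the other half leaves a Gaussian integral equal to
  \<open>sqrt 2\<close> after normalisation, rounded up to 2.\<close>

lemma stdN_tail:
  assumes "a \<ge> 0" shows "measure stdN {v. \<bar>v\<bar> > a} \<le> 2 * exp (- a\<^sup>2 / 4)"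
proof -
  interpret S: real_distribution stdN by (rule real_dist_normal_dist)
  let ?g = "\<lambda>x::real. exp (- (1/4) * x\<^sup>2)"
  have g: "has_bochner_integral lborel ?g (sqrt (pi / (1/4)))"
    by (rule has_bochner_integral_gauss) simp
  have "measure stdN {v. \<bar>v\<bar> > a} = integral\<^sup>L stdN (indicator {v. \<bar>v\<bar> > a})"
    by simp
  also have "\<dots> = (LBINT x. std_normal_density x * indicator {v. \<bar>v\<bar> > a} x)"
    by (subst integral_density) auto
  also have "\<dots> \<le> (LBINT x. (exp (- a\<^sup>2 / 4) / sqrt (2 * pi)) * ?g x)"
  proof (rule integral_mono')
    show "integrable lborel (\<lambda>x. (exp (- a\<^sup>2 / 4) / sqrt (2 * pi)) * ?g x)"
      using g by (auto simp: has_bochner_integral_iff)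
    show "std_normal_density x * indicator {v. \<bar>v\<bar> > a} x \<le> (exp (- a\<^sup>2 / 4) / sqrt (2 * pi)) * ?g x" for x
    proof (cases "\<bar>x\<bar> > a")
      case True
      then have "a\<^sup>2 \<le> x\<^sup>2" using assms by (metis abs_of_nonneg less_imp_le abs_le_square_iff)
      then have "- x\<^sup>2 / 2 \<le> - a\<^sup>2 / 4 + - (1/4) * x\<^sup>2" by simp
      then have "exp (- x\<^sup>2 / 2) \<le> exp (- a\<^sup>2 / 4) * ?g x" by (subst exp_add[symmetric]) simp
      then show ?thesis using True by (simp add: std_normal_density_def divide_right_mono)
    qed auto
  qed auto
  also have "\<dots> = (exp (- a\<^sup>2 / 4) / sqrt (2 * pi)) * sqrt (pi / (1/4))"
    using g by (subst integral_mult_right_zero) (simp add: has_bochner_integral_integral_eq)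
  also have "\<dots> = sqrt 2 * exp (- a\<^sup>2 / 4)"
    by (simp add: real_sqrt_mult real_sqrt_divide)
      (simp add: field_simps flip: real_sqrt_mult)
  also have "\<dots> \<le> 2 * exp (- a\<^sup>2 / 4)"
    by (intro mult_right_mono) (auto intro: real_le_lsqrt)
  finally show ?thesis .
qed

text \<open>The standard normal density is at most \<open>1 / sqrt (2 * pi)\<close>. The crude
  constant 1 suffices, as only the order of the final bound matters.\<close>

lemma cdf_stdN_lipschitz:
  assumes "x \<le> y" shows "cdf stdN y \<le> cdf stdN x + (y - x)"
proof (cases "x = y")
  case False
  then have xy: "x < y" using assms by simp
  interpret S: real_distribution stdN by (rule real_dist_normal_dist)
  have "cdf stdN y - cdf stdN x = measure stdN {x<..y}"
    by (rule S.cdf_diff_eq[OF xy])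
  also have "\<dots> = integral\<^sup>L stdN (indicator {x<..y})" by simp
  also have "\<dots> = (LBINT u. std_normal_density u * indicator {x<..y} u)"
    by (subst integral_density) auto
  also have "\<dots> \<le> (LBINT u. indicator {x<..y} u)"
  proof (rule integral_mono')
    have "std_normal_density u \<le> 1" for u
    proof -
      have "1 \<le> sqrt (2 * pi)" using pi_ge_two by (intro real_le_rsqrt) auto
      then have "1 / sqrt (2 * pi) * exp (- u\<^sup>2 / 2) \<le> 1 * 1" by (intro mult_mono) auto
      then show ?thesis by (simp add: std_normal_density_def)
    qed
    then show "std_normal_density u * indicator {x<..y} u \<le> indicator {x<..y} u" for u
      by (auto split: split_indicator)
  qed (use xy in auto)
  also have "\<dots> = y - x" using xy by simp
  finally show ?thesis by simp
qed simp

text \<open>\<open>N\<close> and the centered normal law \<open>G\<close> of variance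
  \<open>s\<^sup>2\<close> are both smoothed and compared through their characteristic functions.
  Removing the smoothing costs a shift \<open>c * a\<close> and a tail
  \<open>2 * exp (- a\<^sup>2 / 4)\<close> for each of the two laws; the Lipschitz bound pays for
  the total shift.\<close>

lemma berry_esseen_smoothing:
  fixes N :: "real measure"
  assumes N: "real_distribution N" and s: "s > 0" and c: "c > 0" and a: "a \<ge> 0"
    and H: "integrable lborel H"
      "\<And>t. t \<noteq> 0 \<Longrightarrow> cmod (char N t - complex_of_real (exp (- (s * t)\<^sup>2 / 2))) * exp (- (c * t)\<^sup>2 / 2) / \<bar>t\<bar> \<le> H t"
  shows "\<bar>cdf N x - cdf stdN (x / s)\<bar> \<le> integral\<^sup>L lborel H / pi + 2 * c * a / s + 4 * exp (- a\<^sup>2 / 4)"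
proof -
  define G where "G = distr stdN borel (\<lambda>z. s * z)"
  interpret S: real_distribution stdN by (rule real_dist_normal_dist)
  have G: "real_distribution G" unfolding G_def by (rule S.real_distribution_distr) simp
  have cG: "char G t = complex_of_real (exp (- (s * t)\<^sup>2 / 2))" for t
  proof -
    have "char G t = char stdN (t * s)"
      unfolding G_def char_def by (subst integral_distr) (auto simp: mult_ac)
    then show ?thesis by (simp add: char_std_normal_distribution mult_ac)
  qed
  have cdfG: "cdf G x = cdf stdN (x / s)" for x
  proof -
    have "(\<lambda>z. s * z) -` {..x} = {..x / s}" using s by (auto simp: field_simps)
    then show ?thesis unfolding G_def cdf_def by (subst measure_distr) auto
  qed
  have e: "\<bar>cdf (gauss_smooth N c) y - cdf (gauss_smooth G c) y\<bar> \<le> integral\<^sup>L lborel H / pi" for y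
  proof (rule cdf_diff_le_char_diff[OF real_distribution_gauss_smooth[OF N] real_distribution_gauss_smooth[OF G] _ _ H(1)])
    fix t :: real assume "t \<noteq> 0"
    have "char (gauss_smooth N c) t - char (gauss_smooth G c) t
      = (char N t - complex_of_real (exp (- (s * t)\<^sup>2 / 2))) * complex_of_real (exp (- (c * t)\<^sup>2 / 2))"
      by (simp add: char_gauss_smooth[OF N] char_gauss_smooth[OF G] cG left_diff_distrib)
    then have "cmod (char (gauss_smooth N c) t - char (gauss_smooth G c) t)
      = cmod (char N t - complex_of_real (exp (- (s * t)\<^sup>2 / 2))) * exp (- (c * t)\<^sup>2 / 2)"
      by (simp only: norm_mult norm_of_real) simp
    then show "cmod (char (gauss_smooth N c) t - char (gauss_smooth G c) t) / \<bar>t\<bar> \<le> H t"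
      using H(2)[OF \<open>t \<noteq> 0\<close>] by simp
  qed (use c in \<open>auto intro: gauss_smooth_no_atom N G\<close>)
  note tl = stdN_tail[OF a]
  have "cdf N x \<le> cdf (gauss_smooth N c) (x + c * a) + 2 * exp (- a\<^sup>2 / 4)"
    using cdf_le_cdf_gauss_smooth(1)[OF N, of c x a] c tl by simp
  also have "\<dots> \<le> cdf (gauss_smooth G c) (x + c * a) + integral\<^sup>L lborel H / pi + 2 * exp (- a\<^sup>2 / 4)"
    using e[of "x + c * a"] by simp
  also have "\<dots> \<le> cdf G (x + c * a + c * a) + integral\<^sup>L lborel H / pi + 4 * exp (- a\<^sup>2 / 4)"
    using cdf_le_cdf_gauss_smooth(2)[OF G, of c "x + c * a" a] c tl by simp
  also have "cdf G (x + c * a + c * a) \<le> cdf stdN (x / s) + 2 * c * a / s"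
    using cdf_stdN_lipschitz[of "x / s" "(x + c * a + c * a) / s"] s c a unfolding cdfG
    by (simp add: field_simps)
  finally have up: "cdf N x \<le> cdf stdN (x / s) + (integral\<^sup>L lborel H / pi + 2 * c * a / s + 4 * exp (- a\<^sup>2 / 4))"
    by simp
  have "cdf stdN (x / s) \<le> cdf G (x - c * a - c * a) + 2 * c * a / s"
    using cdf_stdN_lipschitz[of "(x - c * a - c * a) / s" "x / s"] s c a unfolding cdfG
    by (simp add: field_simps)
  also have "cdf G (x - c * a - c * a) \<le> cdf (gauss_smooth G c) (x - c * a) + 2 * exp (- a\<^sup>2 / 4)"
    using cdf_le_cdf_gauss_smooth(1)[OF G, of c "x - c * a - c * a" a] c tl by (simp add: mult.commute)
  also have "cdf (gauss_smooth G c) (x - c * a) \<le> cdf (gauss_smooth N c) (x - c * a) + integral\<^sup>L lborel H / pi"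
    using e[of "x - c * a"] by simp
  also have "cdf (gauss_smooth N c) (x - c * a) \<le> cdf N x + 2 * exp (- a\<^sup>2 / 4)"
    using cdf_le_cdf_gauss_smooth(2)[OF N, of c "x - c * a" a] c tl by simp
  finally show ?thesis using up by (simp add: abs_le_iff)
qed

text \<open>Smoothing with standard deviation of order \<open>sqrt (ln n / n)\<close> makes the contribution of
  \<open>\<bar>t\<bar> > c0 * sqrt n\<close>, where nothing is known about the characteristic function, of order \<open>1 / n\<close>.\<close>

lemma berry_esseen_rate:
  fixes N :: "nat \<Rightarrow> real measure"
  assumes N: "\<And>n. real_distribution (N n)" and s: "s > 0" and c0: "c0 > 0" and C: "C \<ge> 0"
    and ch: "\<And>n t. n \<ge> 1 \<Longrightarrow> \<bar>t\<bar> \<le> c0 * sqrt n \<Longrightarrow>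
      cmod (char (N n) t - complex_of_real (exp (- (s * t)\<^sup>2 / 2))) \<le> C * (t\<^sup>2 / n + \<bar>t\<bar>^3 / sqrt n) * exp (- (s\<^sup>2 / 4) * t\<^sup>2)"
  shows "\<exists>K. \<forall>n\<ge>2. \<forall>x. \<bar>cdf (N n) x - cdf stdN (x / s)\<bar> \<le> K * ln n / sqrt n"
proof -
  \<comment> \<open>The bound on the characteristic functions after division by
    \<open>\<bar>t\<bar>\<close> and after replacing \<open>1 / n\<close> by
    \<open>1 / sqrt n\<close>.\<close>
  define g where "g t = (\<bar>t\<bar> ^ 1 * exp (- (s\<^sup>2 / 4) * t\<^sup>2)) + (\<bar>t\<bar> ^ 2 * exp (- (s\<^sup>2 / 4) * t\<^sup>2))" for t :: real
  have g: "integrable lborel g"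
    unfolding g_def using s by (intro Bochner_Integration.integrable_add integrable_abs_power_gauss) auto
  have gnn: "integral\<^sup>L lborel g \<ge> 0"
    by (rule Bochner_Integration.integral_nonneg) (simp add: g_def)
  define K where "K = 2 * C * integral\<^sup>L lborel g / pi + 8 * sqrt pi / pi + 8 / (c0 * s) + 8"
  have "\<bar>cdf (N n) x - cdf stdN (x / s)\<bar> \<le> K * ln n / sqrt n" if n: "n \<ge> 2" for n :: nat and x
  proof -
    \<comment> \<open>Chosen so that \<open>(c * t)\<^sup>2 / 4\<close> is at least
      \<open>ln n\<close> once \<open>\<bar>t\<bar>\<close> exceeds \<open>c0 * sqrt n\<close>; the
      choice of \<open>a\<close> makes \<open>exp (- a\<^sup>2 / 4)\<close> equal to
      \<open>1 / n\<close>. The shift \<open>c * a\<close> is then of order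
      \<open>ln n / sqrt n\<close>.\<close>
    define c where "c = 2 / c0 * sqrt (ln n / n)"
    define a where "a = 2 * sqrt (ln n)"
    have "ln 2 \<le> ln (real n)" using n by simp
    then have lnn: "ln n \<ge> 1/2" using ln2_ge_two_thirds by linarith
    have c: "c > 0" using n lnn c0 by (auto simp: c_def)
    have c2: "c\<^sup>2 = 4 / c0\<^sup>2 * (ln n / n)" using lnn by (simp add: c_def power_mult_distrib power_divide)
    have a: "a \<ge> 0" "a\<^sup>2 / 4 = ln n" using lnn by (auto simp: a_def power_mult_distrib)
    let ?e = "\<lambda>t::real. exp (- (c\<^sup>2 / 4) * t\<^sup>2)"
    \<comment> \<open>In the range of large \<open>t\<close> the smoothing factor is split into two
      halves: one yields \<open>1 / n\<close>, the other keeps the Gaussian integrable. The number 2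
      bounds the difference of the transforms there.\<close>
    define H where "H t = C / sqrt n * g t + 2 / (c0 * sqrt n) * (1 / n) * ?e t" for t
    have ge: "has_bochner_integral lborel ?e (sqrt (pi / (c\<^sup>2 / 4)))"
      using c by (intro has_bochner_integral_gauss) auto
    have H: "integrable lborel H"
      unfolding H_def using g ge by (auto simp: has_bochner_integral_iff)
    have "integral\<^sup>L lborel H = C / sqrt n * integral\<^sup>L lborel g + 2 / (c0 * sqrt n) * (1 / n) * (sqrt pi * 2 / c)"
      unfolding H_def using g ge c
      by (simp add: has_bochner_integral_iff real_sqrt_divide real_sqrt_mult)
    also have "2 / (c0 * sqrt n) * (1 / n) * (sqrt pi * 2 / c) = 2 * sqrt pi / (n * sqrt (ln n))"
      using c0 n lnn by (simp add: c_def real_sqrt_divide field_simps)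
    also have "\<dots> \<le> 8 * sqrt pi * ln n / sqrt n"
    proof -
      have *: "1/2 \<le> sqrt (ln n)" using lnn by (intro real_le_rsqrt) (simp add: power2_eq_square)
      have **: "sqrt n \<le> n" using n
        by (intro real_le_lsqrt) (auto simp: power2_eq_square)
      have "2 * sqrt pi / (n * sqrt (ln n)) \<le> 2 * sqrt pi / (sqrt n * (1/2))"
        using * ** n by (intro divide_left_mono mult_mono) auto
      also have "\<dots> = 4 * sqrt pi * 1 / sqrt n" by simp
      also have "\<dots> \<le> 4 * sqrt pi * (2 * ln n) / sqrt n"
        using lnn by (intro divide_right_mono mult_left_mono) auto
      finally show ?thesis by simp
    qed
    finally have IH: "integral\<^sup>L lborel H \<le> C / sqrt n * integral\<^sup>L lborel g + 8 * sqrt pi * ln n / sqrt n" by simp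
    have Hb: "cmod (char (N n) t - complex_of_real (exp (- (s * t)\<^sup>2 / 2))) * exp (- (c * t)\<^sup>2 / 2) / \<bar>t\<bar> \<le> H t" if "t \<noteq> 0" for t
    proof (cases "\<bar>t\<bar> \<le> c0 * sqrt n")
      case True
      have sn: "sqrt n \<le> n" using n by (intro real_le_lsqrt) (auto simp: power2_eq_square)
      have "t\<^sup>2 / n + \<bar>t\<bar>^3 / sqrt n \<le> t\<^sup>2 / sqrt n + \<bar>t\<bar>^3 / sqrt n"
        using sn n by (intro add_mono divide_left_mono) auto
      also have "\<dots> = \<bar>t\<bar> * (\<bar>t\<bar>^1 + \<bar>t\<bar>^2) / sqrt n"
        by (simp add: distrib_left add_divide_distrib power2_eq_square power3_eq_cube mult.assoc)
      finally have *: "t\<^sup>2 / n + \<bar>t\<bar>^3 / sqrt n \<le> \<bar>t\<bar> * (\<bar>t\<bar>^1 + \<bar>t\<bar>^2) / sqrt n" .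
      have "cmod (char (N n) t - complex_of_real (exp (- (s * t)\<^sup>2 / 2))) * exp (- (c * t)\<^sup>2 / 2)
         \<le> cmod (char (N n) t - complex_of_real (exp (- (s * t)\<^sup>2 / 2))) * 1"
        by (intro mult_left_mono) auto
      also have "\<dots> \<le> C * (t\<^sup>2 / n + \<bar>t\<bar>^3 / sqrt n) * exp (- (s\<^sup>2 / 4) * t\<^sup>2)"
        using ch[OF _ True] n by simp
      also have "\<dots> \<le> C * (\<bar>t\<bar> * (\<bar>t\<bar>^1 + \<bar>t\<bar>^2) / sqrt n) * exp (- (s\<^sup>2 / 4) * t\<^sup>2)"
        using * C by (intro mult_right_mono mult_left_mono) auto
      also have "\<dots> = \<bar>t\<bar> * (C / sqrt n * g t)"
        by (simp add: g_def field_simps)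
      also have "\<dots> \<le> \<bar>t\<bar> * H t"
        using c0 by (intro mult_left_mono) (auto simp: H_def)
      finally show ?thesis using that by (simp add: field_simps)
    next
      case False
      interpret Nn: real_distribution "N n" by (rule N)
      have "cmod (char (N n) t - complex_of_real (exp (- (s * t)\<^sup>2 / 2))) \<le> 1 + 1"
        using Nn.cmod_char_le_1[of t]
        by (intro order_trans[OF norm_triangle_ineq4] add_mono) auto
      moreover have "exp (- (c * t)\<^sup>2 / 2) \<le> (1 / n) * ?e t"
      proof -
        have "(c0 * sqrt n)\<^sup>2 \<le> \<bar>t\<bar>\<^sup>2" using False c0 by (intro power_mono) auto
        then have "c0\<^sup>2 * n \<le> t\<^sup>2" by (simp add: power_mult_distrib)
        then have "c\<^sup>2 / 4 * (c0\<^sup>2 * n) \<le> c\<^sup>2 / 4 * t\<^sup>2" by (intro mult_left_mono) auto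
        moreover have "c\<^sup>2 / 4 * (c0\<^sup>2 * n) = ln n" unfolding c2 using c0 n by simp
        ultimately have "- (c * t)\<^sup>2 / 2 \<le> - ln n + - (c\<^sup>2 / 4) * t\<^sup>2"
          by (simp add: power_mult_distrib)
        then have "exp (- (c * t)\<^sup>2 / 2) \<le> exp (- ln n) * ?e t"
          by (subst exp_add[symmetric]) simp
        then show ?thesis using n by (simp add: exp_minus field_simps)
      qed
      ultimately have "cmod (char (N n) t - complex_of_real (exp (- (s * t)\<^sup>2 / 2))) * exp (- (c * t)\<^sup>2 / 2) \<le> 2 * ((1 / n) * ?e t)"
        by (intro mult_mono) auto
      then have "cmod (char (N n) t - complex_of_real (exp (- (s * t)\<^sup>2 / 2))) * exp (- (c * t)\<^sup>2 / 2) / \<bar>t\<bar> \<le> 2 * ((1 / n) * ?e t) / (c0 * sqrt n)"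
        using False c0 n by (intro frac_le) auto
      also have "\<dots> \<le> H t"
      proof -
        have "0 \<le> C / sqrt n * g t" using C by (simp add: g_def)
        then show ?thesis by (simp add: H_def mult_ac)
      qed
      finally show ?thesis .
    qed
    have "\<bar>cdf (N n) x - cdf stdN (x / s)\<bar> \<le> integral\<^sup>L lborel H / pi + 2 * c * a / s + 4 * exp (- a\<^sup>2 / 4)"
      by (rule berry_esseen_smoothing[OF N s c a(1) H Hb])
    also have "4 * exp (- a\<^sup>2 / 4) = 4 / n" using a(2) n by (simp add: exp_minus field_simps)
    also have "2 * c * a / s = 8 / (c0 * s) * ln n / sqrt n"
      using lnn by (simp add: c_def a_def real_sqrt_divide)
    also have "4 / n \<le> 8 * ln n / sqrt n"
    proof -
      have "sqrt n \<le> n" using n by (intro real_le_lsqrt) (auto simp: power2_eq_square)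
      then have "4 / n \<le> 4 / sqrt n" using n by (intro divide_left_mono) auto
      also have "\<dots> \<le> (8 * ln n) / sqrt n" using lnn by (intro divide_right_mono) auto
      finally show ?thesis .
    qed
    also have "integral\<^sup>L lborel H / pi \<le> (2 * C * integral\<^sup>L lborel g / pi + 8 * sqrt pi / pi) * ln n / sqrt n"
    proof -
      have "C / sqrt n * integral\<^sup>L lborel g * 1 \<le> C / sqrt n * integral\<^sup>L lborel g * (2 * ln n)"
        using C gnn lnn by (intro mult_left_mono) auto
      then have "integral\<^sup>L lborel H \<le> (2 * C * integral\<^sup>L lborel g + 8 * sqrt pi) * ln n / sqrt n"
        using IH by (simp add: add_divide_distrib distrib_right distrib_left mult_ac)
      then have "integral\<^sup>L lborel H / pi \<le> (2 * C * integral\<^sup>L lborel g + 8 * sqrt pi) * ln n / sqrt n / pi"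
        by (intro divide_right_mono) auto
      then show ?thesis by (simp add: field_simps)
    qed
    finally show ?thesis by (simp add: K_def add_divide_distrib distrib_right)
  qed
  then show ?thesis by blast
qed

section \<open>Markov operators that contract on average\<close>

text \<open>The gauge \<open>D\<close> need not satisfy the triangle inequality.\<close>

locale markov_contraction = prob_space \<mu> for \<mu> :: "'g measure" +
  fixes X :: "'x set" and act :: "'g \<Rightarrow> 'x \<Rightarrow> 'x" and D :: "'x \<Rightarrow> 'x \<Rightarrow> real"
    and B B' a :: real and x0 :: 'x
  assumes x0: "x0 \<in> X"
    and act_X: "\<And>g x. g \<in> space \<mu> \<Longrightarrow> x \<in> X \<Longrightarrow> act g x \<in> X"
    and D_nonneg: "\<And>x y. x \<in> X \<Longrightarrow> y \<in> X \<Longrightarrow> 0 \<le> D x y"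
    and D_le: "\<And>x y. x \<in> X \<Longrightarrow> y \<in> X \<Longrightarrow> D x y \<le> B"
    and a: "0 < a" "a < 1"
    and D_meas: "\<And>x y. x \<in> X \<Longrightarrow> y \<in> X \<Longrightarrow> (\<lambda>g. D (act g x) (act g y)) \<in> borel_measurable \<mu>"
    and contraction: "\<And>x y. x \<in> X \<Longrightarrow> y \<in> X \<Longrightarrow> (\<integral>g. D (act g x) (act g y) \<partial>\<mu>) \<le> a * D x y"
    and B': "0 \<le> B'"
    and D_act: "\<And>g x y. g \<in> space \<mu> \<Longrightarrow> x \<in> X \<Longrightarrow> y \<in> X \<Longrightarrow> D (act g x) (act g y) \<le> B' * D x y"
    and lip_meas_real: "\<And>f c x. \<lbrakk>\<And>u v. u \<in> X \<Longrightarrow> v \<in> X \<Longrightarrow> \<bar>f u - f v\<bar> \<le> c * D u v; x \<in> X\<rbrakk>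
      \<Longrightarrow> (\<lambda>g. f (act g x) :: real) \<in> borel_measurable \<mu>"
begin

definition lip :: "real \<Rightarrow> ('x \<Rightarrow> 'b::euclidean_space) \<Rightarrow> bool" where
  "lip c f \<longleftrightarrow> 0 \<le> c \<and> (\<forall>x\<in>X. \<forall>y\<in>X. norm (f x - f y) \<le> c * D x y)"

definition P :: "('x \<Rightarrow> 'b::euclidean_space) \<Rightarrow> 'x \<Rightarrow> 'b" where
  "P f x = (\<integral>g. f (act g x) \<partial>\<mu>)"

lemma B_nonneg: "0 \<le> B"
  using D_nonneg[OF x0 x0] D_le[OF x0 x0] by simp

lemma lipD: "lip c f \<Longrightarrow> x \<in> X \<Longrightarrow> y \<in> X \<Longrightarrow> norm (f x - f y) \<le> c * D x y"
  by (simp add: lip_def)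

lemma lip_nonneg: "lip c f \<Longrightarrow> 0 \<le> c"
  by (simp add: lip_def)

lemma lip_osc: "lip c f \<Longrightarrow> x \<in> X \<Longrightarrow> y \<in> X \<Longrightarrow> norm (f x - f y) \<le> c * B"
  using lipD[of c f x y] mult_left_mono[OF D_le[of x y] lip_nonneg[of c f]] by simp

lemma lip_mono: "lip c f \<Longrightarrow> c \<le> c' \<Longrightarrow> lip c' f"
  unfolding lip_def using mult_right_mono[OF _ D_nonneg, of c c'] by (meson order_trans)

lemma lip_const: "lip 0 (\<lambda>_. b)"
  by (simp add: lip_def)

text \<open>The locale grants measurability for real functions; coordinates carry it to Euclidean
  values, in particular to complex ones.\<close>

lemma lip_meas:
  fixes f :: "'x \<Rightarrow> 'b::euclidean_space"
  assumes "lip c f" "x \<in> X"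
  shows "(\<lambda>g. f (act g x)) \<in> borel_measurable \<mu>"
proof (subst borel_measurable_euclidean_space, rule ballI)
  fix i :: 'b assume i: "i \<in> Basis"
  show "(\<lambda>g. f (act g x) \<bullet> i) \<in> borel_measurable \<mu>"
  proof (rule lip_meas_real[where c=c, OF _ assms(2)])
    fix u v assume "u \<in> X" "v \<in> X"
    have "\<bar>f u \<bullet> i - f v \<bullet> i\<bar> \<le> norm (f u - f v)"
      using Basis_le_norm[OF i, of "f u - f v"] by (simp add: inner_diff_left)
    also have "\<dots> \<le> c * D u v" using lipD[OF assms(1)] \<open>u \<in> X\<close> \<open>v \<in> X\<close> by simp
    finally show "\<bar>f u \<bullet> i - f v \<bullet> i\<bar> \<le> c * D u v" .
  qed
qed

lemma lip_bdd: "lip c f \<Longrightarrow> x \<in> X \<Longrightarrow> norm (f x) \<le> norm (f x0) + c * B"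
  using lip_osc[of c f x x0] x0 norm_triangle_ineq2[of "f x" "f x0"] by simp

lemma lip_integrable:
  assumes "lip c f" "x \<in> X"
  shows "integrable \<mu> (\<lambda>g. f (act g x))"
  by (rule integrable_const_bound[where B="norm (f x0) + c * B"])
     (auto intro!: AE_I2 lip_bdd[OF assms(1)] lip_meas[OF assms] act_X assms(2))

lemma D_integrable:
  assumes "x \<in> X" "y \<in> X"
  shows "integrable \<mu> (\<lambda>g. D (act g x) (act g y))"
  by (rule integrable_const_bound[where B=B])
     (use assms D_nonneg D_le act_X D_meas in \<open>auto\<close>)

text \<open>Integrability of \<open>h\<close> is settled by cases: a non-integrable function has
  Bochner integral 0 by convention, and \<open>w\<close> is nonnegative because it dominates a
  norm.\<close>

lemma norm_integral_le:
  fixes h :: "'g \<Rightarrow> 'b::{banach,second_countable_topology}"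
  assumes "integrable \<mu> w" "\<And>g. g \<in> space \<mu> \<Longrightarrow> norm (h g) \<le> w g"
  shows "norm (\<integral>g. h g \<partial>\<mu>) \<le> (\<integral>g. w g \<partial>\<mu>)"
proof (cases "integrable \<mu> h")
  case True
  then show ?thesis
    by (intro order_trans[OF integral_norm_bound] integral_mono) (use assms in auto)
next
  case False
  have "0 \<le> (\<integral>g. w g \<partial>\<mu>)"
    by (rule integral_nonneg_AE) (use assms(2) norm_ge_zero order_trans in \<open>blast intro: AE_I2\<close>)
  then show ?thesis using False by (simp add: not_integrable_integral_eq)
qed

lemma P_bdd:
  assumes "\<And>x. x \<in> X \<Longrightarrow> norm (f x) \<le> b" "x \<in> X"
  shows "norm (P f x) \<le> b"
  using norm_integral_le[of "\<lambda>_. b" "\<lambda>g. f (act g x)"] assms act_X by (simp add: P_def prob_space)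

lemma P_lip:
  fixes f :: "'x \<Rightarrow> 'b::euclidean_space"
  assumes f: "lip c f"
  shows "lip (a * c) (P f)"
  unfolding lip_def
proof (intro conjI ballI)
  show "0 \<le> a * c" using a lip_nonneg[OF f] by simp
  fix x y assume xy: "x \<in> X" "y \<in> X"
  have "P f x - P f y = (\<integral>g. f (act g x) - f (act g y) \<partial>\<mu>)"
    unfolding P_def using lip_integrable[OF f] xy by simp
  also have "norm \<dots> \<le> (\<integral>g. c * D (act g x) (act g y) \<partial>\<mu>)"
    by (rule norm_integral_le) (use xy D_integrable lipD[OF f] act_X in auto)
  also have "\<dots> \<le> c * (a * D x y)"
    using mult_left_mono[OF contraction lip_nonneg[OF f]] xy by simp
  finally show "norm (P f x - P f y) \<le> a * c * D x y" by (simp add: mult_ac)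
qed

lemma P_iter_lip: "lip c f \<Longrightarrow> lip (a ^ k * c) ((P ^^ k) f)"
  by (induction k) (auto dest: P_lip simp: mult_ac)

text \<open>An iterate of \<open>P\<close> averages values of \<open>f\<close> at points of
  \<open>X\<close>, each within \<open>c * B\<close> of \<open>f y\<close>.\<close>

lemma P_iter_osc:
  assumes f: "lip c f" and y: "y \<in> X"
  shows "x \<in> X \<Longrightarrow> norm ((P ^^ j) f x - f y) \<le> c * B"
proof (induction j arbitrary: x)
  case 0
  then show ?case using lip_osc[OF f] y by simp
next
  case (Suc j)
  have "(P ^^ Suc j) f x - f y = (\<integral>g. (P ^^ j) f (act g x) - f y \<partial>\<mu>)"
    using lip_integrable[OF P_iter_lip[OF f] Suc.prems, of j] by (simp add: P_def prob_space)
  also have "norm \<dots> \<le> (\<integral>g. c * B \<partial>\<mu>)"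
    by (rule norm_integral_le) (use Suc act_X in auto)
  finally show ?case by (simp add: prob_space)
qed

text \<open>Of the \<open>j\<close> steps, \<open>k\<close> shrink the Lipschitz constant to
  \<open>a ^ k * c\<close>; the remaining \<open>j - k\<close> averagings cannot leave the
  oscillation of that function. The result is a Cauchy property with geometric rate.\<close>

lemma P_iter_iter_osc:
  assumes f: "lip c f" and xy: "x \<in> X" "y \<in> X" and "k \<le> j"
  shows "norm ((P ^^ j) f x - (P ^^ k) f y) \<le> a ^ k * c * B"
proof -
  have "(P ^^ j) f = (P ^^ (j - k)) ((P ^^ k) f)"
    using \<open>k \<le> j\<close> by (simp add: funpow_add[symmetric, THEN fun_cong, unfolded comp_def])
  then show ?thesis using P_iter_osc[OF P_iter_lip[OF f] xy(2,1)] by simp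
qed

text \<open>The stationary mean, as a functional on Lipschitz functions. Defining it as a limit of
  iterates at the base point avoids constructing a measure on \<open>X\<close>; its linearity and
  invariance then have to be derived.\<close>

definition nu :: "('x \<Rightarrow> 'b::euclidean_space) \<Rightarrow> 'b" where
  "nu f = lim (\<lambda>k. (P ^^ k) f x0)"

lemma geo0: "(\<lambda>k. a ^ k * c) \<longlonglongrightarrow> 0"
  using a by (intro tendsto_mult_left_zero LIMSEQ_power_zero) auto

lemma nu_tendsto0:
  assumes f: "lip c f" shows "(\<lambda>k. (P ^^ k) f x0) \<longlonglongrightarrow> nu f"
proof -
  have "Cauchy (\<lambda>k. (P ^^ k) f x0)"
    unfolding Cauchy_altdef2
  proof (intro allI impI)
    fix e :: real assume "0 < e"
    then obtain k where "\<bar>a ^ k * (c * B)\<bar> < e"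
      using LIMSEQ_D[OF geo0, of e "c * B"] by auto
    then show "\<exists>N. \<forall>n\<ge>N. dist ((P ^^ n) f x0) ((P ^^ N) f x0) < e"
      using P_iter_iter_osc[OF f x0 x0, of k]
      by (intro exI[of _ k]) (fastforce simp: dist_norm mult.assoc intro: le_less_trans[OF _ le_less_trans[OF abs_ge_self]])
  qed
  then show ?thesis unfolding nu_def
    by (simp add: Cauchy_convergent_iff convergent_LIMSEQ_iff)
qed

text \<open>Letting \<open>j\<close> tend to infinity in \<open>P_iter_iter_osc\<close> shows that
  the limit does not depend on the starting point. The Poisson series and the variance estimate rest
  on the geometric rate.\<close>

lemma nu_close:
  assumes f: "lip c f" and x: "x \<in> X"
  shows "norm ((P ^^ k) f x - nu f) \<le> a ^ k * c * B"
proof (rule Lim_norm_ubound[of sequentially])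
  show "(\<lambda>j. (P ^^ k) f x - (P ^^ j) f x0) \<longlonglongrightarrow> (P ^^ k) f x - nu f"
    by (intro tendsto_intros nu_tendsto0[OF f])
  show "\<forall>\<^sub>F j in sequentially. norm ((P ^^ k) f x - (P ^^ j) f x0) \<le> a ^ k * c * B"
    using eventually_ge_at_top[of k]
    by eventually_elim (subst norm_minus_commute, rule P_iter_iter_osc[OF f x0 x])
qed simp

lemma nu_close0: "lip c f \<Longrightarrow> x \<in> X \<Longrightarrow> norm (f x - nu f) \<le> c * B"
  using nu_close[of c f x 0] by simp

lemma P_iter_bdd:
  assumes "\<And>x. x \<in> X \<Longrightarrow> norm (f x) \<le> b"
  shows "x \<in> X \<Longrightarrow> norm ((P ^^ k) f x) \<le> b"
  by (induction k arbitrary: x) (auto intro: assms P_bdd)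

lemma nu_bdd:
  assumes f: "lip c f" and b: "\<And>x. x \<in> X \<Longrightarrow> norm (f x) \<le> b"
  shows "norm (nu f) \<le> b"
  by (rule Lim_norm_ubound[OF _ nu_tendsto0[OF f]]) (use P_iter_bdd[OF b x0] in auto)

lemma P_cong: "(\<And>x. x \<in> X \<Longrightarrow> f x = h x) \<Longrightarrow> x \<in> X \<Longrightarrow> P f x = P h x"
  unfolding P_def by (intro Bochner_Integration.integral_cong) (auto simp: act_X)

lemma P_iter_cong: "(\<And>x. x \<in> X \<Longrightarrow> f x = h x) \<Longrightarrow> x \<in> X \<Longrightarrow> (P ^^ k) f x = (P ^^ k) h x"
  by (induction k arbitrary: x) (auto intro!: P_cong)

lemma nu_cong: "(\<And>x. x \<in> X \<Longrightarrow> f x = h x) \<Longrightarrow> nu f = nu h"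
  unfolding nu_def using P_iter_cong[OF _ x0] by metis

lemma lip_add: "lip c f \<Longrightarrow> lip d h \<Longrightarrow> lip (c + d) (\<lambda>x. f x + h x)"
  unfolding lip_def
proof (intro conjI ballI, goal_cases)
  case (2 x y)
  have "norm (f x + h x - (f y + h y)) \<le> norm (f x - f y) + norm (h x - h y)"
    by (rule norm_diff_triangle_ineq)
  also have "\<dots> \<le> c * D x y + d * D x y" using 2 by (intro add_mono) auto
  finally show ?case by (simp add: algebra_simps)
qed auto

lemma lip_linear:
  assumes "lip c f" "\<And>x. norm (T x) \<le> k * norm x" "linear T" "0 \<le> k"
  shows "lip (k * c) (\<lambda>x. T (f x))"
  unfolding lip_def
proof (intro conjI ballI)
  fix x y assume xy: "x \<in> X" "y \<in> X"
  have "norm (T (f x) - T (f y)) \<le> k * norm (f x - f y)"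
    using assms(2)[of "f x - f y"] by (simp add: linear_diff[OF assms(3)])
  also have "\<dots> \<le> k * (c * D x y)" using lipD[OF assms(1) xy] assms(4) by (intro mult_left_mono)
  finally show "norm (T (f x) - T (f y)) \<le> k * c * D x y" by (simp add: mult.assoc)
qed (use assms(4) lip_nonneg[OF assms(1)] in simp)

lemma P_iter_add:
  assumes "lip c f" "lip d h"
  shows "x \<in> X \<Longrightarrow> (P ^^ k) (\<lambda>x. f x + h x) x = (P ^^ k) f x + (P ^^ k) h x"
proof (induction k arbitrary: x)
  case (Suc k)
  have "(P ^^ Suc k) (\<lambda>x. f x + h x) x = P (\<lambda>x. (P ^^ k) f x + (P ^^ k) h x) x"
    using Suc by (auto intro!: P_cong)
  also have "\<dots> = (P ^^ Suc k) f x + (P ^^ Suc k) h x"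
    using lip_integrable[OF P_iter_lip[OF assms(1)] Suc.prems, of k]
      lip_integrable[OF P_iter_lip[OF assms(2)] Suc.prems, of k] by (simp add: P_def)
  finally show ?case .
qed simp

lemma nu_add:
  assumes "lip c f" "lip d h" shows "nu (\<lambda>x. f x + h x) = nu f + nu h"
proof (rule LIMSEQ_unique)
  show "(\<lambda>k. (P ^^ k) (\<lambda>x. f x + h x) x0) \<longlonglongrightarrow> nu (\<lambda>x. f x + h x)"
    by (rule nu_tendsto0[OF lip_add[OF assms]])
  show "(\<lambda>k. (P ^^ k) (\<lambda>x. f x + h x) x0) \<longlonglongrightarrow> nu f + nu h"
    unfolding P_iter_add[OF assms x0]
    by (rule tendsto_add[OF nu_tendsto0[OF assms(1)] nu_tendsto0[OF assms(2)]])
qed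

lemma nu_linear:
  assumes f: "lip c f" and T: "bounded_linear T"
  shows "nu (\<lambda>x. T (f x)) = T (nu f)"
proof -
  interpret T: bounded_linear T by (rule T)
  have eq: "x \<in> X \<Longrightarrow> (P ^^ k) (\<lambda>x. T (f x)) x = T ((P ^^ k) f x)" for k x
  proof (induction k arbitrary: x)
    case (Suc k)
    have "(P ^^ Suc k) (\<lambda>x. T (f x)) x = P (\<lambda>x. T ((P ^^ k) f x)) x"
      using Suc by (auto intro!: P_cong)
    also have "\<dots> = T ((P ^^ Suc k) f x)"
      using integral_bounded_linear[OF T lip_integrable[OF P_iter_lip[OF f] Suc.prems, of k]] by (simp add: P_def)
    finally show ?case .
  qed simp
  have "(\<lambda>k. (P ^^ k) (\<lambda>x. T (f x)) x0) \<longlonglongrightarrow> T (nu f)"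
    unfolding eq[OF x0] by (intro T.tendsto nu_tendsto0[OF f])
  then show ?thesis unfolding nu_def by (simp add: limI)
qed

lemma nu_const: "nu (\<lambda>_. b) = b"
proof -
  have "norm (b - nu (\<lambda>_. b)) \<le> 0" using nu_close0[OF lip_const x0] by simp
  then show ?thesis by simp
qed

lemma nu_P: assumes "lip c f" shows "nu (P f) = nu f"
proof -
  have "(P ^^ k) (P f) x0 = (P ^^ Suc k) f x0" for k
    by (simp add: funpow_swap1)
  then have "(\<lambda>k. (P ^^ k) (P f) x0) \<longlonglongrightarrow> nu f"
    using LIMSEQ_Suc[OF nu_tendsto0[OF assms]] by simp
  then show ?thesis using LIMSEQ_unique[OF nu_tendsto0[OF P_lip[OF assms]]] by blast
qed

text \<open>The solution is the series of the functions \<open>(P ^^ k) f - nu f\<close>, which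
  converges geometrically together with its Lipschitz constants. Applying \<open>P\<close> shifts
  the series by one place, so the difference is the term of index 0.\<close>

lemma poisson_equation:
  fixes f :: "'x \<Rightarrow> real"
  assumes f: "lip c f"
  shows "\<exists>\<psi>. lip (c / (1 - a)) \<psi> \<and> (\<forall>x\<in>X. \<bar>\<psi> x\<bar> \<le> c * B / (1 - a)) \<and>
    (\<forall>x\<in>X. \<psi> x - P \<psi> x = f x - nu f)"
proof -
  define h where "h k x = (P ^^ k) f x - nu f" for k x
  define \<psi> where "\<psi> x = (\<Sum>k. h k x)" for x
  have h: "norm (h k x) \<le> a ^ k * (c * B)" if "x \<in> X" for k x
    using nu_close[OF f that, of k] by (simp add: h_def mult.assoc)
  have geo: "(\<lambda>k. a ^ k * d) sums (d / (1 - a))" for d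
    using sums_mult2[OF geometric_sums[of a], of d] a by simp
  have sm: "summable (\<lambda>k. h k x)" if "x \<in> X" for x
    by (rule summable_comparison_test'[OF sums_summable[OF geo]]) (rule h[OF that])
  have hl: "lip (a ^ k * c) (h k)" for k
    using P_iter_lip[OF f, of k] by (simp add: lip_def h_def)
  have bd: "\<bar>\<psi> x\<bar> \<le> c * B / (1 - a)" if "x \<in> X" for x
  proof -
    have "norm (\<psi> x) \<le> (\<Sum>k. a ^ k * (c * B))"
      unfolding \<psi>_def by (rule norm_suminf_le[OF h[OF that] sums_summable[OF geo]])
    then show ?thesis using sums_unique[OF geo, of "c * B"] by simp
  qed
  have lp: "lip (c / (1 - a)) \<psi>"
    unfolding lip_def
  proof (intro conjI ballI)
    show "0 \<le> c / (1 - a)" using a lip_nonneg[OF f] by simp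
    fix x y assume xy: "x \<in> X" "y \<in> X"
    have "\<psi> x - \<psi> y = (\<Sum>k. h k x - h k y)"
      unfolding \<psi>_def by (rule suminf_diff[OF sm[OF xy(1)] sm[OF xy(2)]])
    also have "norm \<dots> \<le> (\<Sum>k. a ^ k * (c * D x y))"
      by (rule norm_suminf_le[OF _ sums_summable[OF geo]]) (use lipD[OF hl xy] in \<open>simp add: mult.assoc\<close>)
    also have "\<dots> = c / (1 - a) * D x y" using sums_unique[OF geo, of "c * D x y"] by simp
    finally show "norm (\<psi> x - \<psi> y) \<le> c / (1 - a) * D x y" .
  qed
  have "\<psi> x - P \<psi> x = f x - nu f" if x: "x \<in> X" for x
  proof -
    have int: "integrable \<mu> (\<lambda>g. h k (act g x))" for k
      by (rule lip_integrable[OF hl x])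
    have ih: "(\<integral>g. h k (act g x) \<partial>\<mu>) = h (Suc k) x" for k
      using lip_integrable[OF P_iter_lip[OF f] x, of k] by (simp add: h_def P_def prob_space)
    have "P \<psi> x = (\<Sum>k. \<integral>g. h k (act g x) \<partial>\<mu>)"
      unfolding P_def \<psi>_def
    proof (rule integral_suminf[OF int])
      show "AE g in \<mu>. summable (\<lambda>k. norm (h k (act g x)))"
        by (intro AE_I2 summable_comparison_test'[OF sums_summable[OF geo]]) (use h act_X x in auto)
      show "summable (\<lambda>k. \<integral>g. norm (h k (act g x)) \<partial>\<mu>)"
      proof (rule summable_comparison_test'[OF sums_summable[OF geo[of "c * B"]]])
        fix k
        show "norm (\<integral>g. norm (h k (act g x)) \<partial>\<mu>) \<le> a ^ k * (c * B)"
          using norm_integral_le[of "\<lambda>_. a ^ k * (c * B)" "\<lambda>g. norm (h k (act g x))"] h act_X x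
          by (simp add: prob_space)
      qed
    qed
    also have "\<dots> = (\<Sum>k. h (Suc k) x)" by (simp add: ih)
    also have "\<dots> = \<psi> x - h 0 x"
      using suminf_split_head[OF sm[OF x]] by (simp add: \<psi>_def)
    finally show ?thesis by (simp add: h_def)
  qed
  then show ?thesis using bd lp by blast
qed

end

section \<open>Characteristic functions of centered cocycles\<close>

lemma exp_minus_bounds:
  fixes w :: real
  assumes "0 \<le> w"
  shows "\<bar>exp (- w) - (1 - w)\<bar> \<le> w\<^sup>2 / 2"
proof -
  have "1 - w \<le> exp (- w)" using exp_ge_add_one_self[of "- w"] by simp
  moreover have "exp (- w) \<le> 1 - w + w\<^sup>2 / 2"
  proof -
    have "1 + w + w\<^sup>2 / 2 \<le> exp w" by (rule exp_lower_Taylor_quadratic[OF assms])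
    moreover have q: "0 \<le> 1 - w + w\<^sup>2 / 2"
      using zero_le_power2[of "w - 1"] by (simp add: power2_eq_square algebra_simps)
    ultimately have "(1 + w + w\<^sup>2 / 2) * (1 - w + w\<^sup>2 / 2) \<le> exp w * (1 - w + w\<^sup>2 / 2)"
      by (intro mult_right_mono)
    \<comment> \<open>The product of the two quadratics is at least 1, so the lower Taylor bound for
      \<open>exp w\<close> becomes an upper bound for its inverse.\<close>
    moreover have "(1 + w + w\<^sup>2 / 2) * (1 - w + w\<^sup>2 / 2) = 1 + w^4 / 4"
      by (simp add: algebra_simps power2_eq_square power4_eq_xxxx)
    moreover have "0 \<le> w^4 / 4" by simp
    ultimately have "1 \<le> exp w * (1 - w + w\<^sup>2 / 2)" by linarith
    then show ?thesis by (simp add: exp_minus field_simps)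
  qed
  ultimately show ?thesis by simp
qed

text \<open>The second bound keeps the factor \<open>\<bar>u - v\<bar>\<close> after removal of the
  linear term. Integrated against a centered cocycle the linear term vanishes, and an oscillation of
  second order in the frequency remains.\<close>

lemma iexp_diff_le:
  fixes u v :: real
  shows "cmod (iexp u - iexp v) \<le> \<bar>u - v\<bar>"
    and "cmod (iexp u - iexp v - \<i> * of_real (u - v)) \<le> \<bar>u - v\<bar> * (\<bar>u\<bar> + 2 * \<bar>v\<bar>)"
proof -
  have fac: "iexp u - iexp v = iexp v * (iexp (u - v) - 1)"
    by (simp add: right_diff_distrib exp_add[symmetric] algebra_simps)
  have 1: "cmod (iexp w - 1) \<le> \<bar>w\<bar>" for w :: real
    using iexp_approx1[of w 0] by simp
  show "cmod (iexp u - iexp v) \<le> \<bar>u - v\<bar>"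
    unfolding fac norm_mult using 1[of "u - v"] by simp
  have 2: "cmod (iexp w - (1 + \<i> * w)) \<le> \<bar>w\<bar>\<^sup>2 / 2" for w :: real
    using iexp_approx1[of w 1] by (simp add: power2_eq_square)
  have "iexp u - iexp v - \<i> * of_real (u - v)
    = iexp v * (iexp (u - v) - (1 + \<i> * of_real (u - v))) + (iexp v - 1) * (\<i> * of_real (u - v))"
    unfolding fac by (simp add: algebra_simps)
  also have "cmod \<dots> \<le> \<bar>u - v\<bar>\<^sup>2 / 2 + \<bar>v\<bar> * \<bar>u - v\<bar>"
  proof (rule norm_triangle_le[OF add_mono])
    show "cmod (iexp v * (iexp (u - v) - (1 + \<i> * of_real (u - v)))) \<le> \<bar>u - v\<bar>\<^sup>2 / 2"
      unfolding norm_mult using 2[of "u - v"] by simp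
    have "cmod (\<i> * complex_of_real (u - v)) = \<bar>u - v\<bar>"
      by (simp only: norm_mult norm_of_real norm_ii mult_1)
    then show "cmod ((iexp v - 1) * (\<i> * of_real (u - v))) \<le> \<bar>v\<bar> * \<bar>u - v\<bar>"
      unfolding norm_mult[of "iexp v - 1"] using 1[of v] by (simp only: mult_right_mono abs_ge_zero)
  qed
  also have "\<dots> = \<bar>u - v\<bar> * (\<bar>u - v\<bar> / 2 + \<bar>v\<bar>)"
    by (simp add: power2_eq_square algebra_simps)
  also have "\<dots> \<le> \<bar>u - v\<bar> * (\<bar>u\<bar> + 2 * \<bar>v\<bar>)"
    by (intro mult_left_mono) auto
  finally show "cmod (iexp u - iexp v - \<i> * of_real (u - v)) \<le> \<bar>u - v\<bar> * (\<bar>u\<bar> + 2 * \<bar>v\<bar>)" .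
qed

text \<open>A single function \<open>k\<close> dominates both the size of the cocycle and its
  Lipschitz constant in the state. The mean is zero at every state and not merely on stationary
  average, which makes the partial sums a martingale.\<close>

locale centered_cocycle = markov_contraction \<mu> X act D B B' a x0
  for \<mu> :: "'g measure" and X :: "'x set" and act D B B' a x0 +
  fixes \<xi> :: "'g \<Rightarrow> 'x \<Rightarrow> real" and k :: "'g \<Rightarrow> real"
  assumes xi_meas: "\<And>x. x \<in> X \<Longrightarrow> (\<lambda>g. \<xi> g x) \<in> borel_measurable \<mu>"
    and k_meas: "k \<in> borel_measurable \<mu>"
    and k_ge_1: "\<And>g. g \<in> space \<mu> \<Longrightarrow> 1 \<le> k g"
    and k_int3: "integrable \<mu> (\<lambda>g. k g ^ 3)"
    and xi_le: "\<And>g x. g \<in> space \<mu> \<Longrightarrow> x \<in> X \<Longrightarrow> \<bar>\<xi> g x\<bar> \<le> k g"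
    and xi_lip: "\<And>g x y. g \<in> space \<mu> \<Longrightarrow> x \<in> X \<Longrightarrow> y \<in> X \<Longrightarrow> \<bar>\<xi> g x - \<xi> g y\<bar> \<le> k g * D x y"
    and xi_centered: "\<And>x. x \<in> X \<Longrightarrow> (\<integral>g. \<xi> g x \<partial>\<mu>) = 0"
begin

lemma k_int: "j \<le> 3 \<Longrightarrow> integrable \<mu> (\<lambda>g. k g ^ j)"
proof (rule Bochner_Integration.integrable_bound[OF k_int3])
  assume "j \<le> 3"
  then show "AE g in \<mu>. norm (k g ^ j) \<le> norm (k g ^ 3)"
    by (intro AE_I2) (use k_ge_1 in \<open>auto intro!: power_increasing order_trans[OF k_ge_1 abs_ge_self] simp: power_abs\<close>)
qed (use k_meas in auto)

abbreviation "K j \<equiv> (\<integral>g. k g ^ j \<partial>\<mu>)"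

lemma K_nonneg: "0 \<le> K j"
  by (rule integral_nonneg_AE, rule AE_I2) (use k_ge_1 in \<open>fastforce intro!: zero_le_power\<close>)

definition V :: "'x \<Rightarrow> real" where "V x = (\<integral>g. (\<xi> g x)\<^sup>2 \<partial>\<mu>)"

text \<open>Increments with zero conditional mean are uncorrelated, so the stationary mean of the
  one-step variance is the whole asymptotic variance.\<close>

definition s2 :: real where "s2 = nu V"

text \<open>The Fourier-twisted transfer operator. Its \<open>n\<close>-th iterate on the constant 1
  is the characteristic function at \<theta> of the sum of \<open>n\<close> increments.\<close>

definition Q :: "real \<Rightarrow> ('x \<Rightarrow> complex) \<Rightarrow> 'x \<Rightarrow> complex" where
  "Q \<theta> f x = (\<integral>g. iexp (\<theta> * \<xi> g x) * f (act g x) \<partial>\<mu>)"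

lemma xi_int: "x \<in> X \<Longrightarrow> integrable \<mu> (\<lambda>g. \<xi> g x)"
  by (rule Bochner_Integration.integrable_bound[OF k_int[of 1]])
     (use xi_le xi_meas in \<open>auto intro!: AE_I2 intro: order_trans[OF _ abs_ge_self]\<close>)

lemma xi_sq_le: "g \<in> space \<mu> \<Longrightarrow> x \<in> X \<Longrightarrow> (\<xi> g x)\<^sup>2 \<le> (k g)\<^sup>2"
  using xi_le[of g x] by (meson abs_le_square_iff abs_ge_self order_trans)

lemma xi_int2: "x \<in> X \<Longrightarrow> integrable \<mu> (\<lambda>g. (\<xi> g x)\<^sup>2)"
  by (rule Bochner_Integration.integrable_bound[OF k_int[of 2]])
     (use xi_sq_le xi_meas in \<open>auto intro!: AE_I2\<close>)

lemma V_lip: "lip (2 * K 2) V"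
  unfolding lip_def
proof (intro conjI ballI)
  fix x y assume xy: "x \<in> X" "y \<in> X"
  have "V x - V y = (\<integral>g. (\<xi> g x)\<^sup>2 - (\<xi> g y)\<^sup>2 \<partial>\<mu>)"
    using xi_int2 xy by (simp add: V_def)
  also have "norm \<dots> \<le> (\<integral>g. (2 * D x y) * k g ^ 2 \<partial>\<mu>)"
  proof (rule norm_integral_le)
    fix g assume g: "g \<in> space \<mu>"
    have "\<bar>(\<xi> g x)\<^sup>2 - (\<xi> g y)\<^sup>2\<bar> = \<bar>\<xi> g x - \<xi> g y\<bar> * \<bar>\<xi> g x + \<xi> g y\<bar>"
      by (simp add: power2_eq_square algebra_simps flip: abs_mult)
    also have "\<dots> \<le> (k g * D x y) * (k g + k g)"
      using xi_lip[OF g xy] xi_le[OF g xy(1)] xi_le[OF g xy(2)] k_ge_1[OF g] D_nonneg[OF xy]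
      by (intro mult_mono) auto
    finally show "norm ((\<xi> g x)\<^sup>2 - (\<xi> g y)\<^sup>2) \<le> (2 * D x y) * k g ^ 2"
      by (simp add: power2_eq_square mult_ac)
  qed (use k_int[of 2] in auto)
  finally show "norm (V x - V y) \<le> 2 * K 2 * D x y" by (simp add: mult_ac)
qed (use K_nonneg in simp)

lemma Q_int:
  assumes f: "lip c f" and x: "x \<in> X"
  shows "integrable \<mu> (\<lambda>g. iexp (\<theta> * \<xi> g x) * f (act g x))"
proof (rule Bochner_Integration.integrable_bound[OF lip_integrable[OF f x]])
  show "(\<lambda>g. iexp (\<theta> * \<xi> g x) * f (act g x)) \<in> borel_measurable \<mu>"
    using xi_meas[OF x] lip_meas[OF f x] by measurable
qed (simp add: norm_mult)

text \<open>An inequality of Doeblin-Fortet type: the variation of \<open>f\<close> is contracted by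
  \<open>a\<close>, while the variation of the phase is paid by the sup norm with a factor
  \<bar>\<theta>\<bar>.\<close>

lemma Q_lip:
  assumes f: "lip c f" and b: "\<And>x. x \<in> X \<Longrightarrow> cmod (f x) \<le> b"
  shows "lip (a * c + \<bar>\<theta>\<bar> * K 1 * b) (Q \<theta> f)"
  unfolding lip_def
proof (intro conjI ballI)
  have b0: "0 \<le> b" using b[OF x0] norm_ge_zero order_trans by blast
  show "0 \<le> a * c + \<bar>\<theta>\<bar> * K 1 * b"
    using a lip_nonneg[OF f] K_nonneg[of 1] b0 by simp
  fix x y assume xy: "x \<in> X" "y \<in> X"
  have "Q \<theta> f x - Q \<theta> f y = (\<integral>g. iexp (\<theta> * \<xi> g x) * f (act g x) - iexp (\<theta> * \<xi> g y) * f (act g y) \<partial>\<mu>)"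
    unfolding Q_def using Q_int[OF f] xy by simp
  also have "cmod \<dots> \<le> (\<integral>g. c * D (act g x) (act g y) + (\<bar>\<theta>\<bar> * b * D x y) * k g ^ 1 \<partial>\<mu>)"
  proof (rule norm_integral_le)
    show "integrable \<mu> (\<lambda>g. c * D (act g x) (act g y) + (\<bar>\<theta>\<bar> * b * D x y) * k g ^ 1)"
      using D_integrable[OF xy] k_int[of 1] by simp
    fix g assume g: "g \<in> space \<mu>"
    have "iexp (\<theta> * \<xi> g x) * f (act g x) - iexp (\<theta> * \<xi> g y) * f (act g y)
      = iexp (\<theta> * \<xi> g x) * (f (act g x) - f (act g y)) + (iexp (\<theta> * \<xi> g x) - iexp (\<theta> * \<xi> g y)) * f (act g y)"
      by (simp add: algebra_simps)
    also have "cmod \<dots> \<le> c * D (act g x) (act g y) + (\<bar>\<theta>\<bar> * (k g * D x y)) * b"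
    proof (rule norm_triangle_le[OF add_mono])
      show "cmod (iexp (\<theta> * \<xi> g x) * (f (act g x) - f (act g y))) \<le> c * D (act g x) (act g y)"
        using lipD[OF f act_X[OF g xy(1)] act_X[OF g xy(2)]] by (simp add: norm_mult)
      have "\<bar>\<theta> * \<xi> g x - \<theta> * \<xi> g y\<bar> \<le> \<bar>\<theta>\<bar> * (k g * D x y)"
        unfolding right_diff_distrib[symmetric] abs_mult using xi_lip[OF g xy] by (intro mult_left_mono) auto
      then have "cmod (iexp (\<theta> * \<xi> g x) - iexp (\<theta> * \<xi> g y)) \<le> \<bar>\<theta>\<bar> * (k g * D x y)"
        using iexp_diff_le(1) order_trans by blast
      then show "cmod ((iexp (\<theta> * \<xi> g x) - iexp (\<theta> * \<xi> g y)) * f (act g y)) \<le> (\<bar>\<theta>\<bar> * (k g * D x y)) * b"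
        unfolding norm_mult using b[OF act_X[OF g xy(2)]] b0
        by (intro mult_mono) (auto intro: order_trans[OF norm_ge_zero])
    qed
    finally show "cmod (iexp (\<theta> * \<xi> g x) * f (act g x) - iexp (\<theta> * \<xi> g y) * f (act g y))
       \<le> c * D (act g x) (act g y) + (\<bar>\<theta>\<bar> * b * D x y) * k g ^ 1" by (simp add: mult_ac)
  qed
  also have "\<dots> = c * (\<integral>g. D (act g x) (act g y) \<partial>\<mu>) + (\<bar>\<theta>\<bar> * b * D x y) * K 1"
    using D_integrable[OF xy] k_int[of 1] by simp
  also have "\<dots> \<le> c * (a * D x y) + (\<bar>\<theta>\<bar> * b * D x y) * K 1"
    using contraction[OF xy] lip_nonneg[OF f] by (intro add_right_mono mult_left_mono) auto
  finally show "cmod (Q \<theta> f x - Q \<theta> f y) \<le> (a * c + \<bar>\<theta>\<bar> * K 1 * b) * D x y"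
    by (simp add: algebra_simps)
qed

lemma Q_P:
  assumes f: "lip c f" and b: "\<And>x. x \<in> X \<Longrightarrow> cmod (f x) \<le> b" and x: "x \<in> X"
  shows "cmod (Q \<theta> f x - P f x) \<le> \<bar>\<theta>\<bar> * K 1 * b"
proof -
  have b0: "0 \<le> b" using b[OF x0] norm_ge_zero order_trans by blast
  have "Q \<theta> f x - P f x = (\<integral>g. iexp (\<theta> * \<xi> g x) * f (act g x) - f (act g x) \<partial>\<mu>)"
    unfolding Q_def P_def using Q_int[OF f x] lip_integrable[OF f x] by simp
  also have "cmod \<dots> \<le> (\<integral>g. (\<bar>\<theta>\<bar> * b) * k g ^ 1 \<partial>\<mu>)"
  proof (rule norm_integral_le)
    fix g assume g: "g \<in> space \<mu>"
    have "cmod (iexp (\<theta> * \<xi> g x) - iexp 0) \<le> \<bar>\<theta> * \<xi> g x\<bar>"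
      using iexp_diff_le(1)[of "\<theta> * \<xi> g x" 0] by simp
    also have "\<dots> \<le> \<bar>\<theta>\<bar> * k g" unfolding abs_mult using xi_le[OF g x] by (intro mult_left_mono) auto
    finally have "cmod ((iexp (\<theta> * \<xi> g x) - iexp 0) * f (act g x)) \<le> (\<bar>\<theta>\<bar> * k g) * b"
      unfolding norm_mult using b[OF act_X[OF g x]] b0
      by (intro mult_mono) (auto intro: order_trans[OF norm_ge_zero])
    then show "cmod (iexp (\<theta> * \<xi> g x) * f (act g x) - f (act g x)) \<le> (\<bar>\<theta>\<bar> * b) * k g ^ 1"
      by (simp add: algebra_simps)
  qed (use k_int[of 1] in simp)
  finally show ?thesis by (simp add: mult_ac)
qed

lemma Q_add:
  assumes "lip c f" "x \<in> X"
  shows "Q \<theta> (\<lambda>x. z + f x) x = z * Q \<theta> (\<lambda>_. 1) x + Q \<theta> f x"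
  using Q_int[OF lip_const[of 1] assms(2)] Q_int[OF assms]
  by (simp add: Q_def distrib_left mult.commute[of z])

text \<open>Centering at \<open>x\<close> and at \<open>y\<close> allows the linear term of the
  phase difference to be subtracted for free. The constant is of order
  \<open>\<theta>\<^sup>2\<close> instead of \<bar>\<theta>\<bar>; the cubic error in the recursion
  for the means depends on this gain.\<close>

lemma Q1_lip: "lip (3 * \<theta>\<^sup>2 * K 2) (Q \<theta> (\<lambda>_. 1))"
  unfolding lip_def
proof (intro conjI ballI)
  fix x y assume xy: "x \<in> X" "y \<in> X"
  have i1: "integrable \<mu> (\<lambda>g. iexp (\<theta> * \<xi> g z))" if "z \<in> X" for z
    using Q_int[OF lip_const[of 1] that] by simp
  have i0: "integrable \<mu> (\<lambda>g. \<theta> * \<xi> g x - \<theta> * \<xi> g y)"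
    using xi_int[OF xy(1)] xi_int[OF xy(2)] by simp
  then have i2: "integrable \<mu> (\<lambda>g. \<i> * complex_of_real (\<theta> * \<xi> g x - \<theta> * \<xi> g y))"
    by (intro integrable_mult_right integrable_of_real)
  have "(\<integral>g. \<theta> * \<xi> g x - \<theta> * \<xi> g y \<partial>\<mu>) = 0"
    using xi_int[OF xy(1)] xi_int[OF xy(2)] xi_centered[OF xy(1)] xi_centered[OF xy(2)] by simp
  then have "(\<integral>g. \<i> * complex_of_real (\<theta> * \<xi> g x - \<theta> * \<xi> g y) \<partial>\<mu>) = 0"
    by (simp only: integral_mult_right_zero integral_complex_of_real of_real_0 mult_zero_right)
  then have "Q \<theta> (\<lambda>_. 1) x - Q \<theta> (\<lambda>_. 1) y
    = (\<integral>g. iexp (\<theta> * \<xi> g x) - iexp (\<theta> * \<xi> g y) - \<i> * complex_of_real (\<theta> * \<xi> g x - \<theta> * \<xi> g y) \<partial>\<mu>)"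
    unfolding Q_def using i1[OF xy(1)] i1[OF xy(2)] i2 by simp
  also have "cmod \<dots> \<le> (\<integral>g. (3 * \<theta>\<^sup>2 * D x y) * k g ^ 2 \<partial>\<mu>)"
  proof (rule norm_integral_le)
    fix g assume g: "g \<in> space \<mu>"
    have 1: "\<bar>\<theta> * \<xi> g x - \<theta> * \<xi> g y\<bar> \<le> \<bar>\<theta>\<bar> * (k g * D x y)"
      unfolding right_diff_distrib[symmetric] abs_mult using xi_lip[OF g xy] by (intro mult_left_mono) auto
    have 2: "\<bar>\<theta> * \<xi> g z\<bar> \<le> \<bar>\<theta>\<bar> * k g" if "z \<in> X" for z
      unfolding abs_mult using xi_le[OF g that] by (intro mult_left_mono) auto
    have "cmod (iexp (\<theta> * \<xi> g x) - iexp (\<theta> * \<xi> g y) - \<i> * complex_of_real (\<theta> * \<xi> g x - \<theta> * \<xi> g y))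
      \<le> \<bar>\<theta> * \<xi> g x - \<theta> * \<xi> g y\<bar> * (\<bar>\<theta> * \<xi> g x\<bar> + 2 * \<bar>\<theta> * \<xi> g y\<bar>)"
      by (rule iexp_diff_le(2))
    also have "\<dots> \<le> (\<bar>\<theta>\<bar> * (k g * D x y)) * (\<bar>\<theta>\<bar> * k g + 2 * (\<bar>\<theta>\<bar> * k g))"
      using 1 2[OF xy(1)] 2[OF xy(2)] k_ge_1[OF g] D_nonneg[OF xy]
      by (intro mult_mono add_mono) auto
    also have "\<dots> = (3 * \<theta>\<^sup>2 * D x y) * k g ^ 2"
      by (simp add: power2_eq_square mult_ac)
    finally show "cmod (iexp (\<theta> * \<xi> g x) - iexp (\<theta> * \<xi> g y) - \<i> * complex_of_real (\<theta> * \<xi> g x - \<theta> * \<xi> g y))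
       \<le> (3 * \<theta>\<^sup>2 * D x y) * k g ^ 2" .
  qed (use k_int[of 2] in simp)
  finally show "cmod (Q \<theta> (\<lambda>_. 1) x - Q \<theta> (\<lambda>_. 1) y) \<le> 3 * \<theta>\<^sup>2 * K 2 * D x y" by (simp add: mult_ac)
qed (use K_nonneg in simp)

text \<open>Third-order Taylor expansion of the exponential, in which centering removes the linear
  term; the factor \<open>1 / 6\<close> is dropped.\<close>

lemma Q1_approx:
  assumes x: "x \<in> X"
  shows "cmod (Q \<theta> (\<lambda>_. 1) x - of_real (1 - \<theta>\<^sup>2 * V x / 2)) \<le> \<bar>\<theta>\<bar> ^ 3 * K 3"
proof -
  let ?p = "\<lambda>g. complex_of_real 1 + \<i> * complex_of_real (\<theta> * \<xi> g x) - complex_of_real (\<theta>\<^sup>2 * (\<xi> g x)\<^sup>2 / 2)"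
  have i: "integrable \<mu> ?p"
    using integrable_of_real[OF xi_int[OF x], where 'a=complex] integrable_of_real[OF xi_int2[OF x], where 'a=complex] by simp
  have "(\<integral>g. ?p g \<partial>\<mu>) = of_real (1 - \<theta>\<^sup>2 * V x / 2)"
    using integrable_of_real[OF xi_int[OF x], where 'a=complex] integrable_of_real[OF xi_int2[OF x], where 'a=complex] xi_centered[OF x]
      integral_complex_of_real[of \<mu> "\<lambda>g. (\<xi> g x)\<^sup>2"]
    by (simp add: V_def prob_space)
  then have "Q \<theta> (\<lambda>_. 1) x - of_real (1 - \<theta>\<^sup>2 * V x / 2) = (\<integral>g. iexp (\<theta> * \<xi> g x) - ?p g \<partial>\<mu>)"
    unfolding Q_def using i Q_int[OF lip_const[of 1] x] by (subst Bochner_Integration.integral_diff) simp_all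
  also have "cmod \<dots> \<le> (\<integral>g. \<bar>\<theta>\<bar> ^ 3 * k g ^ 3 \<partial>\<mu>)"
  proof (rule norm_integral_le)
    fix g assume g: "g \<in> space \<mu>"
    let ?u = "\<theta> * \<xi> g x"
    have "cmod (iexp ?u - ?p g) \<le> \<bar>?u\<bar> ^ 3 / 6"
      using iexp_approx1[of ?u 2] by (simp add: numeral_2_eq_2 numeral_3_eq_3 power2_eq_square algebra_simps)
    also have "\<dots> \<le> \<bar>?u\<bar> ^ 3" by simp
    also have "\<dots> \<le> (\<bar>\<theta>\<bar> * k g) ^ 3" unfolding abs_mult using xi_le[OF g x] by (intro power_mono mult_left_mono) auto
    finally show "cmod (iexp ?u - ?p g) \<le> \<bar>\<theta>\<bar> ^ 3 * k g ^ 3" by (simp add: power_mult_distrib)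
  qed (use k_int[of 3] in simp)
  finally show ?thesis by simp
qed

text \<open>As \<open>nu\<close> is a limit of iterates, the pointwise estimate is transported by
  writing the difference as \<open>nu\<close> of one Lipschitz function and applying
  \<open>nu_bdd\<close> to it.\<close>

lemma nu_Q1_approx: "cmod (nu (Q \<theta> (\<lambda>_. 1)) - of_real (1 - \<theta>\<^sup>2 * s2 / 2)) \<le> \<bar>\<theta>\<bar> ^ 3 * K 3"
proof -
  have bl: "bounded_linear (\<lambda>v. complex_of_real (\<theta>\<^sup>2 / 2 * v))"
    by (intro bounded_linear_compose[OF bounded_linear_of_real bounded_linear_mult_right])
  have l2: "lip (\<theta>\<^sup>2 / 2 * (2 * K 2)) (\<lambda>x. complex_of_real (\<theta>\<^sup>2 / 2 * V x))"
    by (rule lip_linear[OF V_lip]) (use bl in \<open>auto simp: bounded_linear.linear norm_mult abs_mult simp del: of_real_mult\<close>)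
  note l3 = lip_add[OF lip_const[of "- 1"] l2]
  have "nu (\<lambda>x. complex_of_real (\<theta>\<^sup>2 / 2 * V x)) = complex_of_real (\<theta>\<^sup>2 / 2 * s2)"
    unfolding s2_def by (rule nu_linear[OF V_lip bl])
  then have n3: "nu (\<lambda>x. - 1 + complex_of_real (\<theta>\<^sup>2 / 2 * V x)) = - 1 + complex_of_real (\<theta>\<^sup>2 / 2 * s2)"
    unfolding nu_add[OF lip_const l2] nu_const by (simp only:)
  have "nu (Q \<theta> (\<lambda>_. 1)) - of_real (1 - \<theta>\<^sup>2 * s2 / 2) = nu (\<lambda>x. Q \<theta> (\<lambda>_. 1) x + (- 1 + complex_of_real (\<theta>\<^sup>2 / 2 * V x)))"
    using nu_add[OF Q1_lip l3] n3 by (simp add: algebra_simps)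
  also have "cmod \<dots> \<le> \<bar>\<theta>\<bar> ^ 3 * K 3"
    by (rule nu_bdd[OF lip_add[OF Q1_lip l3]]) (use Q1_approx in \<open>simp add: algebra_simps\<close>)
  finally show ?thesis .
qed

end

context centered_cocycle
begin

text \<open>Put \<open>\<phi> n = (Q \<theta> ^^ n) 1\<close> and \<open>a n = nu (\<phi> n)\<close>. Centering makes the oscillation of \<open>Q \<theta> 1\<close>, and
  hence inductively that of \<open>\<phi> n\<close>, of order \<open>\<theta>\<^sup>2 * \<bar>a n\<bar>\<close>. As \<open>nu (Q \<theta> u)\<close> is of order \<open>\<bar>\<theta>\<bar> * sup \<bar>u\<bar>\<close>
  whenever \<open>nu u = 0\<close>, this oscillation changes \<open>a (n + 1)\<close> by a term of third order only:
  \<open>a (n + 1) = a n * (1 - s2 * \<theta>\<^sup>2 / 2 + O(\<bar>\<theta>\<bar>\<^sup>3))\<close>. No perturbation theory of eigenvalues is needed.\<close>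

theorem char_function_estimate:
  assumes s2: "s2 > 0"
  shows "\<exists>c0>0. \<exists>C\<ge>0. \<forall>\<theta> n. \<bar>\<theta>\<bar> \<le> c0 \<longrightarrow>
    cmod ((Q \<theta> ^^ n) (\<lambda>_. 1) x0 - of_real (exp (- s2 * \<theta>\<^sup>2 * n / 2)))
      \<le> C * (\<theta>\<^sup>2 + n * \<bar>\<theta>\<bar> ^ 3) * exp (- s2 * \<theta>\<^sup>2 * n / 4)"
proof -
  \<comment> \<open>The choices give \<open>q * \<eta> = 3 * K 2\<close> and
    \<open>a + 3 * \<eta> = 1\<close>. Hence
    \<open>3 * K 2 + q * (a + \<eta>) = q * (1 - \<eta>)\<close>, and the oscillation bound
    reproduces itself even if the modulus of the mean shrinks by the factor
    \<open>1 - \<eta>\<close>.\<close>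
  define q where "q = 9 * K 2 / (1 - a)"
  define \<eta> where "\<eta> = (1 - a) / 3"
  define C1 where "C1 = K 3 + K 1 * B * q"
  define C2 where "C2 = C1 + s2\<^sup>2 / 8"
  have \<eta>: "0 < \<eta>" "\<eta> < 1" using a by (auto simp: \<eta>_def)
  have q: "0 \<le> q" using a K_nonneg[of 2] by (simp add: q_def)
  have C1: "0 \<le> C1" unfolding C1_def using K_nonneg B_nonneg q by (intro add_nonneg_nonneg mult_nonneg_nonneg)
  have C2: "0 \<le> C2" "C1 \<le> C2" using C1 by (auto simp: C2_def)
  \<comment> \<open>The entries of the minimum secure, in this order:
    \<open>\<bar>\<theta>\<bar> \<le> 1\<close>, a relative loss of at most \<eta> in the mean, the
    factor \<open>a + \<eta>\<close> for the oscillation, the room between \<open>E\<close> and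
    \<open>r\<close>, and \<open>w \<le> 1 / 4\<close>.\<close>
  define c0 where "c0 = Min {1, \<eta> / (s2 / 2 + C1), \<eta> / (1 + K 1 * B), s2 / (8 * (C2 + 1)), 1 / (1 + s2)}"
  have d: "0 < s2 / 2 + C1" "0 < 1 + K 1 * B" "0 < 8 * (C2 + 1)" "0 < 1 + s2"
    using s2 C1 C2 mult_nonneg_nonneg[OF K_nonneg[of 1] B_nonneg] by auto
  have c0: "0 < c0" unfolding c0_def using s2 \<eta> d by (simp add: divide_pos_pos)
  have main: "cmod ((Q \<theta> ^^ n) (\<lambda>_. 1) x0 - of_real (exp (- s2 * \<theta>\<^sup>2 * n / 2)))
      \<le> (B * q + 2 * C2) * (\<theta>\<^sup>2 + n * \<bar>\<theta>\<bar> ^ 3) * exp (- s2 * \<theta>\<^sup>2 * n / 4)"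
    if \<theta>: "\<bar>\<theta>\<bar> \<le> c0" for \<theta> n
  proof -
    define t where "t = \<bar>\<theta>\<bar>"
    have t: "0 \<le> t" "t \<le> 1" "t * (s2 / 2 + C1) \<le> \<eta>" "t * (1 + K 1 * B) \<le> \<eta>" "t * (8 * (C2 + 1)) \<le> s2" "t * (1 + s2) \<le> 1"
      using \<theta> d unfolding c0_def t_def by (auto simp: pos_le_divide_eq)
    have t2: "t\<^sup>2 = \<theta>\<^sup>2" by (simp add: t_def)
    have tt: "t\<^sup>2 \<le> t" "t ^ 3 \<le> t" "t ^ 4 \<le> t ^ 3" "t\<^sup>2 \<le> 1"
      using t(1,2) power_decreasing[of 1 2 t] power_decreasing[of 1 3 t] power_decreasing[of 3 4 t] power_le_one[of t 2] by auto
    define \<phi> where "\<phi> n = (Q \<theta> ^^ n) (\<lambda>_. 1)" for n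
    define an where "an n = nu (\<phi> n)" for n
    define E where "E = exp (- s2 * \<theta>\<^sup>2 / 2)"
    \<comment> \<open>Half of the decay in \<open>E\<close> is given away: the gap between
      \<open>r\<close> and \<open>E\<close> absorbs the cubic errors, and powers of \<open>r\<close>
      form the Gaussian factor of the final bound.\<close>
    define r where "r = exp (- s2 * \<theta>\<^sup>2 / 4)"
    define z where "z = 1 - \<theta>\<^sup>2 * s2 / 2"
    have \<phi>Suc: "\<phi> (Suc n) = Q \<theta> (\<phi> n)" for n by (simp add: \<phi>_def)
    \<comment> \<open>The oscillation is measured relative to \<open>cmod (an n)\<close>, so that
      the error in the recursion for the means is relative as well.\<close>
    have step: "lip (q * t\<^sup>2 * cmod (an (Suc n))) (\<phi> (Suc n)) \<and> cmod (an (Suc n) - an n * of_real z) \<le> C1 * t ^ 3 * cmod (an n)"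
      if IH: "lip (q * t\<^sup>2 * cmod (an n)) (\<phi> n)" for n
    proof -
      define c where "c = q * t\<^sup>2 * cmod (an n)"
      define u where "u x = \<phi> n x - an n" for x
      have c: "0 \<le> c" using q by (simp add: c_def)
      have lu: "lip c u" using IH by (simp add: lip_def u_def c_def)
      have ub: "cmod (u x) \<le> c * B" if "x \<in> X" for x
        using nu_close0[OF IH that] by (simp add: u_def an_def c_def)
      have nuu: "nu u = 0"
      proof -
        have "nu (\<lambda>x. \<phi> n x + (- an n)) = an n + (- an n)"
          unfolding nu_add[OF IH lip_const] nu_const by (simp add: an_def)
        then show ?thesis by (simp add: u_def[abs_def])
      qed
      have lQu: "lip (a * c + \<bar>\<theta>\<bar> * K 1 * (c * B)) (Q \<theta> u)" by (rule Q_lip[OF lu ub])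
      have dec: "\<phi> (Suc n) x = an n * Q \<theta> (\<lambda>_. 1) x + Q \<theta> u x" if "x \<in> X" for x
        using Q_add[OF lu that, of \<theta> "an n"] by (simp add: \<phi>Suc u_def[abs_def])
      have l1: "lip (cmod (an n) * (3 * \<theta>\<^sup>2 * K 2)) (\<lambda>x. an n * Q \<theta> (\<lambda>_. 1) x)"
        by (rule lip_linear[OF Q1_lip]) (auto simp: norm_mult bounded_linear.linear bounded_linear_mult_right)
      have l2: "lip (cmod (an n) * (3 * \<theta>\<^sup>2 * K 2) + (a * c + \<bar>\<theta>\<bar> * K 1 * (c * B))) (\<phi> (Suc n))"
        using lip_add[OF l1 lQu] dec unfolding lip_def by simp
      \<comment> \<open>Since \<open>nu (P u) = nu u = 0\<close>, only
        \<open>Q \<theta> u - P u\<close> counts, and this difference carries a factor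
        \<bar>\<theta>\<bar>.\<close>
      have nuQu: "cmod (nu (Q \<theta> u)) \<le> t * K 1 * (c * B)"
      proof -
        have lm: "lip (1 * (a * c)) (\<lambda>x. - P u x)"
          by (rule lip_linear[OF P_lip[OF lu]]) (auto simp: linear_uminus)
        have "nu (\<lambda>x. - P u x) = - nu (P u)"
          by (rule nu_linear[OF P_lip[OF lu]]) (simp add: bounded_linear_minus)
        then have "nu (\<lambda>x. Q \<theta> u x + - P u x) = nu (Q \<theta> u)"
          using nu_add[OF lQu lm] nu_P[OF lu] nuu by (simp only: minus_zero add_0_right)
        moreover have "cmod (nu (\<lambda>x. Q \<theta> u x + - P u x)) \<le> \<bar>\<theta>\<bar> * K 1 * (c * B)"
          by (rule nu_bdd[OF lip_add[OF lQu lm]]) (unfold add_uminus_conv_diff, rule Q_P[OF lu ub])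
        ultimately show ?thesis by (simp add: t_def)
      qed
      have nuS: "an (Suc n) = an n * nu (Q \<theta> (\<lambda>_. 1)) + nu (Q \<theta> u)"
      proof -
        have "an (Suc n) = nu (\<lambda>x. an n * Q \<theta> (\<lambda>_. 1) x + Q \<theta> u x)"
          unfolding an_def by (rule nu_cong) (use dec in \<open>simp add: an_def\<close>)
        also have "\<dots> = an n * nu (Q \<theta> (\<lambda>_. 1)) + nu (Q \<theta> u)"
          unfolding nu_add[OF l1 lQu] by (simp add: nu_linear[OF Q1_lip] bounded_linear_mult_right)
        finally show ?thesis .
      qed
      have e: "cmod (an (Suc n) - an n * of_real z) \<le> C1 * t ^ 3 * cmod (an n)"
      proof -
        have "an (Suc n) - an n * of_real z = an n * (nu (Q \<theta> (\<lambda>_. 1)) - of_real z) + nu (Q \<theta> u)"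
          unfolding nuS by (simp add: algebra_simps)
        also have "cmod \<dots> \<le> cmod (an n) * (t ^ 3 * K 3) + t * K 1 * (c * B)"
          by (rule norm_triangle_le[OF add_mono[OF _ nuQu]], unfold norm_mult, rule mult_left_mono)
             (use nu_Q1_approx[of \<theta>] in \<open>auto simp: z_def t_def\<close>)
        also have "\<dots> = C1 * t ^ 3 * cmod (an n)"
          by (simp add: C1_def c_def power2_eq_square power3_eq_cube algebra_simps)
        finally show ?thesis .
      qed
      \<comment> \<open>The oscillation of the next iterate has to be compared with the new mean, so
        this mean must not drop too far.\<close>
      have lower: "cmod (an n) * (1 - \<eta>) \<le> cmod (an (Suc n))"
      proof -
        have "cmod (an n * of_real z) \<le> cmod (an (Suc n)) + C1 * t ^ 3 * cmod (an n)"
          using e norm_triangle_ineq2[of "an n * of_real z" "an (Suc n)"] by (simp add: norm_minus_commute)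
        moreover have "cmod (an n) * z \<le> cmod (an n * of_real z)"
          unfolding norm_mult by (intro mult_left_mono) auto
        moreover have "C1 * t ^ 3 \<le> C1 * t" "t\<^sup>2 * s2 / 2 \<le> t * s2 / 2"
          using tt C1 s2 by (auto intro: mult_left_mono)
        then have "1 - \<eta> \<le> z - C1 * t ^ 3"
          using t(3) by (simp add: z_def t2 algebra_simps)
        then have "cmod (an n) * (1 - \<eta>) \<le> cmod (an n) * (z - C1 * t ^ 3)"
          by (intro mult_left_mono) auto
        ultimately show ?thesis by (simp add: algebra_simps)
      qed
      have "cmod (an n) * (3 * \<theta>\<^sup>2 * K 2) + (a * c + \<bar>\<theta>\<bar> * K 1 * (c * B))
         = cmod (an n) * t\<^sup>2 * (3 * K 2 + q * (a + t * (K 1 * B)))"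
        by (simp add: c_def t2 t_def[symmetric] algebra_simps)
      also have "\<dots> \<le> cmod (an n) * t\<^sup>2 * (q * \<eta> + q * (a + \<eta>))"
      proof (intro mult_left_mono add_mono)
        show "3 * K 2 \<le> q * \<eta>" using a by (simp add: q_def \<eta>_def)
        show "t * (K 1 * B) \<le> \<eta>" using t(4) t(1) by (simp add: distrib_left)
      qed (use q in auto)
      also have "\<dots> = q * t\<^sup>2 * (cmod (an n) * (1 - \<eta>))"
        by (simp add: \<eta>_def field_simps)
      also have "\<dots> \<le> q * t\<^sup>2 * cmod (an (Suc n))"
        using lower q by (intro mult_left_mono) auto
      finally show ?thesis using lip_mono[OF l2] e by blast
    qed
    have \<phi>0: "lip (q * t\<^sup>2 * cmod (an 0)) (\<phi> 0)" "an 0 = 1"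
      using q D_nonneg by (auto simp: \<phi>_def an_def lip_def nu_const)
    have L: "lip (q * t\<^sup>2 * cmod (an n)) (\<phi> n)" for n
      by (induction n) (use \<phi>0 step in auto)
    define w where "w = s2 * \<theta>\<^sup>2 / 4"
    have w: "0 \<le> w" "w \<le> 1/4"
    proof -
      show "0 \<le> w" using s2 by (simp add: w_def)
      have "s2 * t\<^sup>2 \<le> s2 * t" using tt s2 by (intro mult_left_mono) auto
      also have "\<dots> \<le> 1" using t(1,6) by (simp add: algebra_simps)
      finally show "w \<le> 1/4" by (simp add: w_def t2)
    qed
    have Ew: "E = exp (- (2 * w))" and rw: "r = exp (- w)" by (simp_all add: E_def r_def w_def)
    have Er: "0 \<le> E" "E \<le> r" "0 < r" using w by (auto simp: Ew rw)
    have rhalf: "1/2 \<le> r" using exp_ge_add_one_self[of "- w"] w by (simp add: rw)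
    have zE: "\<bar>z - E\<bar> \<le> s2\<^sup>2 / 8 * t ^ 3"
    proof -
      have "\<bar>exp (- (2 * w)) - (1 - 2 * w)\<bar> \<le> (2 * w)\<^sup>2 / 2"
        using exp_minus_bounds[of "2 * w"] w by simp
      moreover have "z = 1 - 2 * w" by (simp add: z_def w_def)
      moreover have "(2 * w)\<^sup>2 / 2 = s2\<^sup>2 / 8 * t ^ 4"
        by (simp add: w_def t_def power_mult_distrib power_divide flip: power_mult)
      moreover have "s2\<^sup>2 / 8 * t ^ 4 \<le> s2\<^sup>2 / 8 * t ^ 3" using tt by (intro mult_left_mono) auto
      ultimately show ?thesis by (simp add: Ew abs_minus_commute)
    qed
    have aE: "cmod (an (Suc n) - an n * of_real E) \<le> C2 * t ^ 3 * cmod (an n)" for n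
    proof -
      have "an (Suc n) - an n * of_real E = (an (Suc n) - an n * of_real z) + an n * of_real (z - E)"
        by (simp add: algebra_simps)
      also have "cmod \<dots> \<le> C1 * t ^ 3 * cmod (an n) + cmod (an n) * (s2\<^sup>2 / 8 * t ^ 3)"
        by (rule norm_triangle_le[OF add_mono], (use step[OF L] in blast), unfold norm_mult norm_of_real,
            rule mult_left_mono[OF zE norm_ge_zero])
      finally show ?thesis by (simp add: C2_def algebra_simps)
    qed
    have Er2: "E + C2 * t ^ 3 \<le> r"
    proof -
      have "C2 * t ^ 3 = (t * C2) * t\<^sup>2" by (simp add: power2_eq_square power3_eq_cube)
      also have "t * C2 \<le> s2 / 8" using t(1,5) C2 by (simp add: algebra_simps)
      also have "s2 / 8 * t\<^sup>2 = w / 2" by (simp add: w_def t2)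
      finally have "C2 * t ^ 3 \<le> w / 2" by (simp add: mult_right_mono)
      moreover have "w / 2 \<le> r - E"
      proof -
        have "w * (1/2) \<le> w * (1 - 2 * w)" using w by (intro mult_left_mono) auto
        also have "\<dots> \<le> (exp w - 1) * exp (- (2 * w))"
        proof (rule mult_mono)
          show "w \<le> exp w - 1" using exp_ge_add_one_self[of w] by linarith
          show "1 - 2 * w \<le> exp (- (2 * w))" using exp_ge_add_one_self[of "- (2 * w)"] by linarith
        qed (use w in auto)
        also have "\<dots> = r - E" by (simp add: Ew rw left_diff_distrib exp_add[symmetric])
        finally show ?thesis by simp
      qed
      ultimately show ?thesis by simp
    qed
    have an_le: "cmod (an n) \<le> r ^ n" for n
    proof (induction n)
      case (Suc n)
      have "cmod (an (Suc n)) \<le> cmod (an n * of_real E) + C2 * t ^ 3 * cmod (an n)"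
        using aE[of n] norm_triangle_ineq2[of "an (Suc n)" "an n * of_real E"] by simp
      also have "\<dots> = (E + C2 * t ^ 3) * cmod (an n)" using Er by (simp add: norm_mult algebra_simps)
      also have "\<dots> \<le> r * r ^ n" using Er2 Suc Er by (intro mult_mono) auto
      finally show ?case by simp
    qed (simp add: \<phi>0)
    \<comment> \<open>Summing the one-step errors would give \<open>r ^ (n - 1)\<close>; the factor
      \<open>r\<close> on the left avoids the subtraction and is removed later by
      \<open>r \<ge> 1 / 2\<close>.\<close>
    have diff: "r * cmod (an n - of_real (E ^ n)) \<le> n * (C2 * t ^ 3) * r ^ n" for n
    proof (induction n)
      case (Suc n)
      have "an (Suc n) - of_real (E ^ Suc n) = (an (Suc n) - an n * of_real E) + (an n - of_real (E ^ n)) * of_real E"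
        by (simp add: algebra_simps)
      also have "cmod \<dots> \<le> C2 * t ^ 3 * cmod (an n) + cmod (an n - of_real (E ^ n)) * E"
        by (rule norm_triangle_le[OF add_mono[OF aE]]) (use Er in \<open>simp add: norm_mult\<close>)
      also have "\<dots> \<le> C2 * t ^ 3 * r ^ n + cmod (an n - of_real (E ^ n)) * r"
        using an_le[of n] Er C2 t by (intro add_mono mult_left_mono) auto
      finally have le: "cmod (an (Suc n) - of_real (E ^ Suc n)) \<le> C2 * t ^ 3 * r ^ n + cmod (an n - of_real (E ^ n)) * r" .
      have "r * cmod (an (Suc n) - of_real (E ^ Suc n)) \<le> r * (C2 * t ^ 3 * r ^ n + r * cmod (an n - of_real (E ^ n)))"
        by (rule mult_left_mono) (use Er le in \<open>simp_all add: mult.commute\<close>)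
      also have "\<dots> \<le> r * (C2 * t ^ 3 * r ^ n + n * (C2 * t ^ 3) * r ^ n)"
        using Suc Er by (intro mult_left_mono add_left_mono) auto
      finally show ?case by (simp add: algebra_simps)
    qed (simp add: \<phi>0)
    have diff2: "cmod (an n - of_real (E ^ n)) \<le> 2 * (n * (C2 * t ^ 3) * r ^ n)"
    proof -
      have "1/2 * cmod (an n - of_real (E ^ n)) \<le> r * cmod (an n - of_real (E ^ n))"
        using rhalf by (intro mult_right_mono) auto
      then show ?thesis using diff[of n] by simp
    qed
    have "cmod (\<phi> n x0 - an n) \<le> q * t\<^sup>2 * cmod (an n) * B"
      using nu_close0[OF L x0] by (simp add: an_def)
    also have "\<dots> \<le> q * t\<^sup>2 * r ^ n * B"
      using an_le[of n] q B_nonneg by (intro mult_left_mono mult_right_mono) auto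
    finally have f1: "cmod (\<phi> n x0 - an n) \<le> B * q * t\<^sup>2 * r ^ n" by (simp add: mult_ac)
    have "cmod (\<phi> n x0 - of_real (E ^ n)) \<le> B * q * t\<^sup>2 * r ^ n + 2 * C2 * (n * t ^ 3) * r ^ n"
      using norm_triangle_ineq[of "\<phi> n x0 - an n" "an n - of_real (E ^ n)"] f1 diff2 by (simp add: mult_ac)
    also have "\<dots> \<le> (B * q + 2 * C2) * (t\<^sup>2 + n * t ^ 3) * r ^ n"
    proof -
      have "B * q * t\<^sup>2 \<le> B * q * (t\<^sup>2 + n * t ^ 3)" "2 * C2 * (n * t ^ 3) \<le> 2 * C2 * (t\<^sup>2 + n * t ^ 3)"
        using B_nonneg q C2 t by (intro mult_left_mono; simp)+
      then have "(B * q * t\<^sup>2 + 2 * C2 * (n * t ^ 3)) * r ^ n \<le> (B * q + 2 * C2) * (t\<^sup>2 + n * t ^ 3) * r ^ n"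
        using Er by (intro mult_right_mono) (auto simp: distrib_right)
      then show ?thesis by (simp add: distrib_right)
    qed
    finally have fin: "cmod (\<phi> n x0 - of_real (E ^ n)) \<le> (B * q + 2 * C2) * (t\<^sup>2 + n * t ^ 3) * r ^ n" .
    have "E ^ n = exp (- s2 * \<theta>\<^sup>2 * n / 2)" "r ^ n = exp (- s2 * \<theta>\<^sup>2 * n / 4)"
      by (simp_all add: E_def r_def exp_of_nat_mult[symmetric] mult_ac)
    with fin show ?thesis unfolding \<phi>_def t2 unfolding t_def by simp
  qed
  have "0 \<le> B * q + 2 * C2" using B_nonneg q C2 by simp
  then show ?thesis using main c0 by blast
qed

end

text \<open>The mean \<open>f x\<close> of the increment varies with the state. Adding the
  coboundary of the Poisson solution replaces it by the constant \<open>m = nu f\<close>.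
  Contraction holds only on average, so the pointwise expansion bound \<open>D_act\<close> is what
  keeps the coboundary Lipschitz for each single \<open>g\<close>.\<close>

lemma (in markov_contraction) ex_centering:
  assumes sigma_meas: "\<And>x. x \<in> X \<Longrightarrow> (\<lambda>g. \<sigma> g x) \<in> borel_measurable \<mu>"
    and l_meas: "l \<in> borel_measurable \<mu>"
    and l_ge_1: "\<And>g. g \<in> space \<mu> \<Longrightarrow> 1 \<le> l g"
    and l_int3: "integrable \<mu> (\<lambda>g. l g ^ 3)"
    and sigma_le: "\<And>g x. g \<in> space \<mu> \<Longrightarrow> x \<in> X \<Longrightarrow> \<bar>\<sigma> g x\<bar> \<le> l g"
    and sigma_lip: "\<And>g x y. g \<in> space \<mu> \<Longrightarrow> x \<in> X \<Longrightarrow> y \<in> X \<Longrightarrow> \<bar>\<sigma> g x - \<sigma> g y\<bar> \<le> l g * D x y"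
  shows "\<exists>m \<psi> c b K. lip c \<psi> \<and> (\<forall>x\<in>X. \<bar>\<psi> x\<bar> \<le> b) \<and>
    centered_cocycle \<mu> X act D B B' a x0 (\<lambda>g x. \<sigma> g x - m + \<psi> (act g x) - \<psi> x) (\<lambda>g. K * l g)"
proof -
  have l_int: "integrable \<mu> l"
  proof (rule Bochner_Integration.integrable_bound[OF l_int3 l_meas], rule AE_I2)
    fix g assume "g \<in> space \<mu>"
    then have "l g ^ 1 \<le> l g ^ 3" using l_ge_1 by (intro power_increasing) auto
    then show "norm (l g) \<le> norm (l g ^ 3)" using l_ge_1[OF \<open>g \<in> space \<mu>\<close>] by simp
  qed
  have s_int: "integrable \<mu> (\<lambda>g. \<sigma> g x)" if "x \<in> X" for x
    by (rule Bochner_Integration.integrable_bound[OF l_int sigma_meas[OF that]], rule AE_I2)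
       (use sigma_le that l_ge_1 in \<open>force intro: order_trans[OF sigma_le abs_ge_self]\<close>)
  define f where "f x = (\<integral>g. \<sigma> g x \<partial>\<mu>)" for x
  have l0: "0 \<le> (\<integral>g. l g \<partial>\<mu>)"
    by (rule integral_nonneg_AE, rule AE_I2) (use l_ge_1 in fastforce)
  have f: "lip (\<integral>g. l g \<partial>\<mu>) f"
    unfolding lip_def
  proof (intro conjI ballI l0)
    fix x y assume xy: "x \<in> X" "y \<in> X"
    have "f x - f y = (\<integral>g. \<sigma> g x - \<sigma> g y \<partial>\<mu>)" using s_int xy by (simp add: f_def)
    also have "norm \<dots> \<le> (\<integral>g. l g * D x y \<partial>\<mu>)"
      by (rule norm_integral_le) (use l_int sigma_lip xy in auto)
    finally show "norm (f x - f y) \<le> (\<integral>g. l g \<partial>\<mu>) * D x y" by simp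
  qed
  obtain \<psi> where psi: "lip ((\<integral>g. l g \<partial>\<mu>) / (1 - a)) \<psi>"
      "\<And>x. x \<in> X \<Longrightarrow> \<bar>\<psi> x\<bar> \<le> (\<integral>g. l g \<partial>\<mu>) * B / (1 - a)" "\<And>x. x \<in> X \<Longrightarrow> \<psi> x - P \<psi> x = f x - nu f"
    using poisson_equation[OF f] by blast
  define m where "m = nu f"
  define c where "c = (\<integral>g. l g \<partial>\<mu>) / (1 - a)"
  define b where "b = (\<integral>g. l g \<partial>\<mu>) * B / (1 - a)"
  have c: "0 \<le> c" using lip_nonneg[OF psi(1)] by (simp add: c_def)
  have b: "0 \<le> b" using psi(2)[OF x0] abs_ge_zero order_trans unfolding b_def by blast
  \<comment> \<open>As \<open>l g \<ge> 1\<close>, the constants coming from \<open>m\<close> and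
    \<psi> are absorbed into a multiple of \<open>l g\<close>; \<open>K\<close> covers the size
    bound and the Lipschitz bound at once.\<close>
  define K where "K = 1 + \<bar>m\<bar> + 2 * b + c * B' + c"
  have K1: "1 + \<bar>m\<bar> + 2 * b \<le> K" "1 + c * B' + c \<le> K" "1 \<le> K"
    using b c B' mult_nonneg_nonneg[OF c B'] by (auto simp: K_def)
  define \<xi> where "\<xi> g x = \<sigma> g x - m + \<psi> (act g x) - \<psi> x" for g x
  have "centered_cocycle \<mu> X act D B B' a x0 \<xi> (\<lambda>g. K * l g)"
  proof unfold_locales
    show "(\<lambda>g. K * l g) \<in> borel_measurable \<mu>" using l_meas by simp
    show "integrable \<mu> (\<lambda>g. (K * l g) ^ 3)" using l_int3 by (simp add: power_mult_distrib)
    fix x assume x: "x \<in> X"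
    show "(\<lambda>g. \<xi> g x) \<in> borel_measurable \<mu>"
      unfolding \<xi>_def using sigma_meas[OF x] lip_meas[OF psi(1) x] by simp
    show "(\<integral>g. \<xi> g x \<partial>\<mu>) = 0"
      using s_int[OF x] lip_integrable[OF psi(1) x] psi(3)[OF x]
      by (simp add: \<xi>_def prob_space P_def f_def m_def)
  next
    fix g x assume g: "g \<in> space \<mu>" and x: "x \<in> X"
    have "\<bar>\<xi> g x\<bar> \<le> \<bar>\<sigma> g x\<bar> + \<bar>m\<bar> + \<bar>\<psi> (act g x)\<bar> + \<bar>\<psi> x\<bar>" by (simp add: \<xi>_def)
    also have "\<dots> \<le> l g + (\<bar>m\<bar> + 2 * b) * 1"
      using sigma_le[OF g x] psi(2)[OF x] psi(2)[OF act_X[OF g x]] by (simp add: b_def)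
    also have "\<dots> \<le> l g + (\<bar>m\<bar> + 2 * b) * l g"
      using l_ge_1[OF g] b by (intro add_left_mono mult_left_mono) auto
    also have "\<dots> = (1 + \<bar>m\<bar> + 2 * b) * l g" by (simp add: algebra_simps)
    also have "\<dots> \<le> K * l g" using K1 l_ge_1[OF g] by (intro mult_right_mono) auto
    finally show "\<bar>\<xi> g x\<bar> \<le> K * l g" .
  next
    fix g assume g: "g \<in> space \<mu>"
    show "1 \<le> K * l g" using mult_mono[OF K1(3) l_ge_1[OF g]] K1 by simp
    fix x y assume xy: "x \<in> X" "y \<in> X"
    have "\<bar>\<psi> (act g x) - \<psi> (act g y)\<bar> \<le> c * (B' * D x y)"
      using lipD[OF psi(1) act_X[OF g xy(1)] act_X[OF g xy(2)]] mult_left_mono[OF D_act[OF g xy] c]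
      by (simp add: c_def)
    moreover have "\<bar>\<psi> x - \<psi> y\<bar> \<le> c * D x y"
      using lipD[OF psi(1) xy] by (simp add: c_def)
    ultimately have "\<bar>\<xi> g x - \<xi> g y\<bar> \<le> l g * D x y + ((c * B' + c) * D x y) * 1"
      using sigma_lip[OF g xy] unfolding \<xi>_def by (simp add: algebra_simps)
    also have "\<dots> \<le> l g * D x y + ((c * B' + c) * D x y) * l g"
      using l_ge_1[OF g] c B' D_nonneg[OF xy] by (intro add_left_mono mult_left_mono) auto
    also have "\<dots> = (1 + c * B' + c) * (l g * D x y)" by (simp add: algebra_simps)
    also have "\<dots> \<le> K * (l g * D x y)"
      using K1 l_ge_1[OF g] D_nonneg[OF xy] by (intro mult_right_mono) auto
    finally show "\<bar>\<xi> g x - \<xi> g y\<bar> \<le> K * l g * D x y" by (simp add: mult.assoc)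
  qed
  then show ?thesis using psi unfolding \<xi>_def[abs_def] by blast
qed

section \<open>Nonnegative matrices\<close>

text \<open>Positive vectors, not normalised, serve as state space: every function applied to them below is
  homogeneous of degree \<open>0\<close>.\<close>

definition Pos :: "(real ^ 'n::finite) set" where "Pos = {x. \<forall>i. 0 < x $ i}"

text \<open>These numbers are the l1 norms of the images of the basis vectors. The operator norm is
  their maximum and \<open>vmin\<close> their minimum, which turns both into finite
  expressions.\<close>

definition colsum :: "real ^ 'n::finite ^ 'n \<Rightarrow> 'n \<Rightarrow> real" where "colsum g j = (\<Sum>i\<in>UNIV. g $ i $ j)"

text \<open>Equal to \<open>1 - exp (- d)\<close> for the Hilbert projective distance
  \<open>d\<close>. On normalised vectors it is comparable with \<open>dproj\<close>, because
  \<open>phi s \<le> 1 - s \<le> 2 * phi s\<close> on the unit interval.\<close>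

definition pgap :: "real ^ 'n::finite \<Rightarrow> real ^ 'n \<Rightarrow> real" where
  "pgap x y = 1 - mratio x y * mratio y x"

text \<open>A quantitative form of strict positivity: within \<open>Gmat\<close> such a matrix has
  only positive entries, with all ratios at most \<open>K\<close>.\<close>

definition good :: "real \<Rightarrow> (real ^ 'n::finite ^ 'n) set" where
  "good K = {g. \<forall>i j k l. g $ i $ j \<le> K * g $ k $ l}"

section \<open>Column sums, norms and distortion\<close>

lemma mv_nth: "(g *v x :: real ^ 'n::finite) $ i = (\<Sum>j\<in>UNIV. g $ i $ j * x $ j)"
  by (simp add: matrix_vector_mult_def)

lemma GmatD: "g \<in> Gmat \<Longrightarrow> 0 \<le> g $ i $ j" "g \<in> Gmat \<Longrightarrow> \<exists>j. 0 < g $ i $ j" "g \<in> Gmat \<Longrightarrow> \<exists>i. 0 < g $ i $ j"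
  by (auto simp: Gmat_def)

lemma PosD: "x \<in> Pos \<Longrightarrow> 0 < x $ i"
  by (simp add: Pos_def)

lemma l1norm_nonneg: "0 \<le> l1norm x"
  by (simp add: l1norm_def sum_nonneg)

lemma l1norm_eq: "(\<And>i. 0 \<le> x $ i) \<Longrightarrow> l1norm x = (\<Sum>i\<in>UNIV. x $ i)"
  by (simp add: l1norm_def)

lemma l1norm_pos: "x \<in> Pos \<Longrightarrow> 0 < l1norm x"
  unfolding l1norm_def by (intro sum_pos) (auto simp: Pos_def less_imp_neq dest: less_imp_neq[symmetric])

lemma mv_nonneg: "g \<in> Gmat \<Longrightarrow> (\<And>i. 0 \<le> x $ i) \<Longrightarrow> 0 \<le> (g *v x) $ i"
  unfolding mv_nth by (intro sum_nonneg mult_nonneg_nonneg GmatD(1)) auto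

lemma mv_Pos: assumes "g \<in> Gmat" "x \<in> Pos" shows "g *v x \<in> Pos"
  unfolding Pos_def
proof (intro CollectI allI)
  fix i
  obtain j where "0 < g $ i $ j" using GmatD(2)[OF assms(1)] by blast
  then show "0 < (g *v x) $ i" unfolding mv_nth
    using GmatD(1)[OF assms(1)] PosD[OF assms(2)]
    by (intro sum_pos2[of UNIV j]) (auto intro!: mult_nonneg_nonneg intro: less_imp_le)
qed

lemma l1norm_mv:
  assumes "g \<in> Gmat" "\<And>i. 0 \<le> x $ i"
  shows "l1norm (g *v x) = (\<Sum>j\<in>UNIV. colsum g j * x $ j)"
proof -
  have "l1norm (g *v x) = (\<Sum>i\<in>UNIV. \<Sum>j\<in>UNIV. g $ i $ j * x $ j)"
    using mv_nonneg[OF assms] by (simp add: l1norm_def mv_nth)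
  also have "\<dots> = (\<Sum>j\<in>UNIV. \<Sum>i\<in>UNIV. g $ i $ j * x $ j)" by (rule sum.swap)
  finally show ?thesis by (simp add: colsum_def sum_distrib_right)
qed

lemma colsum_pos: assumes "g \<in> Gmat" shows "0 < colsum g j"
proof -
  obtain i where "0 < g $ i $ j" using GmatD(3)[OF assms] by blast
  then show ?thesis unfolding colsum_def
    using GmatD(1)[OF assms] by (intro sum_pos2[of UNIV i]) auto
qed

lemma axis_Splus: "axis j 1 \<in> Splus"
  by (auto simp: Splus_def l1norm_def axis_def)

lemma mv_axis_norm: "g \<in> Gmat \<Longrightarrow> l1norm (g *v axis j 1) = colsum g j"
  by (subst l1norm_mv) (auto simp: axis_def if_distrib[of "(*) _"] cong: if_cong)

lemma l1norm_mv_le: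
  assumes "g \<in> Gmat" "\<And>j. colsum g j \<le> c" shows "l1norm (g *v x) \<le> c * l1norm x"
proof -
  have "l1norm (g *v x) \<le> (\<Sum>i\<in>UNIV. \<Sum>j\<in>UNIV. g $ i $ j * \<bar>x $ j\<bar>)"
    unfolding l1norm_def mv_nth
    by (intro sum_mono order_trans[OF sum_abs]) (simp add: abs_mult GmatD(1)[OF assms(1)])
  also have "\<dots> = (\<Sum>j\<in>UNIV. \<Sum>i\<in>UNIV. g $ i $ j * \<bar>x $ j\<bar>)" by (rule sum.swap)
  also have "\<dots> = (\<Sum>j\<in>UNIV. colsum g j * \<bar>x $ j\<bar>)" by (simp add: colsum_def sum_distrib_right)
  also have "\<dots> \<le> (\<Sum>j\<in>UNIV. c * \<bar>x $ j\<bar>)" by (intro sum_mono mult_right_mono assms) auto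
  finally show ?thesis by (simp add: l1norm_def sum_distrib_left)
qed

lemma l1_onorm_eq: assumes "g \<in> Gmat" shows "l1_onorm g = Max (range (colsum g))"
  unfolding l1_onorm_def
proof (rule cSup_eq_maximum)
  have "Max (range (colsum g)) \<in> range (colsum g)" by (rule Max_in) auto
  then obtain j where "Max (range (colsum g)) = colsum g j" by (rule rangeE)
  then show "Max (range (colsum g)) \<in> (\<lambda>x. l1norm (g *v x)) ` {x. l1norm x = 1}"
    using mv_axis_norm[OF assms, of j] axis_Splus[of j] by (auto simp: Splus_def image_iff)
  show "y \<le> Max (range (colsum g))" if y: "y \<in> (\<lambda>x. l1norm (g *v x)) ` {x. l1norm x = 1}" for y
  proof -
    from y obtain x where "y = l1norm (g *v x)" "l1norm x = 1" by auto
    then show ?thesis using l1norm_mv_le[OF assms, of "Max (range (colsum g))" x] by auto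
  qed
qed

text \<open>On the simplex the norm of the image is a convex combination of the column sums, hence
  minimal at a vertex.\<close>

lemma vmin_eq: assumes "g \<in> Gmat" shows "vmin g = Min (range (colsum g))"
  unfolding vmin_def
proof (rule cInf_eq_minimum)
  have "Min (range (colsum g)) \<in> range (colsum g)" by (rule Min_in) auto
  then obtain j where "Min (range (colsum g)) = colsum g j" by (rule rangeE)
  then show "Min (range (colsum g)) \<in> (\<lambda>x. l1norm (g *v x)) ` Splus"
    using mv_axis_norm[OF assms, of j] axis_Splus[of j] by (auto simp: image_iff intro!: bexI[of _ "axis j 1"])
  show "Min (range (colsum g)) \<le> y" if y: "y \<in> (\<lambda>x. l1norm (g *v x)) ` Splus" for y
  proof -
    from y obtain x where x: "y = l1norm (g *v x)" "x \<in> Splus" by auto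
    have "Min (range (colsum g)) * (\<Sum>j\<in>UNIV. x $ j) \<le> (\<Sum>j\<in>UNIV. colsum g j * x $ j)"
      unfolding sum_distrib_left by (intro sum_mono mult_right_mono) (auto simp: Splus_nonneg[OF x(2)])
    then show ?thesis using x Splus_sum[OF x(2)] l1norm_mv[OF assms Splus_nonneg[OF x(2)]] by simp
  qed
qed

lemma colsum_le_onorm: "g \<in> Gmat \<Longrightarrow> colsum g j \<le> l1_onorm g"
  by (simp add: l1_onorm_eq)

lemma vmin_le_colsum: "g \<in> Gmat \<Longrightarrow> vmin g \<le> colsum g j"
  by (simp add: vmin_eq)

lemma vmin_pos: "g \<in> Gmat \<Longrightarrow> 0 < vmin g"
  by (simp add: vmin_eq colsum_pos)

lemma vmin_le_onorm: "g \<in> Gmat \<Longrightarrow> vmin g \<le> l1_onorm g"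
  using vmin_le_colsum colsum_le_onorm order_trans by blast

lemma onorm_pos: "g \<in> Gmat \<Longrightarrow> 0 < l1_onorm g"
  using vmin_pos vmin_le_onorm less_le_trans by blast

lemma l1norm_mv_le_onorm: "g \<in> Gmat \<Longrightarrow> l1norm (g *v x) \<le> l1_onorm g * l1norm x"
  by (rule l1norm_mv_le) (simp_all add: colsum_le_onorm)

lemma l1norm_mv_ge_vmin:
  assumes "g \<in> Gmat" "\<And>i. 0 \<le> x $ i" shows "vmin g * l1norm x \<le> l1norm (g *v x)"
  unfolding l1norm_mv[OF assms] l1norm_eq[OF assms(2)] sum_distrib_left
  by (intro sum_mono mult_right_mono vmin_le_colsum assms)

lemma colsum_mult: "colsum (g ** h) j = (\<Sum>i\<in>UNIV. colsum g i * h $ i $ j)"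
proof -
  have "colsum (g ** h) j = (\<Sum>i\<in>UNIV. \<Sum>k\<in>UNIV. g $ i $ k * h $ k $ j)"
    by (simp add: colsum_def matrix_matrix_mult_def)
  also have "\<dots> = (\<Sum>k\<in>UNIV. \<Sum>i\<in>UNIV. g $ i $ k * h $ k $ j)" by (rule sum.swap)
  finally show ?thesis by (simp add: colsum_def sum_distrib_right)
qed

lemma mult_nth: "(g ** h) $ i $ j = (\<Sum>k\<in>UNIV. g $ i $ k * h $ k $ j)"
  by (simp add: matrix_matrix_mult_def)

lemma Gmat_mult: assumes g: "g \<in> Gmat" and h: "h \<in> Gmat" shows "g ** h \<in> Gmat"
proof -
  have nn: "0 \<le> g $ i $ k * h $ k $ j" for i j k
    using GmatD(1)[OF g] GmatD(1)[OF h] by simp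
  have "\<exists>j. 0 < (g ** h) $ i $ j" for i
  proof -
    obtain k where k: "0 < g $ i $ k" using GmatD(2)[OF g] by blast
    obtain j where j: "0 < h $ k $ j" using GmatD(2)[OF h] by blast
    have "0 < (g ** h) $ i $ j" unfolding mult_nth
      using nn j k by (intro sum_pos2[of UNIV k]) auto
    then show ?thesis by blast
  qed
  moreover have "\<exists>i. 0 < (g ** h) $ i $ j" for j
  proof -
    obtain k where k: "0 < h $ k $ j" using GmatD(3)[OF h] by blast
    obtain i where i: "0 < g $ i $ k" using GmatD(3)[OF g] by blast
    have "0 < (g ** h) $ i $ j" unfolding mult_nth
      using nn i k by (intro sum_pos2[of UNIV k]) auto
    then show ?thesis by blast
  qed
  moreover have "0 \<le> (g ** h) $ i $ j" for i j
    unfolding mult_nth by (intro sum_nonneg nn)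
  ultimately show ?thesis by (simp add: Gmat_def)
qed

lemma Gmat_one: "mat 1 \<in> Gmat"
  by (auto simp: Gmat_def mat_def)

lemma onorm_mult:
  assumes "g \<in> Gmat" "h \<in> Gmat" shows "l1_onorm (g ** h) \<le> l1_onorm g * l1_onorm h"
proof -
  have "colsum (g ** h) j \<le> l1_onorm g * l1_onorm h" for j
  proof -
    have "colsum (g ** h) j \<le> l1_onorm g * colsum h j"
      unfolding colsum_mult unfolding colsum_def[of h] sum_distrib_left
      by (intro sum_mono mult_right_mono colsum_le_onorm GmatD(1) assms)
    also have "\<dots> \<le> l1_onorm g * l1_onorm h"
      using onorm_pos[OF assms(1)] colsum_le_onorm[OF assms(2)] by (intro mult_left_mono) auto
    finally show ?thesis .
  qed
  then show ?thesis by (subst l1_onorm_eq[OF Gmat_mult[OF assms]]) auto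
qed

lemma vmin_mult:
  assumes "g \<in> Gmat" "h \<in> Gmat" shows "vmin g * vmin h \<le> vmin (g ** h)"
proof -
  have "vmin g * vmin h \<le> colsum (g ** h) j" for j
  proof -
    have "vmin g * vmin h \<le> vmin g * colsum h j"
      using vmin_pos[OF assms(1)] vmin_le_colsum[OF assms(2)] by (intro mult_left_mono) auto
    also have "\<dots> \<le> colsum (g ** h) j"
      unfolding colsum_mult unfolding colsum_def[of h] sum_distrib_left
      by (intro sum_mono mult_right_mono vmin_le_colsum GmatD(1) assms)
    finally show ?thesis .
  qed
  then show ?thesis by (subst vmin_eq[OF Gmat_mult[OF assms]]) auto
qed

lemma Lmat_ge_1: "g \<in> Gmat \<Longrightarrow> 1 \<le> Lmat g"
  using vmin_le_onorm[of g] vmin_pos[of g] by (simp add: Lmat_def)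

lemma Lmat_mult:
  assumes "g \<in> Gmat" "h \<in> Gmat" shows "Lmat (g ** h) \<le> Lmat g * Lmat h"
proof -
  have "l1_onorm (g ** h) / vmin (g ** h) \<le> (l1_onorm g * l1_onorm h) / (vmin g * vmin h)"
    using onorm_mult[OF assms] vmin_mult[OF assms] vmin_pos[OF assms(1)] vmin_pos[OF assms(2)] onorm_pos[OF Gmat_mult[OF assms]]
    by (intro frac_le) auto
  then show ?thesis by (simp add: Lmat_def)
qed

lemma ln_Lmat_mult:
  assumes "g \<in> Gmat" "h \<in> Gmat" shows "ln (Lmat (g ** h)) \<le> ln (Lmat g) + ln (Lmat h)"
proof -
  have "ln (Lmat (g ** h)) \<le> ln (Lmat g * Lmat h)"
    using Lmat_mult[OF assms] Lmat_ge_1[OF Gmat_mult[OF assms]]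
    by (subst ln_le_cancel_iff) auto
  also have "\<dots> = ln (Lmat g) + ln (Lmat h)"
    using Lmat_ge_1[OF assms(1)] Lmat_ge_1[OF assms(2)] by (simp add: ln_mult)
  finally show ?thesis .
qed

text \<open>A column sum of \<open>g ** h\<close> combines the entries of one column of
  \<open>h\<close> with the weights \<open>colsum g i\<close>. Exchanging that column for another
  costs a factor \<open>K\<close>, whatever the weights.\<close>

lemma Lmat_mult_good:
  assumes g: "g \<in> Gmat" and h: "h \<in> Gmat" "h \<in> good K" shows "Lmat (g ** h) \<le> K"
proof -
  have le: "colsum (g ** h) j \<le> K * colsum (g ** h) l" for j l
    unfolding colsum_mult sum_distrib_left
  proof (intro sum_mono)
    fix i
    have "colsum g i * h $ i $ j \<le> colsum g i * (K * h $ i $ l)"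
      using h(2) colsum_pos[OF g, of i] unfolding good_def by (intro mult_left_mono) auto
    then show "colsum g i * h $ i $ j \<le> K * (colsum g i * h $ i $ l)" by (simp add: mult_ac)
  qed
  have gh: "g ** h \<in> Gmat" by (rule Gmat_mult[OF g h(1)])
  have "Max (range (colsum (g ** h))) \<in> range (colsum (g ** h))" by (rule Max_in) auto
  moreover have "Min (range (colsum (g ** h))) \<in> range (colsum (g ** h))" by (rule Min_in) auto
  ultimately obtain j l where "Max (range (colsum (g ** h))) = colsum (g ** h) j"
      "Min (range (colsum (g ** h))) = colsum (g ** h) l"
    by (elim rangeE)
  then have "l1_onorm (g ** h) \<le> K * vmin (g ** h)"
    unfolding l1_onorm_eq[OF gh] vmin_eq[OF gh] using le by simp
  then show ?thesis using vmin_pos[OF gh] by (simp add: Lmat_def divide_le_eq)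
qed

lemma Nmat_ge_1: assumes "g \<in> Gmat" shows "1 \<le> Nmat g"
proof (cases "1 \<le> l1_onorm g")
  case False
  then have "vmin g \<le> 1" using vmin_le_onorm[OF assms] by simp
  then have "1 \<le> 1 / vmin g" using vmin_pos[OF assms] by simp
  then show ?thesis by (simp add: Nmat_def)
qed (simp add: Nmat_def)

section \<open>Coordinate ratios of positive vectors and the projective gap\<close>

lemma le_mratio_Pos:
  assumes "y \<in> Pos" "\<And>i. c * y $ i \<le> x $ i" shows "c \<le> mratio x y"
  unfolding mratio_def
proof (rule cINF_greatest)
  show "{i. 0 < y $ i} \<noteq> {}" using PosD[OF assms(1)] by auto
  show "c \<le> x $ i / y $ i" if "i \<in> {i. 0 < y $ i}" for i
    using that assms(2)[of i] by (simp add: pos_le_divide_eq)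
qed

lemma mratio_mult_le_Pos: assumes "y \<in> Pos" shows "mratio x y * y $ i \<le> x $ i"
proof -
  have "mratio x y \<le> x $ i / y $ i"
    unfolding mratio_def by (rule cINF_lower) (use PosD[OF assms] in auto)
  then show ?thesis using PosD[OF assms, of i] by (simp add: pos_le_divide_eq)
qed

lemma mratio_attained: assumes "y \<in> Pos" shows "\<exists>i. mratio x y * y $ i = x $ i"
proof -
  have "mratio x y = Min (range (\<lambda>i. x $ i / y $ i))"
    unfolding mratio_def using PosD[OF assms] by (simp add: cInf_eq_Min)
  moreover have "Min (range (\<lambda>i. x $ i / y $ i)) \<in> range (\<lambda>i. x $ i / y $ i)" by (rule Min_in) auto
  ultimately have "mratio x y \<in> range (\<lambda>i. x $ i / y $ i)" by simp
  then obtain i where "mratio x y = x $ i / y $ i" by (rule rangeE)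
  then show ?thesis using PosD[OF assms, of i] by (intro exI[of _ i]) simp
qed

lemma mratio_pos: assumes "x \<in> Pos" "y \<in> Pos" shows "0 < mratio x y"
proof -
  obtain i where "mratio x y * y $ i = x $ i" using mratio_attained[OF assms(2)] by blast
  then show ?thesis using PosD[OF assms(1), of i] PosD[OF assms(2), of i] by (simp add: zero_less_mult_iff flip: \<open>_ = x $ i\<close>)
qed

lemma mratio_prod_le_1: assumes "x \<in> Pos" "y \<in> Pos" shows "mratio x y * mratio y x \<le> 1"
proof -
  fix i :: 'a
  have "mratio x y * (mratio y x * x $ i) \<le> mratio x y * y $ i"
    using mratio_mult_le_Pos[OF assms(1)] mratio_pos[OF assms] by (intro mult_left_mono) auto
  also have "\<dots> \<le> 1 * x $ i" using mratio_mult_le_Pos[OF assms(2)] by simp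
  finally show ?thesis using PosD[OF assms(1), of i] unfolding mult.assoc[symmetric] by (simp only: mult_le_cancel_right_pos)
qed

lemma pgap_nonneg: "x \<in> Pos \<Longrightarrow> y \<in> Pos \<Longrightarrow> 0 \<le> pgap x y"
  using mratio_prod_le_1[of x y] by (simp add: pgap_def)

lemma pgap_less_1: "x \<in> Pos \<Longrightarrow> y \<in> Pos \<Longrightarrow> pgap x y < 1"
  using mratio_pos[of x y] mratio_pos[of y x] by (simp add: pgap_def)

lemma pgap_commute: "pgap x y = pgap y x"
  by (simp add: pgap_def mult.commute)

lemma mv_diff_nth: "(g *v x :: real ^ 'n::finite) $ i - m * (g *v y) $ i = (\<Sum>j\<in>UNIV. g $ i $ j * (x $ j - m * y $ j))"
  unfolding mv_nth sum_distrib_left sum_subtractf[symmetric]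
  by (intro sum.cong refl) (simp add: right_diff_distrib mult_ac)

text \<open>The vector \<open>x - mratio x y *\<^sub>R y\<close> is nonnegative, and
  \<open>g\<close> preserves the nonnegative cone.\<close>

lemma mratio_mv_ge:
  assumes g: "g \<in> Gmat" and "x \<in> Pos" "y \<in> Pos"
  shows "mratio x y \<le> mratio (g *v x) (g *v y)"
proof (rule le_mratio_Pos[OF mv_Pos[OF g assms(3)]])
  fix i
  have "0 \<le> (g *v x) $ i - mratio x y * (g *v y) $ i"
    unfolding mv_diff_nth using mratio_mult_le_Pos[OF assms(3), of x]
    by (intro sum_nonneg mult_nonneg_nonneg GmatD(1)[OF g]) auto
  then show "mratio x y * (g *v y) $ i \<le> (g *v x) $ i" by simp
qed

lemma pgap_mv_le:
  assumes "g \<in> Gmat" "x \<in> Pos" "y \<in> Pos"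
  shows "pgap (g *v x) (g *v y) \<le> pgap x y"
  unfolding pgap_def using assms
  by (intro diff_left_mono mult_mono mratio_mv_ge less_imp_le[OF mratio_pos] mv_Pos) auto

text \<open>Writing \<open>m\<close>, \<open>M\<close> for the extreme values of \<open>x i / y i\<close> and \<open>m'\<close>, \<open>M'\<close> for those of the images,
  comparability of the entries gives \<open>m' \<ge> (1 - \<epsilon>) m + \<epsilon> M'\<close> with \<open>\<epsilon> = 1 / K\<^sup>2\<close>; dividing by
  \<open>M' \<le> M\<close> yields the contraction.\<close>

lemma pgap_mv_good:
  assumes g: "g \<in> Gmat" "g \<in> good K" and K: "1 \<le> K" and xy: "x \<in> Pos" "y \<in> Pos"
  shows "pgap (g *v x) (g *v y) \<le> (1 - 1 / K\<^sup>2) * pgap x y"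
proof -
  let ?X = "g *v x" and ?Y = "g *v y"
  have P: "?X \<in> Pos" "?Y \<in> Pos" using mv_Pos[OF g(1)] xy by auto
  define m where "m = mratio x y"
  define m' where "m' = mratio ?X ?Y"
  define p where "p = mratio y x"
  define p' where "p' = mratio ?Y ?X"
  have pos: "0 < m" "0 < p" "0 < m'" "0 < p'" using mratio_pos xy P by (auto simp: m_def p_def m'_def p'_def)
  have pp: "p \<le> p'" unfolding p_def p'_def by (rule mratio_mv_ge[OF g(1) xy(2,1)])
  \<comment> \<open>A row in which the ratio of the images is largest; that ratio is
    \<open>M' = 1 / p'\<close>.\<close>
  obtain i where i: "p' * ?X $ i = ?Y $ i" using mratio_attained[OF P(1)] unfolding p'_def by blast
  define M' where "M' = 1 / p'"
  have Xi: "?X $ i = M' * ?Y $ i" using i pos by (simp add: M'_def field_simps)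
  have nn: "0 \<le> x $ j - m * y $ j" for j using mratio_mult_le_Pos[OF xy(2), of x j] by (simp add: m_def)
  have mM: "0 \<le> M' - m"
  proof -
    have "0 \<le> ?X $ i - m * ?Y $ i" unfolding mv_diff_nth
      using nn by (intro sum_nonneg mult_nonneg_nonneg GmatD(1)[OF g(1)]) auto
    then have "0 \<le> (M' - m) * ?Y $ i" by (simp add: Xi left_diff_distrib)
    then show ?thesis using PosD[OF P(2), of i] by (simp add: zero_le_mult_iff)
  qed
  have "m + 1 / K\<^sup>2 * (M' - m) \<le> m'"
    unfolding m'_def
  proof (rule le_mratio_Pos[OF P(2)])
    fix k
    have Yk: "?Y $ k \<le> K * ?Y $ i"
      unfolding mv_nth sum_distrib_left
    proof (intro sum_mono)
      fix j
      have "g $ k $ j * y $ j \<le> (K * g $ i $ j) * y $ j"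
        using g(2) PosD[OF xy(2), of j] unfolding good_def by (intro mult_right_mono) auto
      then show "g $ k $ j * y $ j \<le> K * (g $ i $ j * y $ j)" by (simp add: mult_ac)
    qed
    have "?X $ i - m * ?Y $ i \<le> K * (?X $ k - m * ?Y $ k)"
      unfolding mv_diff_nth sum_distrib_left
    proof (intro sum_mono)
      fix j
      have "g $ i $ j * (x $ j - m * y $ j) \<le> (K * g $ k $ j) * (x $ j - m * y $ j)"
        using g(2) nn unfolding good_def by (intro mult_right_mono) auto
      then show "g $ i $ j * (x $ j - m * y $ j) \<le> K * (g $ k $ j * (x $ j - m * y $ j))" by (simp add: mult_ac)
    qed
    then have "(M' - m) * ?Y $ i \<le> K * (?X $ k - m * ?Y $ k)" by (simp add: Xi left_diff_distrib)
    \<comment> \<open>One factor \<open>K\<close> comes from exchanging row \<open>i\<close> for row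
      \<open>k\<close> in the nonnegative differences, the other from the same exchange in
      \<open>y\<close>; together they give the square in \<open>1 / K\<^sup>2\<close>.\<close>
    then have "(M' - m) * (K * ?Y $ i) \<le> K * K * (?X $ k - m * ?Y $ k)"
      using K mult_left_mono[of "(M' - m) * ?Y $ i" _ K] by (simp add: mult_ac)
    moreover have "(M' - m) * ?Y $ k \<le> (M' - m) * (K * ?Y $ i)" using Yk mM by (intro mult_left_mono)
    ultimately have "(M' - m) * ?Y $ k \<le> K\<^sup>2 * (?X $ k - m * ?Y $ k)" by (simp add: power2_eq_square)
    then have "1 / K\<^sup>2 * ((M' - m) * ?Y $ k) \<le> 1 / K\<^sup>2 * (K\<^sup>2 * (?X $ k - m * ?Y $ k))"
      by (intro mult_left_mono) auto
    then show "(m + 1 / K\<^sup>2 * (M' - m)) * ?Y $ k \<le> ?X $ k"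
      using K by (simp add: distrib_right)
  qed
  then have "(m + 1 / K\<^sup>2 * (M' - m)) * p' \<le> m' * p'" using pos by (intro mult_right_mono) auto
  moreover have "(m + 1 / K\<^sup>2 * (M' - m)) * p' = (1 - 1 / K\<^sup>2) * (m * p') + 1 / K\<^sup>2"
  proof -
    have "(m + e * (M' - m)) * p' = (1 - e) * (m * p') + e * (M' * p')" for e by (simp add: algebra_simps)
    moreover have "M' * p' = 1" using pos by (simp add: M'_def)
    ultimately show ?thesis by (metis mult.right_neutral)
  qed
  moreover have "(1 - 1 / K\<^sup>2) * (m * p) \<le> (1 - 1 / K\<^sup>2) * (m * p')"
    using K pp pos by (intro mult_left_mono) (auto simp: one_le_power)
  ultimately have "(1 - 1 / K\<^sup>2) * (m * p) + 1 / K\<^sup>2 \<le> m' * p'" by simp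
  then show ?thesis unfolding pgap_def m_def[symmetric] m'_def[symmetric] p_def[symmetric] p'_def[symmetric]
    by (simp add: algebra_simps diff_divide_distrib)
qed

text \<open>Subtracting the logarithm of the norm of \<open>x\<close> makes this homogeneous of
  degree 0 in \<open>x\<close>, as the unnormalised state space demands. It agrees with
  \<open>cocycle\<close> on vectors of norm 1.\<close>

definition sig :: "real ^ 'n::finite ^ 'n \<Rightarrow> real ^ 'n \<Rightarrow> real" where
  "sig g x = ln (l1norm (g *v x)) - ln (l1norm x)"

lemma sig_bounds:
  assumes "g \<in> Gmat" "x \<in> Pos"
  shows "ln (vmin g) \<le> sig g x" "sig g x \<le> ln (l1_onorm g)"
proof -
  have x: "0 < l1norm x" "0 < l1norm (g *v x)" using l1norm_pos mv_Pos assms by auto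
  have "ln (vmin g * l1norm x) \<le> ln (l1norm (g *v x))"
    using l1norm_mv_ge_vmin[OF assms(1), of x] PosD[OF assms(2)] vmin_pos[OF assms(1)] x
    by (subst ln_le_cancel_iff) (auto intro: less_imp_le)
  then show "ln (vmin g) \<le> sig g x" using x vmin_pos[OF assms(1)] by (simp add: sig_def ln_mult)
  have "ln (l1norm (g *v x)) \<le> ln (l1_onorm g * l1norm x)"
    using l1norm_mv_le_onorm[OF assms(1), of x] onorm_pos[OF assms(1)] x by (subst ln_le_cancel_iff) auto
  then show "sig g x \<le> ln (l1_onorm g)" using x onorm_pos[OF assms(1)] by (simp add: sig_def ln_mult)
qed

lemma abs_sig_le: assumes "g \<in> Gmat" "x \<in> Pos" shows "\<bar>sig g x\<bar> \<le> ln (Nmat g)"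
proof -
  have "ln (l1_onorm g) \<le> ln (Nmat g)" using onorm_pos[OF assms(1)] by (simp add: Nmat_def)
  moreover have "ln (1 / vmin g) \<le> ln (Nmat g)"
    using vmin_pos[OF assms(1)] by (subst ln_le_cancel_iff) (auto simp: Nmat_def less_max_iff_disj)
  then have "- ln (vmin g) \<le> ln (Nmat g)" using vmin_pos[OF assms(1)] by (simp add: ln_div)
  ultimately show ?thesis using sig_bounds[OF assms] by simp
qed

lemma sig_mult:
  "sig (g ** h) x = sig g (h *v x) + sig h x"
  by (simp add: sig_def matrix_vector_mul_assoc)

text \<open>Coordinatewise, \<open>g *v x\<close> dominates \<open>mratio x y\<close> times
  \<open>g *v y\<close>, and \<open>y\<close> dominates \<open>mratio y x\<close> times
  \<open>x\<close>. Adding the logarithms of the two norm inequalities produces the product of the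
  ratios, which is \<open>1 - pgap x y\<close>.\<close>

lemma sig_diff_ge:
  assumes g: "g \<in> Gmat" and xy: "x \<in> Pos" "y \<in> Pos"
  shows "ln (1 - pgap x y) \<le> sig g x - sig g y"
proof -
  have P: "g *v x \<in> Pos" "g *v y \<in> Pos" using mv_Pos[OF g] xy by auto
  have mono: "mratio u v * l1norm v \<le> l1norm u" if "u \<in> Pos" "v \<in> Pos" for u v :: "real ^ 'a"
    using that mratio_mult_le_Pos[OF that(2), of u]
    by (simp add: l1norm_eq less_imp_le[OF PosD] sum_distrib_left sum_mono)
  have 1: "ln (mratio x y) + ln (l1norm (g *v y)) \<le> ln (l1norm (g *v x))"
  proof -
    have "mratio x y * l1norm (g *v y) \<le> mratio (g *v x) (g *v y) * l1norm (g *v y)"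
      by (intro mult_right_mono mratio_mv_ge g xy l1norm_nonneg)
    also have "\<dots> \<le> l1norm (g *v x)" by (rule mono[OF P])
    finally have "ln (mratio x y * l1norm (g *v y)) \<le> ln (l1norm (g *v x))"
      using mratio_pos[OF xy] l1norm_pos[OF P(1)] l1norm_pos[OF P(2)] by (subst ln_le_cancel_iff) auto
    then show ?thesis using mratio_pos[OF xy] l1norm_pos[OF P(2)] by (simp add: ln_mult)
  qed
  have 2: "ln (mratio y x) + ln (l1norm x) \<le> ln (l1norm y)"
  proof -
    have "ln (mratio y x * l1norm x) \<le> ln (l1norm y)"
      using mono[OF xy(2,1)] mratio_pos[OF xy(2,1)] l1norm_pos[OF xy(1)] l1norm_pos[OF xy(2)]
      by (subst ln_le_cancel_iff) auto
    then show ?thesis using mratio_pos[OF xy(2,1)] l1norm_pos[OF xy(1)] by (simp add: ln_mult)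
  qed
  have "ln (1 - pgap x y) = ln (mratio x y) + ln (mratio y x)"
    using mratio_pos[OF xy] mratio_pos[OF xy(2,1)] by (simp add: pgap_def ln_mult)
  then show ?thesis using 1 2 by (simp add: sig_def)
qed

text \<open>For a gap of at most \<open>1 / 2\<close> the logarithm in \<open>sig_diff_ge\<close> is
  bounded linearly. For a larger gap the trivial bound \<open>2 * ln (Nmat g)\<close> is at most
  \<open>4 * ln (Nmat g)\<close> times the gap. The Lipschitz constant thus inherits the third
  moment.\<close>

lemma sig_lip:
  assumes g: "g \<in> Gmat" and xy: "x \<in> Pos" "y \<in> Pos"
  shows "\<bar>sig g x - sig g y\<bar> \<le> (2 + 4 * ln (Nmat g)) * pgap x y"
proof (cases "pgap x y \<le> 1/2")
  case True
  define d where "d = pgap x y"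
  have d: "0 \<le> d" "d \<le> 1/2" using True pgap_nonneg[OF xy] by (auto simp: d_def)
  have "- ln (1 - d) \<le> 2 * d"
  proof -
    have "- ln (1 - d) = ln (1 / (1 - d))" using d by (simp add: ln_div)
    also have "\<dots> \<le> 1 / (1 - d) - 1" using d by (intro ln_le_minus_one) auto
    also have "\<dots> = d / (1 - d)" using d by (simp add: field_simps)
    also have "\<dots> \<le> d / (1/2)" using d by (intro divide_left_mono) auto
    finally show ?thesis by simp
  qed
  moreover have "ln (1 - d) \<le> sig g x - sig g y" "ln (1 - d) \<le> sig g y - sig g x"
    using sig_diff_ge[OF g xy] sig_diff_ge[OF g xy(2,1)] pgap_commute[of y x] by (auto simp: d_def)
  ultimately have "\<bar>sig g x - sig g y\<bar> \<le> 2 * d" by simp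
  also have "\<dots> \<le> (2 + 4 * ln (Nmat g)) * d" using d Nmat_ge_1[OF g] by (intro mult_right_mono) auto
  finally show ?thesis by (simp add: d_def)
next
  case False
  have N: "0 \<le> ln (Nmat g)" using Nmat_ge_1[OF g] by simp
  have "\<bar>sig g x - sig g y\<bar> \<le> 2 * ln (Nmat g)"
    using abs_sig_le[OF g xy(1)] abs_sig_le[OF g xy(2)] by simp
  also have "\<dots> = (4 * ln (Nmat g)) * (1/2)" by simp
  also have "\<dots> \<le> (2 + 4 * ln (Nmat g)) * pgap x y" using N False by (intro mult_mono) auto
  finally show ?thesis .
qed

lemma pgap_le_dist:
  assumes x: "x \<in> Pos" and y: "y \<in> Pos" and e: "0 < e" "e < 1" and d: "\<And>i. \<bar>y $ i - x $ i\<bar> \<le> e * x $ i"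
  shows "pgap x y \<le> 2 * e"
proof -
  have "1 / (1 + e) \<le> mratio x y"
  proof (rule le_mratio_Pos[OF y])
    fix i
    have "y $ i \<le> (1 + e) * x $ i" using d[of i] by (simp add: algebra_simps)
    then show "1 / (1 + e) * y $ i \<le> x $ i" using e by (simp add: field_simps)
  qed
  moreover have "1 - e \<le> mratio y x"
    by (rule le_mratio_Pos[OF x]) (use d in \<open>simp add: left_diff_distrib abs_le_iff algebra_simps\<close>)
  ultimately have "1 / (1 + e) * (1 - e) \<le> mratio x y * mratio y x"
    using e mratio_pos[OF x y] by (intro mult_mono) auto
  moreover have "1 - 2 * e \<le> 1 / (1 + e) * (1 - e)"
  proof -
    have "(1 - 2 * e) * (1 + e) \<le> 1 - e" using e by (simp add: algebra_simps)
    then show ?thesis using e by (simp add: pos_le_divide_eq)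
  qed
  ultimately show ?thesis by (simp add: pgap_def)
qed

text \<open>A Euclidean perturbation that is small against the smallest coordinate changes the gap
  little. This continuity supplies the measurability demanded by \<open>lip_meas_real\<close> for
  the matrix action.\<close>

lemma continuous_on_Pos_of_lip:
  fixes f :: "real ^ 'n::finite \<Rightarrow> real"
  assumes f: "\<And>x y. x \<in> Pos \<Longrightarrow> y \<in> Pos \<Longrightarrow> \<bar>f x - f y\<bar> \<le> c * pgap x y"
  shows "continuous_on Pos f"
  unfolding continuous_on_iff
proof (intro ballI allI impI)
  fix x :: "real ^ 'n" and \<epsilon> :: real assume x: "x \<in> Pos" and \<epsilon>: "0 < \<epsilon>"
  define C where "C = \<bar>c\<bar> + 1"
  define e where "e = min (1/2) (\<epsilon> / (4 * C))"
  have C: "0 < C" "c \<le> C" by (auto simp: C_def)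
  have e: "0 < e" "e < 1" "e \<le> \<epsilon> / (4 * C)" using \<epsilon> C by (auto simp: e_def)
  define b where "b = Min (range (\<lambda>i. x $ i))"
  have b: "0 < b" "\<And>i. b \<le> x $ i" using PosD[OF x] by (auto simp: b_def)
  have "dist (f y) (f x) < \<epsilon>" if y: "y \<in> Pos" "dist y x < e * b" for y
  proof -
    have "\<bar>y $ i - x $ i\<bar> \<le> e * x $ i" for i
    proof -
      have "\<bar>y $ i - x $ i\<bar> \<le> dist y x"
        using component_le_norm_cart[of "y - x" i] by (simp add: dist_norm)
      also have "\<dots> \<le> e * b" using y by simp
      also have "\<dots> \<le> e * x $ i" using b e by (intro mult_left_mono) auto
      finally show ?thesis .
    qed
    then have "pgap x y \<le> 2 * e" by (rule pgap_le_dist[OF x y(1) e(1,2)])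
    then have "\<bar>f x - f y\<bar> \<le> C * (2 * e)"
      using f[OF x y(1)] C pgap_nonneg[OF x y(1)] mult_mono[of c C "pgap x y" "2 * e"] by auto
    also have "\<dots> \<le> C * (2 * (\<epsilon> / (4 * C)))" using C e by (intro mult_left_mono) auto
    also have "\<dots> < \<epsilon>" using C \<epsilon> by simp
    finally show ?thesis by (simp add: dist_real_def abs_minus_commute)
  qed
  then show "\<exists>d>0. \<forall>y\<in>Pos. dist y x < d \<longrightarrow> dist (f y) (f x) < \<epsilon>"
    using e b by (intro exI[of _ "e * b"]) auto
qed

section \<open>Measurability\<close>

lemma borel_measurable_vecI:
  fixes f :: "'a \<Rightarrow> 'b::euclidean_space ^ 'n::finite"
  assumes "\<And>i. (\<lambda>x. f x $ i) \<in> borel_measurable M"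
  shows "f \<in> borel_measurable M"
proof (subst borel_measurable_euclidean_space, rule ballI)
  fix u :: "'b ^ 'n" assume "u \<in> Basis"
  then obtain i b where "u = axis i b" by (auto simp: Basis_vec_def)
  then show "(\<lambda>x. f x \<bullet> u) \<in> borel_measurable M"
    using borel_measurable_inner[OF assms[of i] borel_measurable_const[of b]] by (simp add: inner_axis)
qed

lemma space_borel_G [simp]: "space borel_G = Gmat"
  by (simp add: borel_G_def space_restrict_space)

lemma id_borel_G: "(\<lambda>g. g) \<in> borel_measurable borel_G"
  unfolding borel_G_def by (rule measurable_restrict_space1) simp

lemma entry_measurable [measurable]: "(\<lambda>g. g $ i $ j) \<in> borel_measurable borel_G"
proof -
  have "(\<lambda>g. (g :: real^'a^'a) $ i $ j) \<in> borel_measurable borel"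
    by (intro borel_measurable_continuous_onI continuous_intros)
  then show ?thesis by (rule measurable_compose[OF id_borel_G])
qed

lemma measurable_borel_GI:
  assumes "\<And>x. x \<in> space M \<Longrightarrow> f x \<in> Gmat" "\<And>i j. (\<lambda>x. f x $ i $ j) \<in> borel_measurable M"
  shows "f \<in> measurable M borel_G"
  unfolding borel_G_def using assms
  by (intro measurable_restrict_space2 borel_measurable_vecI) auto

lemma mult_measurable [measurable]:
  assumes f: "f \<in> measurable M borel_G" and h: "h \<in> measurable M borel_G"
  shows "(\<lambda>x. f x ** h x) \<in> measurable M borel_G"
proof (rule measurable_borel_GI)
  show "f x ** h x \<in> Gmat" if "x \<in> space M" for x
    using measurable_space[OF f that] measurable_space[OF h that] by (simp add: Gmat_mult)
  show "(\<lambda>x. (f x ** h x) $ i $ j) \<in> borel_measurable M" for i j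
    unfolding mult_nth
    using measurable_compose[OF f entry_measurable] measurable_compose[OF h entry_measurable]
    by (intro borel_measurable_sum borel_measurable_times)
qed

lemma mv_measurable:
  assumes f: "f \<in> measurable M borel_G" and h: "\<And>j. (\<lambda>x. h x $ j) \<in> borel_measurable M"
  shows "(\<lambda>x. (f x *v h x) $ i) \<in> borel_measurable M"
  unfolding mv_nth using measurable_compose[OF f entry_measurable] h
  by (intro borel_measurable_sum borel_measurable_times)

lemma colsum_measurable [measurable]: "(\<lambda>g. colsum g j) \<in> borel_measurable borel_G"
  unfolding colsum_def by measurable

lemma onorm_measurable [measurable]: "l1_onorm \<in> borel_measurable borel_G"
proof -
  have "(\<lambda>g. Max ((\<lambda>j. colsum g j) ` UNIV)) \<in> borel_measurable (borel_G :: (real^'a^'a) measure)"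
    by (intro borel_measurable_Max) auto
  then show ?thesis by (subst measurable_cong[OF l1_onorm_eq]) auto
qed

lemma vmin_measurable [measurable]: "vmin \<in> borel_measurable borel_G"
proof -
  have "(\<lambda>g. Min ((\<lambda>j. colsum g j) ` UNIV)) \<in> borel_measurable (borel_G :: (real^'a^'a) measure)"
    by (intro borel_measurable_Min) auto
  then show ?thesis by (subst measurable_cong[OF vmin_eq]) auto
qed

lemma Lmat_measurable [measurable]: "Lmat \<in> borel_measurable borel_G"
  unfolding Lmat_def[abs_def] by measurable

lemma Nmat_measurable [measurable]: "Nmat \<in> borel_measurable borel_G"
  unfolding Nmat_def[abs_def] by measurable

lemma good_sets: "good K \<inter> Gmat \<in> sets borel_G"
proof -
  have "{g \<in> space borel_G. \<forall>i j k l. g $ i $ j \<le> K * g $ k $ l} \<in> sets (borel_G :: (real^'a^'a) measure)"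
    by measurable
  also have "{g \<in> space borel_G. \<forall>i j k l. g $ i $ j \<le> K * g $ k $ l} = good K \<inter> Gmat"
    by (auto simp: good_def)
  finally show ?thesis .
qed

lemma l1norm_measurable:
  assumes "\<And>j. (\<lambda>x. h x $ j) \<in> borel_measurable M"
  shows "(\<lambda>x. l1norm (h x)) \<in> borel_measurable M"
  unfolding l1norm_def using assms by measurable

lemma sig_measurable: "(\<lambda>g. sig g x) \<in> borel_measurable borel_G"
  unfolding sig_def by (intro borel_measurable_diff borel_measurable_ln l1norm_measurable mv_measurable) auto

lemma continuous_Pos_measurable:
  fixes f :: "real ^ 'n::finite \<Rightarrow> real"
  assumes "continuous_on Pos f" "x \<in> Pos"
  shows "(\<lambda>g. f (g *v x)) \<in> borel_measurable borel_G"
proof -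
  have "(\<lambda>g. g *v x) \<in> measurable borel_G (restrict_space borel Pos)"
    using mv_Pos assms(2) by (intro measurable_restrict_space2 borel_measurable_vecI mv_measurable) auto
  then show ?thesis
    using borel_measurable_continuous_on_restrict[OF assms(1)] by (rule measurable_compose)
qed

lemma mratio_eq_Min: "y \<in> Pos \<Longrightarrow> mratio x y = Min ((\<lambda>i. x $ i / y $ i) ` UNIV)"
  unfolding mratio_def by (simp add: cInf_eq_Min PosD)

lemma pgap_measurable:
  assumes "\<And>j. (\<lambda>z. u z $ j) \<in> borel_measurable M" "\<And>j. (\<lambda>z. v z $ j) \<in> borel_measurable M"
    and P: "\<And>z. z \<in> space M \<Longrightarrow> u z \<in> Pos" "\<And>z. z \<in> space M \<Longrightarrow> v z \<in> Pos"
  shows "(\<lambda>z. pgap (u z) (v z)) \<in> borel_measurable M"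
proof -
  have "(\<lambda>z. 1 - Min ((\<lambda>i. u z $ i / v z $ i) ` UNIV) * Min ((\<lambda>i. v z $ i / u z $ i) ` UNIV)) \<in> borel_measurable M"
    using assms(1,2)
    by (intro borel_measurable_diff borel_measurable_times borel_measurable_Min borel_measurable_divide) auto
  also have "?this \<longleftrightarrow> ?thesis"
    by (rule measurable_cong) (simp add: pgap_def mratio_eq_Min P)
  finally show ?thesis .
qed

lemma space_borel_Splus: "space borel_Splus = Splus"
proof -
  interpret S: Metric_space "Splus :: (real ^ 'a) set" dproj by (rule Metric_space_dproj)
  show ?thesis
    unfolding borel_Splus_def by (rule space_measure_of) (auto dest: S.openin_mtopology[THEN iffD1])
qed

lemma borel_Splus_measurable:
  "(\<lambda>x. x $ i) \<in> borel_measurable (borel_Splus :: (real ^ 'n::finite) measure)"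
proof -
  interpret S: Metric_space "Splus :: (real ^ 'n) set" dproj by (rule Metric_space_dproj)
  have op: "openin S.mtopology {x \<in> Splus. x $ i < c}" for c
    unfolding S.openin_mtopology
  proof (intro conjI ballI allI impI)
    fix x assume "x \<in> {x \<in> Splus. x $ i < c}"
    then have x: "x \<in> Splus" "x $ i < c" by auto
    have x0: "0 \<le> x $ i" by (rule Splus_nonneg[OF x(1)])
    \<comment> \<open>This is \<open>phi (x $ i / c)\<close>: if \<open>y $ i \<ge> c\<close>, then
      \<open>mratio x y \<le> x $ i / c\<close>, and \<open>y\<close> lies at distance at least
      \<open>r\<close> from \<open>x\<close>.\<close>
    define r where "r = (c - x $ i) / (c + x $ i)"
    have r: "0 < r" "r \<le> 1" using x x0 by (auto simp: r_def)
    have "y $ i < c" if y: "y \<in> Splus" "dproj x y < r" for y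
    proof (rule ccontr)
      assume "\<not> y $ i < c"
      then have yc: "c \<le> y $ i" by simp
      let ?s = "mratio x y * mratio y x"
      have s: "0 \<le> ?s" "?s \<le> mratio x y"
        using mratio_nonneg[OF x(1) y(1)] mratio_nonneg[OF y(1) x(1)] mratio_le_1[OF y(1) x(1)]
        by (auto intro: mult_left_le)
      have "?s * c \<le> mratio x y * y $ i" using s yc x x0 by (intro mult_mono) auto
      also have "\<dots> \<le> x $ i" by (rule mratio_mult_le[OF x(1) y(1)])
      finally have sc: "?s * c \<le> x $ i" .
      have "r * (1 + ?s) \<le> 1 - ?s"
      proof -
        have "(c - x $ i) * (1 + ?s) \<le> (1 - ?s) * (c + x $ i)" using sc by (simp add: algebra_simps)
        then show ?thesis using x x0 by (simp add: r_def divide_le_eq)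
      qed
      then have "r \<le> phi ?s" using s by (simp add: phi_def pos_le_divide_eq)
      then show False using y x by (simp add: dproj_def)
    qed
    then show "\<exists>r>0. S.mball x r \<subseteq> {x \<in> Splus. x $ i < c}"
      using r by (intro exI[of _ r]) (auto simp: S.in_mball)
  qed auto
  show ?thesis
  proof (subst borel_measurable_iff_less, intro allI)
    fix c
    have "{w \<in> space borel_Splus. w $ i < c} = {x \<in> Splus. x $ i < c}" by (simp add: space_borel_Splus)
    moreover have "{x \<in> Splus. x $ i < c} \<in> sets borel_Splus"
      unfolding borel_Splus_def
      by (subst sets_measure_of) (use op[of c] in \<open>auto dest: S.openin_mtopology[THEN iffD1]\<close>)
    ultimately show "{w \<in> space borel_Splus. w $ i < c} \<in> sets borel_Splus" by simp
  qed
qed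

section \<open>The spectral radius: bounds and measurability\<close>

definition cspec :: "real ^ 'n::finite ^ 'n \<Rightarrow> complex set" where
  "cspec g = {z. \<exists>w :: complex ^ 'n. w \<noteq> 0 \<and> (\<chi> i j. complex_of_real (g $ i $ j)) *v w = z *s w}"

lemma kappa_eq: "kappa g = (SUP z\<in>cspec g. cmod z)"
  by (simp add: kappa_def cspec_def)

lemma cspec_iff: "z \<in> cspec g \<longleftrightarrow> (\<exists>w :: complex ^ 'n. w \<noteq> 0 \<and> (\<forall>i. (\<Sum>j\<in>UNIV. of_real (g $ i $ j) * w $ j) = z * w $ i))"
  for g :: "real ^ 'n::finite ^ 'n"
  by (simp add: cspec_def vec_eq_iff matrix_vector_mult_def vector_scalar_mult_def)

text \<open>Moduli are taken in every coordinate of the eigenvector equation and summed; exchanging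
  the sums makes the column sums appear.\<close>

lemma cspec_le_onorm:
  fixes g :: "real ^ 'n::finite ^ 'n"
  assumes g: "g \<in> Gmat" and z: "z \<in> cspec g" shows "cmod z \<le> l1_onorm g"
proof -
  obtain w :: "complex ^ 'n" where w: "w \<noteq> 0" "\<And>i. (\<Sum>j\<in>UNIV. of_real (g $ i $ j) * w $ j) = z * w $ i"
    using z unfolding cspec_iff by blast
  obtain k where "w $ k \<noteq> 0" using w(1) by (auto simp: vec_eq_iff)
  then have pos: "0 < (\<Sum>i\<in>UNIV. cmod (w $ i))" by (intro sum_pos2[of UNIV k]) auto
  have "cmod z * (\<Sum>i\<in>UNIV. cmod (w $ i)) = (\<Sum>i\<in>UNIV. cmod (\<Sum>j\<in>UNIV. of_real (g $ i $ j) * w $ j))"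
    by (simp add: w(2) norm_mult sum_distrib_left)
  also have "\<dots> \<le> (\<Sum>i\<in>UNIV. \<Sum>j\<in>UNIV. g $ i $ j * cmod (w $ j))"
    by (intro sum_mono order_trans[OF norm_sum]) (simp add: norm_mult GmatD(1)[OF g])
  also have "\<dots> = (\<Sum>j\<in>UNIV. \<Sum>i\<in>UNIV. g $ i $ j * cmod (w $ j))" by (rule sum.swap)
  also have "\<dots> = (\<Sum>j\<in>UNIV. colsum g j * cmod (w $ j))" by (simp add: colsum_def sum_distrib_right)
  also have "\<dots> \<le> (\<Sum>j\<in>UNIV. l1_onorm g * cmod (w $ j))"
    by (intro sum_mono mult_right_mono colsum_le_onorm[OF g]) auto
  finally have "cmod z * (\<Sum>i\<in>UNIV. cmod (w $ i)) \<le> l1_onorm g * (\<Sum>i\<in>UNIV. cmod (w $ i))"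
    by (simp add: sum_distrib_left)
  then show ?thesis using pos by simp
qed

text \<open>Brouwer's theorem for the projective action on the simplex gives a nonnegative
  eigenvector \<open>x\<close>. Its eigenvalue is \<open>l1norm (g *v x)\<close>, which is at least
  \<open>vmin g\<close>.\<close>

lemma cspec_ge_vmin:
  fixes g :: "real ^ 'n::finite ^ 'n"
  assumes g: "g \<in> Gmat" shows "\<exists>z\<in>cspec g. vmin g \<le> cmod z"
proof -
  have S: "Splus = {x :: real^'n. (\<forall>i. 0 \<le> x $ i) \<and> (\<Sum>i\<in>UNIV. x $ i) = 1}"
    by (auto simp: Splus_def l1norm_def)
  have cl: "closed (Splus :: (real^'n) set)"
    unfolding S by (intro closed_Collect_conj closed_Collect_all closed_Collect_le closed_Collect_eq continuous_intros)
  have "norm x \<le> 1" if "x \<in> Splus" for x :: "real^'n"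
  proof -
    have "l1norm x = 1" using that by (simp add: Splus_def)
    then show ?thesis using norm_le_l1_cart[of x] by (simp only: l1norm_def)
  qed
  then have bd: "bounded (Splus :: (real^'n) set)" by (auto simp: bounded_iff)
  have cv: "convex (Splus :: (real^'n) set)"
    unfolding S convex_def by (auto simp: sum.distrib simp flip: sum_distrib_left)
  have gpos: "0 < l1norm (g *v x)" if "x \<in> Splus" for x
    using l1norm_mv_ge_vmin[OF g Splus_nonneg[OF that]] vmin_pos[OF g] that by (simp add: Splus_def)
  have "(\<Sum>i\<in>UNIV. \<bar>(g *v x) $ i\<bar>) \<noteq> 0" if "x \<in> Splus" for x
    using gpos[OF that] by (simp add: l1norm_def)
  then have "continuous_on Splus (act g)"
    unfolding act_def l1norm_def by (intro continuous_intros) auto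
  moreover have "act g \<in> Splus \<rightarrow> Splus"
  proof
    fix x :: "real ^ 'n" assume x: "x \<in> Splus"
    have "l1norm (act g x) = (1 / l1norm (g *v x)) * l1norm (g *v x)"
      using l1norm_nonneg[of "g *v x"] by (simp add: act_def l1norm_def[of "_ *\<^sub>R _"] abs_mult l1norm_def[symmetric] flip: sum_divide_distrib)
    then show "act g x \<in> Splus"
      using gpos[OF x] mv_nonneg[OF g Splus_nonneg[OF x]] by (auto simp: Splus_def act_def)
  qed
  ultimately obtain x where x: "x \<in> Splus" "act g x = x"
    using brouwer[OF _ cv, of "act g"] cl bd axis_Splus by (metis compact_eq_bounded_closed empty_iff)
  have eig: "g *v x = l1norm (g *v x) *\<^sub>R x"
    using gpos[OF x(1)] arg_cong[OF x(2), of "\<lambda>y. l1norm (g *v x) *\<^sub>R y"] by (simp add: act_def)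
  let ?w = "\<chi> i. complex_of_real (x $ i)"
  have "(\<Sum>j\<in>UNIV. of_real (g $ i $ j) * ?w $ j) = complex_of_real (l1norm (g *v x)) * ?w $ i" for i
  proof -
    have "(\<Sum>j\<in>UNIV. g $ i $ j * x $ j) = l1norm (g *v x) * x $ i"
      using arg_cong[OF eig, of "\<lambda>y. y $ i"] by (simp add: mv_nth)
    then show ?thesis by (simp flip: of_real_mult of_real_sum)
  qed
  moreover have "?w \<noteq> 0"
    using Splus_ex_pos[OF x(1)] by (auto simp: vec_eq_iff dest: less_imp_neq[symmetric])
  ultimately have "complex_of_real (l1norm (g *v x)) \<in> cspec g" unfolding cspec_iff by blast
  moreover have "vmin g \<le> cmod (complex_of_real (l1norm (g *v x)))"
    using l1norm_mv_ge_vmin[OF g Splus_nonneg[OF x(1)]] x(1) gpos[OF x(1)] by (simp add: Splus_def)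
  ultimately show ?thesis by blast
qed

lemma cspec_bdd: "g \<in> Gmat \<Longrightarrow> bdd_above (cmod ` cspec g)"
  using cspec_le_onorm[of g] by (auto intro!: bdd_aboveI[of _ "l1_onorm g"])

lemma kappa_bounds:
  assumes "g \<in> Gmat" shows "vmin g \<le> kappa g" "kappa g \<le> l1_onorm g"
proof -
  obtain z where z: "z \<in> cspec g" "vmin g \<le> cmod z" using cspec_ge_vmin[OF assms] by blast
  have "cmod z \<le> kappa g" unfolding kappa_eq by (rule cSUP_upper[OF z(1) cspec_bdd[OF assms]])
  then show "vmin g \<le> kappa g" using z by simp
  show "kappa g \<le> l1_onorm g" unfolding kappa_eq
    by (rule cSUP_least) (use z cspec_le_onorm[OF assms] in auto)
qed

text \<open>The set \<open>{c < kappa}\<close> is a countable union of projections of compact sets of triples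
  (matrix, eigenvalue, unit eigenvector).\<close>

lemma kappa_measurable [measurable]:
  "kappa \<in> borel_measurable (borel_G :: (real ^ 'n::finite ^ 'n) measure)"
proof (subst borel_measurable_iff_greater, intro allI)
  fix c :: real
  define E :: "real \<Rightarrow> real \<Rightarrow> ((real ^ 'n ^ 'n) \<times> complex \<times> (complex ^ 'n)) set" where
    "E R e = {p. norm (fst p) \<le> R \<and> e \<le> cmod (fst (snd p)) \<and> cmod (fst (snd p)) \<le> R \<and> norm (snd (snd p)) = 1 \<and>
      (\<forall>i. (\<Sum>j\<in>UNIV. of_real (fst p $ i $ j) * snd (snd p) $ j) = fst (snd p) * snd (snd p) $ i)}" for R e
  have "compact (E R e)" for R e
  proof -
    have "closed (E R e)" unfolding E_def
      by (intro closed_Collect_conj closed_Collect_all closed_Collect_le closed_Collect_eq continuous_intros)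
    moreover have "E R e \<subseteq> cball 0 R \<times> cball 0 R \<times> cball 0 1"
      by (auto simp: E_def)
    then have "bounded (E R e)"
      by (rule bounded_subset[rotated]) (intro bounded_Times bounded_cball)
    ultimately show ?thesis by (simp add: compact_eq_bounded_closed)
  qed
  then have "closed (fst ` E R e)" for R e
    by (intro compact_imp_closed compact_continuous_image continuous_intros)
  \<comment> \<open>The increments \<open>1 / Suc k\<close> replace the strict inequality by closed
    conditions, and \<open>N\<close> exhausts all matrices and eigenvalues.\<close>
  then have "(\<Union>k::nat. \<Union>N::nat. fst ` E (real N) (c + 1 / Suc k)) \<in> sets borel"
    by (intro sets.countable_UN) (auto intro: borel_closed)
  then have "Gmat \<inter> (\<Union>k::nat. \<Union>N::nat. fst ` E (real N) (c + 1 / Suc k)) \<in> sets borel_G"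
    unfolding borel_G_def sets_restrict_space by (rule imageI)
  moreover have "{g \<in> space borel_G. c < kappa g} = Gmat \<inter> (\<Union>k::nat. \<Union>N::nat. fst ` E (real N) (c + 1 / Suc k))"
  proof (intro set_eqI iffI)
    fix g :: "real ^ 'n ^ 'n" assume "g \<in> {g \<in> space borel_G. c < kappa g}"
    then have g: "g \<in> Gmat" "c < kappa g" by auto
    have "cspec g \<noteq> {}" using cspec_ge_vmin[OF g(1)] by auto
    then obtain z where z: "z \<in> cspec g" "c < cmod z"
      using g(2) less_cSUP_iff[OF _ cspec_bdd[OF g(1)]] unfolding kappa_eq by blast
    obtain w :: "complex ^ 'n" where w: "w \<noteq> 0" "\<And>i. (\<Sum>j\<in>UNIV. of_real (g $ i $ j) * w $ j) = z * w $ i"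
      using z unfolding cspec_iff by blast
    obtain k where k: "inverse (real (Suc k)) < cmod z - c" using reals_Archimedean[of "cmod z - c"] z by auto
    obtain N :: nat where N: "max (norm g) (cmod z) \<le> real N" using real_arch_simple by blast
    let ?w = "(1 / norm w) *\<^sub>R w"
    have "(\<Sum>j\<in>UNIV. of_real (g $ i $ j) * ?w $ j) = z * ?w $ i" for i
    proof -
      define r where "r = complex_of_real (1 / norm w)"
      have "?w $ j = r * w $ j" for j unfolding r_def vector_scaleR_component by (rule scaleR_conv_of_real)
      then have "(\<Sum>j\<in>UNIV. of_real (g $ i $ j) * ?w $ j) = r * (\<Sum>j\<in>UNIV. of_real (g $ i $ j) * w $ j)"
        by (simp add: sum_distrib_left mult.left_commute)
      also have "\<dots> = z * ?w $ i" using w(2)[of i] \<open>?w $ i = r * w $ i\<close> by (simp add: mult.left_commute)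
      finally show ?thesis .
    qed
    moreover have "norm ?w = 1" using w(1) by simp
    ultimately have "(g, z, ?w) \<in> E (real N) (c + 1 / Suc k)"
      using N k by (simp add: E_def inverse_eq_divide)
    then have "g \<in> fst ` E (real N) (c + 1 / Suc k)" by force
    then show "g \<in> Gmat \<inter> (\<Union>k::nat. \<Union>N::nat. fst ` E (real N) (c + 1 / Suc k))" using g by blast
  next
    fix g assume "g \<in> Gmat \<inter> (\<Union>k::nat. \<Union>N::nat. fst ` E (real N) (c + 1 / Suc k))"
    then obtain k N z w where g: "g \<in> Gmat" and e: "(g, z, w) \<in> E (real N) (c + 1 / Suc k)" by auto
    have "w \<noteq> 0" using e by (auto simp: E_def)
    then have zs: "z \<in> cspec g" using e unfolding cspec_iff E_def by auto
    have "c < c + 1 / Suc k" by simp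
    also have "\<dots> \<le> cmod z" using e by (simp add: E_def)
    also have "\<dots> \<le> kappa g" unfolding kappa_eq by (rule cSUP_upper[OF zs cspec_bdd[OF g]])
    finally show "g \<in> {g \<in> space borel_G. c < kappa g}" using g by simp
  qed
  ultimately show "{g \<in> space (borel_G :: (real ^ 'n ^ 'n) measure). c < kappa g} \<in> sets borel_G"
    by (simp only:)
qed

section \<open>Products of independent matrices\<close>

locale matrix_law =
  fixes \<mu> :: "(real ^ 'n::finite ^ 'n) measure"
  assumes prob_mu: "prob_space \<mu>" and sets_mu: "sets \<mu> = sets borel_G"
begin

abbreviation "cp \<equiv> conv_pow \<mu>"

lemma space_mu: "space \<mu> = Gmat"
  using sets_eq_imp_space_eq[OF sets_mu] by simp

lemma measurable_mu: "measurable \<mu> N = measurable borel_G N"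
  by (rule measurable_cong_sets[OF sets_mu refl])

lemma sets_cp: "sets (cp n) = sets borel_G"
  by (cases n) simp_all

lemma space_cp: "space (cp n) = Gmat"
  using sets_eq_imp_space_eq[OF sets_cp] by simp

lemma measurable_cp: "measurable (cp n) N = measurable borel_G N"
  by (rule measurable_cong_sets[OF sets_cp refl])

lemma sets_pair: "sets (\<mu> \<Otimes>\<^sub>M cp n) = sets (borel_G \<Otimes>\<^sub>M borel_G)" "sets (cp m \<Otimes>\<^sub>M cp n) = sets (borel_G \<Otimes>\<^sub>M borel_G)"
  by (intro sets_pair_measure_cong sets_mu sets_cp)+

lemma measurable_pair: "measurable (\<mu> \<Otimes>\<^sub>M cp n) N = measurable (borel_G \<Otimes>\<^sub>M borel_G) N"
  "measurable (cp m \<Otimes>\<^sub>M cp n) N = measurable (borel_G \<Otimes>\<^sub>M borel_G) N"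
  by (intro measurable_cong_sets sets_pair refl)+

lemma prod_meas: "(\<lambda>(g, h). g ** h) \<in> measurable (borel_G \<Otimes>\<^sub>M borel_G) (borel_G :: (real^'n^'n) measure)"
  unfolding case_prod_beta' by (intro mult_measurable measurable_fst measurable_snd)

lemma prob_cp: "prob_space (cp n)"
proof (induction n)
  case 0
  show ?case by (simp add: prob_space_return Gmat_one)
next
  case (Suc n)
  interpret \<mu>: prob_space \<mu> by (rule prob_mu)
  interpret c: prob_space "cp n" by (rule Suc)
  interpret p: pair_prob_space \<mu> "cp n" ..
  show ?case by (simp only: conv_pow.simps) (rule p.prob_space_distr, simp only: measurable_pair prod_meas)
qed

sublocale mu: prob_space \<mu> by (rule prob_mu)

sublocale cp: prob_space "cp n" for n by (rule prob_cp)

sublocale mc: pair_prob_space \<mu> "cp n" for n ..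

lemma nn_integral_cp_Suc:
  assumes f: "f \<in> borel_measurable borel_G"
  shows "(\<integral>\<^sup>+k. f k \<partial>cp (Suc n)) = (\<integral>\<^sup>+g. \<integral>\<^sup>+h. f (g ** h) \<partial>cp n \<partial>\<mu>)"
proof -
  have m: "(\<lambda>p. f (fst p ** snd p)) \<in> borel_measurable (\<mu> \<Otimes>\<^sub>M cp n)"
    unfolding measurable_pair by (intro measurable_compose[OF _ f] mult_measurable measurable_fst measurable_snd)
  have "(\<integral>\<^sup>+k. f k \<partial>cp (Suc n)) = (\<integral>\<^sup>+p. f (case p of (g, h) \<Rightarrow> g ** h) \<partial>(\<mu> \<Otimes>\<^sub>M cp n))"
    unfolding conv_pow.simps by (rule nn_integral_distr) (simp_all only: measurable_pair prod_meas f measurable_distr_eq1)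
  also have "\<dots> = (\<integral>\<^sup>+g. \<integral>\<^sup>+h. f (g ** h) \<partial>cp n \<partial>\<mu>)"
    using cp.nn_integral_fst[OF m] by (simp add: case_prod_beta')
  finally show ?thesis .
qed

lemma inner_meas:
  assumes f: "f \<in> borel_measurable borel_G"
  shows "(\<lambda>g. \<integral>\<^sup>+h. f (g ** h) \<partial>cp n) \<in> borel_measurable borel_G"
    and "(\<lambda>g. \<integral>\<^sup>+h. f (h ** g) \<partial>cp n) \<in> borel_measurable borel_G"
proof -
  have s: "measurable (borel_G \<Otimes>\<^sub>M cp n) N = measurable (borel_G \<Otimes>\<^sub>M borel_G) N" for N :: "'c measure"
    by (intro measurable_cong_sets sets_pair_measure_cong sets_cp refl)
  show "(\<lambda>g. \<integral>\<^sup>+h. f (g ** h) \<partial>cp n) \<in> borel_measurable borel_G"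
    by (rule cp.borel_measurable_nn_integral) (simp only: case_prod_beta' s,
        intro measurable_compose[OF _ f] mult_measurable measurable_fst measurable_snd)
  show "(\<lambda>g. \<integral>\<^sup>+h. f (h ** g) \<partial>cp n) \<in> borel_measurable borel_G"
    by (rule cp.borel_measurable_nn_integral) (simp only: case_prod_beta' s,
        intro measurable_compose[OF _ f] mult_measurable measurable_fst measurable_snd)
qed

lemma nn_integral_cp_add:
  assumes f: "f \<in> borel_measurable borel_G"
  shows "(\<integral>\<^sup>+k. f k \<partial>cp (n + m)) = (\<integral>\<^sup>+g. \<integral>\<^sup>+h. f (g ** h) \<partial>cp m \<partial>cp n)"
  using f
proof (induction n arbitrary: f)
  case 0
  show ?case
    using inner_meas(1)[OF 0, of m] by (simp add: nn_integral_return Gmat_one)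
next
  case (Suc n)
  have "(\<integral>\<^sup>+k. f k \<partial>cp (Suc n + m)) = (\<integral>\<^sup>+g. \<integral>\<^sup>+k. f (g ** k) \<partial>cp (n + m) \<partial>\<mu>)"
    using nn_integral_cp_Suc[OF Suc.prems, of "n + m"] by simp
  also have "\<dots> = (\<integral>\<^sup>+g. \<integral>\<^sup>+k. \<integral>\<^sup>+h. f (g ** (k ** h)) \<partial>cp m \<partial>cp n \<partial>\<mu>)"
  proof (rule nn_integral_cong)
    fix g assume "g \<in> space \<mu>"
    then have "(\<lambda>k. f (g ** k)) \<in> borel_measurable borel_G"
      by (intro measurable_compose[OF _ Suc.prems] mult_measurable measurable_const measurable_ident_sets) (auto simp: space_mu)
    then show "(\<integral>\<^sup>+k. f (g ** k) \<partial>cp (n + m)) = (\<integral>\<^sup>+k. \<integral>\<^sup>+h. f (g ** (k ** h)) \<partial>cp m \<partial>cp n)"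
      by (rule Suc.IH)
  qed
  also have "\<dots> = (\<integral>\<^sup>+k. \<integral>\<^sup>+h. f (k ** h) \<partial>cp m \<partial>cp (Suc n))"
    by (subst nn_integral_cp_Suc[OF inner_meas(1)[OF Suc.prems]]) (simp add: matrix_mul_assoc)
  finally show ?case .
qed

lemma nn_integral_cp_1:
  assumes f: "f \<in> borel_measurable borel_G"
  shows "(\<integral>\<^sup>+k. f k \<partial>cp 1) = (\<integral>\<^sup>+g. f g \<partial>\<mu>)"
proof -
  have "(\<integral>\<^sup>+h. f (g ** h) \<partial>cp 0) = f g" if "g \<in> Gmat" for g
  proof -
    have "(\<lambda>h. f (g ** h)) \<in> borel_measurable borel_G"
      using that by (intro measurable_compose[OF _ f] mult_measurable measurable_const measurable_ident_sets) auto
    then show ?thesis by (simp add: nn_integral_return Gmat_one)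
  qed
  then show ?thesis
    using nn_integral_cp_Suc[OF f, of 0] unfolding One_nat_def by (simp add: space_mu cong: nn_integral_cong_simp del: conv_pow.simps)
qed

text \<open>\<open>conv_pow\<close> adds its factor on the left. Here one factor is split off on the
  right, the one that acts on a vector before all others; associativity and Fubini reconcile the
  two.\<close>

lemma nn_integral_cp_Suc':
  assumes f: "f \<in> borel_measurable borel_G"
  shows "(\<integral>\<^sup>+k. f k \<partial>cp (Suc n)) = (\<integral>\<^sup>+g. \<integral>\<^sup>+h. f (h ** g) \<partial>cp n \<partial>\<mu>)"
proof -
  have "(\<integral>\<^sup>+k. f k \<partial>cp (Suc n)) = (\<integral>\<^sup>+h. \<integral>\<^sup>+g. f (h ** g) \<partial>cp 1 \<partial>cp n)"
    using nn_integral_cp_add[OF f, of n 1] by simp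
  also have "\<dots> = (\<integral>\<^sup>+h. \<integral>\<^sup>+g. f (h ** g) \<partial>\<mu> \<partial>cp n)"
  proof (rule nn_integral_cong)
    fix h assume "h \<in> space (cp n)"
    then have "(\<lambda>g. f (h ** g)) \<in> borel_measurable borel_G"
      by (intro measurable_compose[OF _ f] mult_measurable measurable_const measurable_ident_sets) (auto simp: space_cp)
    then show "(\<integral>\<^sup>+g. f (h ** g) \<partial>cp 1) = (\<integral>\<^sup>+g. f (h ** g) \<partial>\<mu>)" by (rule nn_integral_cp_1)
  qed
  also have "\<dots> = (\<integral>\<^sup>+g. \<integral>\<^sup>+h. f (h ** g) \<partial>cp n \<partial>\<mu>)"
    by (rule mc.Fubini') (simp only: case_prod_beta' measurable_pair,
        intro measurable_compose[OF _ f] mult_measurable measurable_fst measurable_snd)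
  finally show ?thesis .
qed

section \<open>Average contraction of the projective gap\<close>

lemma pgap_act_meas:
  assumes "x \<in> Pos" "y \<in> Pos"
  shows "(\<lambda>h. pgap (h *v x) (h *v y)) \<in> borel_measurable borel_G"
  by (rule pgap_measurable) (use assms mv_Pos in \<open>auto intro!: mv_measurable\<close>)

definition mean_pgap :: "nat \<Rightarrow> real ^ 'n \<Rightarrow> real ^ 'n \<Rightarrow> real" where
  "mean_pgap j x y = (\<integral>h. pgap (h *v x) (h *v y) \<partial>cp j)"

lemma pgap_int: "x \<in> Pos \<Longrightarrow> y \<in> Pos \<Longrightarrow> integrable (cp j) (\<lambda>h. pgap (h *v x) (h *v y))"
  by (rule cp.integrable_const_bound[where B=1])
     (auto simp: space_cp measurable_cp pgap_act_meas pgap_nonneg less_imp_le[OF pgap_less_1] mv_Pos intro!: AE_I2)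

lemma mean_pgap_nn: "x \<in> Pos \<Longrightarrow> y \<in> Pos \<Longrightarrow> ennreal (mean_pgap j x y) = (\<integral>\<^sup>+h. pgap (h *v x) (h *v y) \<partial>cp j)"
  unfolding mean_pgap_def by (rule nn_integral_eq_integral[symmetric, OF pgap_int])
    (auto intro!: AE_I2 pgap_nonneg mv_Pos simp: space_cp)

lemma mean_pgap_nonneg: "x \<in> Pos \<Longrightarrow> y \<in> Pos \<Longrightarrow> 0 \<le> mean_pgap j x y"
  unfolding mean_pgap_def by (intro integral_nonneg_AE AE_I2 pgap_nonneg mv_Pos) (auto simp: space_cp)

lemma mean_pgap_le: "x \<in> Pos \<Longrightarrow> y \<in> Pos \<Longrightarrow> mean_pgap j x y \<le> pgap x y"
proof -
  assume xy: "x \<in> Pos" "y \<in> Pos"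
  have "mean_pgap j x y \<le> (\<integral>h. pgap x y \<partial>cp j)"
    unfolding mean_pgap_def by (rule integral_mono[OF pgap_int[OF xy]]) (use xy in \<open>auto simp: space_cp pgap_mv_le\<close>)
  then show ?thesis by (simp add: cp.prob_space)
qed

lemma mean_pgap_0: "x \<in> Pos \<Longrightarrow> y \<in> Pos \<Longrightarrow> mean_pgap 0 x y = pgap x y"
  unfolding mean_pgap_def by (simp add: integral_return Gmat_one pgap_act_meas)

lemma mean_pgap_meas:
  assumes "x \<in> Pos" "y \<in> Pos"
  shows "(\<lambda>g. mean_pgap j (g *v x) (g *v y)) \<in> borel_measurable borel_G"
proof -
  have "(\<lambda>g. enn2real (\<integral>\<^sup>+h. ennreal (pgap ((h ** g) *v x) ((h ** g) *v y)) \<partial>cp j)) \<in> borel_measurable borel_G"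
    using inner_meas(2)[OF measurable_compose[OF pgap_act_meas[OF assms] measurable_ennreal], of j] by measurable
  then show ?thesis
  proof (rule measurable_cong[THEN iffD1, rotated])
    fix g assume "g \<in> space (borel_G :: (real^'n^'n) measure)"
    then have P: "g *v x \<in> Pos" "g *v y \<in> Pos" using mv_Pos assms by auto
    show "enn2real (\<integral>\<^sup>+h. ennreal (pgap ((h ** g) *v x) ((h ** g) *v y)) \<partial>cp j) = mean_pgap j (g *v x) (g *v y)"
      using mean_pgap_nn[OF P, of j] mean_pgap_nonneg[OF P, of j]
      by (simp add: matrix_vector_mul_assoc[symmetric]) (metis enn2real_ennreal)
  qed
qed

lemma mean_pgap_act_int:
  assumes "x \<in> Pos" "y \<in> Pos"
  shows "integrable \<mu> (\<lambda>g. mean_pgap j (g *v x) (g *v y))"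
proof (rule mu.integrable_const_bound[where B=1])
  show "AE g in \<mu>. norm (mean_pgap j (g *v x) (g *v y)) \<le> 1"
  proof (rule AE_I2)
    fix g assume "g \<in> space \<mu>"
    then have P: "g *v x \<in> Pos" "g *v y \<in> Pos" using mv_Pos assms by (auto simp: space_mu)
    show "norm (mean_pgap j (g *v x) (g *v y)) \<le> 1"
      using mean_pgap_nonneg[OF P, of j] mean_pgap_le[OF P, of j] pgap_less_1[OF P] by simp
  qed
qed (use mean_pgap_meas[OF assms] in \<open>simp add: measurable_mu\<close>)

text \<open>The step taken before the other \<open>j\<close> is the rightmost factor of the product,
  hence the appeal to \<open>nn_integral_cp_Suc'\<close>.\<close>

lemma mean_pgap_Suc:
  assumes xy: "x \<in> Pos" "y \<in> Pos"
  shows "(\<integral>g. mean_pgap j (g *v x) (g *v y) \<partial>\<mu>) = mean_pgap (Suc j) x y"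
proof -
  have P: "g *v x \<in> Pos" "g *v y \<in> Pos" if "g \<in> space \<mu>" for g using mv_Pos xy that by (auto simp: space_mu)
  have "ennreal (\<integral>g. mean_pgap j (g *v x) (g *v y) \<partial>\<mu>) = (\<integral>\<^sup>+g. mean_pgap j (g *v x) (g *v y) \<partial>\<mu>)"
    by (rule nn_integral_eq_integral[symmetric, OF mean_pgap_act_int[OF xy]]) (auto intro!: AE_I2 mean_pgap_nonneg P)
  also have "\<dots> = (\<integral>\<^sup>+g. \<integral>\<^sup>+h. ennreal (pgap ((h ** g) *v x) ((h ** g) *v y)) \<partial>cp j \<partial>\<mu>)"
    by (rule nn_integral_cong) (simp add: mean_pgap_nn P matrix_vector_mul_assoc)
  also have "\<dots> = (\<integral>\<^sup>+k. ennreal (pgap (k *v x) (k *v y)) \<partial>cp (Suc j))"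
    by (rule nn_integral_cp_Suc'[symmetric, OF measurable_compose[OF pgap_act_meas[OF xy] measurable_ennreal]])
  also have "\<dots> = ennreal (mean_pgap (Suc j) x y)" by (rule mean_pgap_nn[OF xy, symmetric])
  finally show ?thesis
    using mean_pgap_nonneg[OF xy] by (subst (asm) ennreal_inj) (auto intro!: integral_nonneg_AE AE_I2 mean_pgap_nonneg P)
qed

text \<open>Matrices in \<open>good K\<close> shrink the gap by \<open>1 - 1 / K\<^sup>2\<close>,
  and no matrix of \<open>Gmat\<close> enlarges it.\<close>

lemma mean_pgap_contract:
  assumes K: "1 \<le> K" and xy: "x \<in> Pos" "y \<in> Pos"
  shows "mean_pgap r x y \<le> (1 - measure (cp r) (good K \<inter> Gmat) / K\<^sup>2) * pgap x y"
proof -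
  let ?A = "good K \<inter> Gmat"
  have A: "?A \<in> sets (cp r)" using good_sets by (simp add: sets_cp)
  have "mean_pgap r x y \<le> (\<integral>h. pgap x y - (pgap x y / K\<^sup>2) * indicator ?A h \<partial>cp r)"
    unfolding mean_pgap_def
  proof (rule integral_mono[OF pgap_int[OF xy]])
    show "integrable (cp r) (\<lambda>h. pgap x y - pgap x y / K\<^sup>2 * indicat_real ?A h)"
      using A by (intro Bochner_Integration.integrable_diff cp.integrable_const integrable_mult_right) (auto simp: less_top[symmetric])
    fix h assume "h \<in> space (cp r)"
    then have h: "h \<in> Gmat" by (simp add: space_cp)
    show "pgap (h *v x) (h *v y) \<le> pgap x y - pgap x y / K\<^sup>2 * indicat_real ?A h"
    proof (cases "h \<in> good K")
      case True
      then show ?thesis using pgap_mv_good[OF h True K xy] h by (simp add: left_diff_distrib)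
    qed (use pgap_mv_le[OF h xy] in simp)
  qed
  also have "\<dots> = pgap x y - (pgap x y / K\<^sup>2) * measure (cp r) ?A"
    using A by (subst Bochner_Integration.integral_diff) (auto simp: cp.prob_space less_top[symmetric])
  finally show ?thesis by (simp add: right_diff_distrib mult.commute[of "1 - _"])
qed

end

abbreviation ones :: "real ^ 'n::finite" where "ones \<equiv> (\<chi> i. 1)"

lemma ones_Pos: "ones \<in> Pos"
  by (simp add: Pos_def)

lemma Gplus_subset: "Gplus \<subseteq> (\<Union>n::nat. good (real (Suc n)) \<inter> Gmat)"
proof
  fix g :: "real ^ 'n ^ 'n" assume "g \<in> Gplus"
  then have g: "0 < g $ i $ j" for i j by (simp add: Gplus_def)
  define r where "r = (\<lambda>(i, j, k, l). g $ i $ j / g $ k $ l)"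
  obtain n :: nat where n: "Max (range r) \<le> real n" using real_arch_simple by blast
  have "g $ i $ j \<le> real (Suc n) * g $ k $ l" for i j k l
  proof -
    have "r (i, j, k, l) \<le> Max (range r)" by (rule Max_ge) auto
    then have "r (i, j, k, l) \<le> real (Suc n)" using n by linarith
    then have "g $ i $ j / g $ k $ l \<le> real (Suc n)" by (simp add: r_def)
    then show ?thesis using g[of k l] by (simp add: pos_divide_le_eq)
  qed
  then have "g \<in> good (real (Suc n))" by (simp add: good_def)
  moreover have "g \<in> Gmat" using g by (auto simp: Gmat_def less_imp_le)
  ultimately show "g \<in> (\<Union>n::nat. good (real (Suc n)) \<inter> Gmat)" by blast
qed

context matrix_law
begin

text \<open>The strictly positive matrices are covered by countably many sets \<open>good K\<close>,
  so one of these has positive mass.\<close>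

lemma ex_good:
  assumes "strictly_contracting \<mu>"
  shows "\<exists>r\<ge>1. \<exists>K\<ge>1. measure (cp r) (good K \<inter> Gmat) > 0"
proof -
  obtain r where r: "r \<ge> 1" "emeasure (cp r) Gplus > 0"
    using assms by (auto simp: strictly_contracting_def)
  let ?A = "\<lambda>n::nat. (good (real (Suc n)) \<inter> Gmat :: (real^'n^'n) set)"
  have A: "?A n \<in> sets (cp r)" for n using good_sets by (simp add: sets_cp del: of_nat_Suc)
  have "\<exists>n. emeasure (cp r) (?A n) \<noteq> 0"
  proof (rule ccontr)
    assume "\<not> ?thesis"
    then have "emeasure (cp r) (\<Union>n. ?A n) = 0" using A by (intro emeasure_UN_eq_0) auto
    moreover have "emeasure (cp r) Gplus \<le> emeasure (cp r) (\<Union>n. ?A n)"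
      by (rule emeasure_mono[OF Gplus_subset]) (use A in blast)
    ultimately show False using r by simp
  qed
  then obtain n where "emeasure (cp r) (?A n) \<noteq> 0" by blast
  then have "measure (cp r) (?A n) > 0"
    by (simp add: cp.emeasure_eq_measure zero_less_measure_iff del: of_nat_Suc)
  then show ?thesis using r by (intro exI[of _ r] conjI exI[of _ "real (Suc n)"]) auto
qed

text \<open>Contraction holds only after \<open>r\<close> steps for \<open>pgap\<close>; the weights \<open>1 / b ^ j\<close> in the adapted gauge turn
  this into a contraction in one step.\<close>

lemma ex_markov_contraction:
  assumes "strictly_contracting \<mu>"
  shows "\<exists>D B b. markov_contraction \<mu> Pos (*v) D B B b ones \<and> (\<forall>x\<in>Pos. \<forall>y\<in>Pos. pgap x y \<le> D x y)"
proof -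
  obtain r K where r: "r \<ge> 1" and K: "1 \<le> K" and pos: "measure (cp r) (good K \<inter> Gmat) > 0"
    using ex_good[OF assms] by blast
  define \<rho> where "\<rho> = 1 - measure (cp r) (good K \<inter> Gmat) / K\<^sup>2"
  have \<rho>: "\<rho> < 1" using pos K by (simp add: \<rho>_def)
  \<comment> \<open>The root is taken to obtain \<open>\<rho> \<le> b ^ r\<close>; the maximum with
    \<open>1 / 2\<close> keeps \<open>b\<close> positive even if \<rho> vanishes.\<close>
  define b where "b = root r (max \<rho> (1/2))"
  have b: "0 < b" "b < 1" "\<rho> \<le> b ^ r"
    using \<rho> r by (auto simp: b_def)
  define D where "D x y = (\<Sum>j<r. mean_pgap j x y / b ^ j)" for x y
  define B where "B = (\<Sum>j<r. 1 / b ^ j)"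
  have B: "0 \<le> B" unfolding B_def using b by (intro sum_nonneg) auto
  have D_nonneg: "0 \<le> D x y" and D_le': "D x y \<le> B * pgap x y" and le_D: "pgap x y \<le> D x y"
    if xy: "x \<in> Pos" "y \<in> Pos" for x y
  proof -
    show "0 \<le> D x y" unfolding D_def using mean_pgap_nonneg[OF xy] b by (intro sum_nonneg) auto
    show "D x y \<le> B * pgap x y" unfolding D_def B_def sum_distrib_right
      using mean_pgap_le[OF xy] b by (intro sum_mono) (simp add: divide_right_mono)
    have "mean_pgap 0 x y / b ^ 0 \<le> D x y" unfolding D_def
      using r mean_pgap_nonneg[OF xy] b by (intro member_le_sum[where f="\<lambda>j. mean_pgap j x y / b ^ j"]) auto
    then show "pgap x y \<le> D x y" by (simp add: mean_pgap_0[OF xy])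
  qed
  have act: "g *v x \<in> Pos" if "g \<in> space \<mu>" "x \<in> Pos" for g and x :: "real^'n"
    using that by (simp add: space_mu mv_Pos)
  have "markov_contraction \<mu> Pos (*v) D B B b ones"
  proof unfold_locales
    show "ones \<in> Pos" by (rule ones_Pos)
    show "0 < b" "b < 1" "0 \<le> B" using b B by auto
    fix x y :: "real^'n" assume xy: "x \<in> Pos" "y \<in> Pos"
    show "0 \<le> D x y" by (rule D_nonneg[OF xy])
    show "D x y \<le> B" using D_le'[OF xy] mult_left_mono[OF less_imp_le[OF pgap_less_1[OF xy]] B] by simp
    show "(\<lambda>g. D (g *v x) (g *v y)) \<in> borel_measurable \<mu>"
      unfolding D_def measurable_mu using mean_pgap_meas[OF xy] by (intro borel_measurable_sum borel_measurable_divide) auto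
    have "(\<integral>g. D (g *v x) (g *v y) \<partial>\<mu>) = (\<Sum>j<r. mean_pgap (Suc j) x y / b ^ j)"
      unfolding D_def using mean_pgap_act_int[OF xy] by (simp add: mean_pgap_Suc[OF xy])
    also have "\<dots> = b * (\<Sum>j<r. mean_pgap (Suc j) x y / b ^ Suc j)"
      using b by (simp add: sum_distrib_left)
    \<comment> \<open>Integration raises the index by one: the weighted sum loses its term of index
      0, which is \<open>pgap x y\<close>, and gains the term of index \<open>r\<close>, which is no
      larger.\<close>
    also have "(\<Sum>j<r. mean_pgap (Suc j) x y / b ^ Suc j) = (\<Sum>j<Suc r. mean_pgap j x y / b ^ j) - mean_pgap 0 x y"
      by (subst sum.lessThan_Suc_shift) simp
    also have "\<dots> = D x y + mean_pgap r x y / b ^ r - pgap x y"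
      by (simp add: D_def mean_pgap_0[OF xy])
    also have "mean_pgap r x y / b ^ r \<le> pgap x y"
    proof -
      have "mean_pgap r x y \<le> \<rho> * pgap x y" using mean_pgap_contract[OF K xy] by (simp add: \<rho>_def)
      also have "\<dots> \<le> b ^ r * pgap x y" using b pgap_nonneg[OF xy] by (intro mult_right_mono) auto
      finally show ?thesis using b by (simp add: divide_le_eq mult.commute)
    qed
    finally show "(\<integral>g. D (g *v x) (g *v y) \<partial>\<mu>) \<le> b * D x y" using b by simp
  next
    fix g and x y :: "real^'n" assume g: "g \<in> space \<mu>" and xy: "x \<in> Pos" "y \<in> Pos"
    have "D (g *v x) (g *v y) \<le> B * pgap (g *v x) (g *v y)" by (rule D_le'[OF act[OF g xy(1)] act[OF g xy(2)]])
    also have "\<dots> \<le> B * D x y"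
      using pgap_mv_le[OF _ xy, of g] g le_D[OF xy] B by (intro mult_left_mono) (auto simp: space_mu)
    finally show "D (g *v x) (g *v y) \<le> B * D x y" .
  next
    fix f :: "real^'n \<Rightarrow> real" and c and x :: "real^'n"
    assume f: "\<And>u v. u \<in> Pos \<Longrightarrow> v \<in> Pos \<Longrightarrow> \<bar>f u - f v\<bar> \<le> c * D u v" and x: "x \<in> Pos"
    have "\<bar>f u - f v\<bar> \<le> (\<bar>c\<bar> * B) * pgap u v" if "u \<in> Pos" "v \<in> Pos" for u v
    proof -
      have "\<bar>f u - f v\<bar> \<le> \<bar>c\<bar> * D u v"
        using f[OF that] mult_right_mono[OF abs_ge_self D_nonneg[OF that], of c] by simp
      also have "\<dots> \<le> \<bar>c\<bar> * (B * pgap u v)" using D_le'[OF that] by (intro mult_left_mono) auto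
      finally show ?thesis by (simp add: mult.assoc)
    qed
    then show "(\<lambda>g. f (g *v x)) \<in> borel_measurable \<mu>"
      unfolding measurable_mu by (intro continuous_Pos_measurable[OF continuous_on_Pos_of_lip x])
  qed (use act in auto)
  then show ?thesis using le_D by blast
qed

text \<open>The integral over the newest factor \<open>g\<close> is the inner one, so this is
  conditioning on the past product \<open>h\<close>.\<close>

lemma integral_cp_Suc:
  fixes F :: "_ \<Rightarrow> 'b::{banach, second_countable_topology}"
  assumes F: "F \<in> borel_measurable borel_G" and i: "integrable (cp (Suc n)) F"
  shows "(\<integral>k. F k \<partial>cp (Suc n)) = (\<integral>h. \<integral>g. F (g ** h) \<partial>\<mu> \<partial>cp n)"
proof -
  have m: "(\<lambda>(g, h). g ** h) \<in> measurable (\<mu> \<Otimes>\<^sub>M cp n) borel_G" by (simp only: measurable_pair prod_meas)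
  have "(\<integral>k. F k \<partial>cp (Suc n)) = (\<integral>p. F (case p of (g, h) \<Rightarrow> g ** h) \<partial>(\<mu> \<Otimes>\<^sub>M cp n))"
    unfolding conv_pow.simps by (rule integral_distr[OF m F])
  also have "\<dots> = (\<integral>(g, h). F (g ** h) \<partial>(\<mu> \<Otimes>\<^sub>M cp n))"
    by (intro Bochner_Integration.integral_cong) auto
  also have "\<dots> = (\<integral>h. \<integral>g. F (g ** h) \<partial>\<mu> \<partial>cp n)"
  proof (rule mc.integral_snd[symmetric])
    have "integrable (\<mu> \<Otimes>\<^sub>M cp n) (\<lambda>p. F (case p of (g, h) \<Rightarrow> g ** h))"
      using i unfolding conv_pow.simps by (simp only: integrable_distr_eq[OF m F])
    then show "integrable (\<mu> \<Otimes>\<^sub>M cp n) (\<lambda>(g, h). F (g ** h))" by (simp add: case_prod_beta')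
  qed
  finally show ?thesis .
qed

end

section \<open>The martingale attached to the matrix product\<close>

locale matrix_cocycle = matrix_law \<mu> +
  centered_cocycle \<mu> Pos "(*v)" D B B' a ones "\<lambda>g x. sig g x - m + \<psi> (g *v x) - \<psi> x" k
  for \<mu> :: "(real ^ 'n::finite ^ 'n) measure" and D B B' a m \<psi> k +
  fixes c b :: real
  assumes psi_lip: "lip c \<psi>" and psi_bdd: "\<And>x. x \<in> Pos \<Longrightarrow> \<bar>\<psi> x\<bar> \<le> b"
begin

text \<open>The increments of the centered cocycle along the orbit of \<open>ones\<close> telescope
  to this expression. It depends on the product alone, so its law can be computed under
  \<open>conv_pow \<mu> n\<close>.\<close>

definition mart :: "nat \<Rightarrow> real ^ 'n ^ 'n \<Rightarrow> real" where
  "mart n h = sig h ones - real n * m + \<psi> (h *v ones) - \<psi> ones"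

lemma lip_act_meas: "lip d f \<Longrightarrow> x \<in> Pos \<Longrightarrow> (\<lambda>h. f (h *v x)) \<in> borel_measurable borel_G"
  using lip_meas[of d f x] by (simp add: measurable_mu)

lemma mart_meas [measurable]: "mart n \<in> borel_measurable borel_G"
  unfolding mart_def[abs_def] using lip_act_meas[OF psi_lip ones_Pos] sig_measurable[of ones]
  by (intro borel_measurable_diff borel_measurable_add) auto

lemma mart_Suc:
  "mart (Suc n) (g ** h) = mart n h + (sig g (h *v ones) - m + \<psi> (g *v (h *v ones)) - \<psi> (h *v ones))"
  by (simp add: mart_def sig_mult matrix_vector_mul_assoc algebra_simps)

lemma h_ones: "h \<in> Gmat \<Longrightarrow> h *v ones \<in> Pos"
  by (rule mv_Pos[OF _ ones_Pos])

lemma P_iter_cp: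
  fixes f :: "real ^ 'n \<Rightarrow> real"
  assumes "lip d f"
  shows "(P ^^ n) f ones = (\<integral>h. f (h *v ones) \<partial>cp n)"
  using assms
proof (induction n arbitrary: f d)
  case 0
  show ?case using lip_act_meas[OF 0 ones_Pos] by (simp add: integral_return Gmat_one)
next
  case (Suc n)
  have "integrable (cp (Suc n)) (\<lambda>h. f (h *v ones))"
    by (rule cp.integrable_const_bound[where B="norm (f ones) + d * B"])
       (auto intro!: AE_I2 lip_bdd[OF Suc.prems, unfolded real_norm_def] h_ones
          simp: space_cp measurable_cp lip_act_meas[OF Suc.prems ones_Pos] simp del: conv_pow.simps)
  then have "(\<integral>h. f (h *v ones) \<partial>cp (Suc n)) = (\<integral>h. \<integral>g. f ((g ** h) *v ones) \<partial>\<mu> \<partial>cp n)"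
    by (rule integral_cp_Suc[OF lip_act_meas[OF Suc.prems ones_Pos]])
  also have "\<dots> = (\<integral>h. P f (h *v ones) \<partial>cp n)" by (simp add: P_def matrix_vector_mul_assoc)
  also have "\<dots> = (P ^^ n) (P f) ones" using Suc.IH[OF P_lip[OF Suc.prems]] by simp
  finally show ?case by (simp add: funpow_swap1)
qed

text \<open>With \<open>f\<close> generalised in the induction, integrating out the newest factor
  turns \<open>f\<close> into \<open>Q \<theta> f\<close>. For \<open>f = 1\<close> the right side
  is the characteristic function of the martingale.\<close>

lemma Q_iter_cp:
  assumes "lip d f"
  shows "(Q \<theta> ^^ n) f ones = (\<integral>h. iexp (\<theta> * mart n h) * f (h *v ones) \<partial>cp n)"
  using assms
proof (induction n arbitrary: f d)
  case 0
  have "(\<lambda>h. iexp (\<theta> * mart 0 h) * f (h *v ones)) \<in> borel_measurable borel_G"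
    using lip_act_meas[OF 0 ones_Pos] by measurable
  then show ?case by (simp add: integral_return Gmat_one) (simp add: mart_def sig_def)
next
  case (Suc n)
  let ?F = "\<lambda>h. iexp (\<theta> * mart (Suc n) h) * f (h *v ones)"
  have Fm: "?F \<in> borel_measurable borel_G"
    using lip_act_meas[OF Suc.prems ones_Pos] by measurable
  have "integrable (cp (Suc n)) ?F"
    by (rule cp.integrable_const_bound[where B="norm (f ones) + d * B"])
       (use Fm in \<open>auto intro!: AE_I2 lip_bdd[OF Suc.prems] h_ones
          simp: space_cp measurable_cp norm_mult simp del: conv_pow.simps\<close>)
  then have "(\<integral>h. ?F h \<partial>cp (Suc n)) = (\<integral>h. \<integral>g. ?F (g ** h) \<partial>\<mu> \<partial>cp n)"
    by (rule integral_cp_Suc[OF Fm])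
  also have "\<dots> = (\<integral>h. iexp (\<theta> * mart n h) * Q \<theta> f (h *v ones) \<partial>cp n)"
    unfolding Q_def mart_Suc integral_mult_right_zero[symmetric]
    by (intro Bochner_Integration.integral_cong refl)
       (simp add: distrib_left exp_add mult.assoc matrix_vector_mul_assoc flip: of_real_mult)
  also have "\<dots> = (Q \<theta> ^^ n) (Q \<theta> f) ones"
    using Suc.IH[OF Q_lip[OF Suc.prems lip_bdd[OF Suc.prems]]] by simp
  finally show ?case by (simp add: funpow_swap1)
qed

text \<open>The cross term vanishes because the increment is centered at the state
  \<open>h *v ones\<close>.\<close>

lemma mart_Suc_sq:
  "h \<in> Gmat \<Longrightarrow> (\<integral>g. (mart (Suc n) (g ** h))\<^sup>2 \<partial>\<mu>) = (mart n h)\<^sup>2 + V (h *v ones)"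
proof -
  assume h: "h \<in> Gmat"
  let ?x = "\<lambda>g. sig g (h *v ones) - m + \<psi> (g *v (h *v ones)) - \<psi> (h *v ones)"
  have "(\<integral>g. (mart (Suc n) (g ** h))\<^sup>2 \<partial>\<mu>) = (\<integral>g. (mart n h)\<^sup>2 + 2 * mart n h * ?x g + (?x g)\<^sup>2 \<partial>\<mu>)"
    by (intro Bochner_Integration.integral_cong refl) (simp add: mart_Suc power2_sum[of "mart n h"])
  also have "\<dots> = (mart n h)\<^sup>2 + 2 * mart n h * (\<integral>g. ?x g \<partial>\<mu>) + (\<integral>g. (?x g)\<^sup>2 \<partial>\<mu>)"
    using xi_int[OF h_ones[OF h]] xi_int2[OF h_ones[OF h]] by (simp add: mu.prob_space)
  also have "\<dots> = (mart n h)\<^sup>2 + V (h *v ones)"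
    using xi_centered[OF h_ones[OF h]] by (simp add: V_def)
  finally show ?thesis .
qed

lemma mart_sq:
  "integrable (cp n) (\<lambda>h. (mart n h)\<^sup>2) \<and> (\<integral>h. (mart n h)\<^sup>2 \<partial>cp n) = (\<Sum>j<n. (P ^^ j) V ones)"
proof (induction n)
  case 0
  have m0: "mart 0 (mat 1) = 0" by (simp add: mart_def sig_def)
  have "(\<integral>\<^sup>+h. ennreal ((mart 0 h)\<^sup>2) \<partial>return borel_G (mat 1)) = 0"
    by (simp add: nn_integral_return Gmat_one m0)
  then have "integrable (return borel_G (mat 1)) (\<lambda>h. (mart 0 h)\<^sup>2)"
    by (intro integrableI_bounded) auto
  then show ?case by (simp add: integral_return Gmat_one m0)
next
  case (Suc n)
  have km: "(\<lambda>g. ennreal (2 * (k g)\<^sup>2)) \<in> borel_measurable \<mu>" using k_meas by measurable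
  have i: "integrable (cp (Suc n)) (\<lambda>h. (mart (Suc n) h)\<^sup>2)"
  proof (rule integrableI_bounded)
    have "(\<integral>\<^sup>+h. ennreal ((mart (Suc n) h)\<^sup>2) \<partial>cp (Suc n)) = (\<integral>\<^sup>+g. \<integral>\<^sup>+h. ennreal ((mart (Suc n) (g ** h))\<^sup>2) \<partial>cp n \<partial>\<mu>)"
      by (rule nn_integral_cp_Suc) measurable
    also have "\<dots> \<le> (\<integral>\<^sup>+g. \<integral>\<^sup>+h. ennreal (2 * (k g)\<^sup>2) + ennreal (2 * (mart n h)\<^sup>2) \<partial>cp n \<partial>\<mu>)"
    proof (intro nn_integral_mono)
      fix g h assume "g \<in> space \<mu>" "h \<in> space (cp n)"
      then have h: "h \<in> Gmat" by (simp add: space_cp)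
      let ?x = "sig g (h *v ones) - m + \<psi> (g *v (h *v ones)) - \<psi> (h *v ones)"
      have "(mart (Suc n) (g ** h))\<^sup>2 = (mart n h + ?x)\<^sup>2" by (simp add: mart_Suc)
      also have "\<dots> \<le> 2 * ?x\<^sup>2 + 2 * (mart n h)\<^sup>2"
        using sum_squares_bound[of "mart n h" ?x] by (simp add: power2_sum)
      also have "\<dots> \<le> 2 * (k g)\<^sup>2 + 2 * (mart n h)\<^sup>2"
        using xi_sq_le[OF \<open>g \<in> space \<mu>\<close> h_ones[OF h]] by simp
      finally show "ennreal ((mart (Suc n) (g ** h))\<^sup>2) \<le> ennreal (2 * (k g)\<^sup>2) + ennreal (2 * (mart n h)\<^sup>2)"
        by (simp add: ennreal_leI flip: ennreal_plus)
    qed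
    also have "\<dots> = (\<integral>\<^sup>+g. ennreal (2 * (k g)\<^sup>2) \<partial>\<mu>) + (\<integral>\<^sup>+h. ennreal (2 * (mart n h)\<^sup>2) \<partial>cp n)"
      using km by (simp add: nn_integral_add measurable_cp cp.emeasure_space_1 mu.emeasure_space_1)
    also have "\<dots> < \<infinity>"
      using k_int[of 2] Suc by (auto simp: nn_integral_eq_integral less_top[symmetric])
    finally show "(\<integral>\<^sup>+h. ennreal (norm ((mart (Suc n) h)\<^sup>2)) \<partial>cp (Suc n)) < \<infinity>" by simp
  qed (unfold measurable_cp, measurable)
  have bV: "integrable (cp n) (\<lambda>h. V (h *v ones))"
    by (rule cp.integrable_const_bound[where B="norm (V ones) + (2 * K 2) * B"])
       (auto intro!: AE_I2 lip_bdd[OF V_lip, unfolded real_norm_def] h_ones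
          simp: space_cp measurable_cp lip_act_meas[OF V_lip ones_Pos] simp del: conv_pow.simps)
  have "(\<integral>h. (mart (Suc n) h)\<^sup>2 \<partial>cp (Suc n)) = (\<integral>h. \<integral>g. (mart (Suc n) (g ** h))\<^sup>2 \<partial>\<mu> \<partial>cp n)"
    by (rule integral_cp_Suc[OF _ i]) measurable
  also have "\<dots> = (\<integral>h. (mart n h)\<^sup>2 + V (h *v ones) \<partial>cp n)"
    by (rule Bochner_Integration.integral_cong[OF refl]) (simp add: space_cp mart_Suc_sq)
  also have "\<dots> = (\<Sum>j<Suc n. (P ^^ j) V ones)"
    using Suc bV P_iter_cp[OF V_lip, of n] by simp
  finally show ?case using i by blast
qed

text \<open>The conditional variances \<open>(P ^^ j) V ones\<close> approach \<open>s2\<close>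
  geometrically, so their deviations sum to a quantity bounded in \<open>n\<close>.\<close>

lemma mart_variance: "\<bar>(\<integral>h. (mart n h)\<^sup>2 \<partial>cp n) - n * s2\<bar> \<le> 2 * K 2 * B / (1 - a)"
proof -
  have "(\<integral>h. (mart n h)\<^sup>2 \<partial>cp n) - n * s2 = (\<Sum>j<n. (P ^^ j) V ones - s2)"
    using mart_sq[of n] by (simp add: sum_subtractf)
  also have "\<bar>\<dots>\<bar> \<le> (\<Sum>j<n. a ^ j * (2 * K 2 * B))"
    using nu_close[OF V_lip ones_Pos] unfolding s2_def
    by (intro order_trans[OF sum_abs] sum_mono) (simp add: mult.assoc)
  also have "\<dots> = (\<Sum>j<n. a ^ j) * (2 * K 2 * B)" by (simp add: sum_distrib_right)
  also have "\<dots> \<le> 1 / (1 - a) * (2 * K 2 * B)"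
  proof (rule mult_right_mono)
    have "(\<Sum>j<n. a ^ j) = (1 - a ^ n) / (1 - a)" using a by (simp add: sum_gp_strict)
    also have "\<dots> \<le> 1 / (1 - a)" using a by (intro divide_right_mono) auto
    finally show "(\<Sum>j<n. a ^ j) \<le> 1 / (1 - a)" .
  qed (use K_nonneg[of 2] B_nonneg in simp)
  finally show ?thesis by simp
qed

lemma mart_char:
  assumes "s2 > 0"
  shows "\<exists>c0>0. \<exists>C\<ge>0. \<forall>\<theta> n. \<bar>\<theta>\<bar> \<le> c0 \<longrightarrow>
    cmod ((\<integral>h. iexp (\<theta> * mart n h) \<partial>cp n) - of_real (exp (- s2 * \<theta>\<^sup>2 * n / 2)))
      \<le> C * (\<theta>\<^sup>2 + n * \<bar>\<theta>\<bar> ^ 3) * exp (- s2 * \<theta>\<^sup>2 * n / 4)"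
  using char_function_estimate[OF assms] Q_iter_cp[OF lip_const[of "1::complex"]] by simp

end

section \<open>Exponential moments of the distortion\<close>

text \<open>By homogeneity two fractions with sum 1 are enough, and there
  \<open>t \<le> t powr \<gamma>\<close>.\<close>

lemma powr_subadditive:
  fixes x y \<gamma> :: real
  assumes "0 \<le> x" "0 \<le> y" "0 < \<gamma>" "\<gamma> \<le> 1"
  shows "(x + y) powr \<gamma> \<le> x powr \<gamma> + y powr \<gamma>"
proof (cases "x + y = 0")
  case False
  then have s: "0 < x + y" using assms by simp
  have t: "t \<le> t powr \<gamma>" if "0 \<le> t" "t \<le> 1" for t :: real
  proof (cases "t = 0")
    case False
    then have "t powr 1 \<le> t powr \<gamma>" using that assms by (intro powr_mono') auto
    then show ?thesis using that False by simp
  qed simp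
  have "1 = x / (x + y) + y / (x + y)" using s by (simp add: add_divide_distrib[symmetric])
  also have "\<dots> \<le> (x / (x + y)) powr \<gamma> + (y / (x + y)) powr \<gamma>"
    using assms s by (intro add_mono t) auto
  also have "\<dots> = (x powr \<gamma> + y powr \<gamma>) / (x + y) powr \<gamma>"
    using assms s by (simp add: powr_divide add_divide_distrib)
  finally show ?thesis using s by (simp add: pos_le_divide_eq)
qed (use assms in \<open>auto simp: add_nonneg_eq_0_iff\<close>)

text \<open>Convexity of the exponential between 0 and \<open>\<delta>0 * z\<close>. A small
  \<delta> brings the resulting bound on an expectation close to 1, at the price of the moment at
  \<open>\<delta>0\<close>.\<close>

lemma exp_convex_bound:
  fixes z \<delta> \<delta>0 :: real
  assumes "0 < \<delta>" "\<delta> \<le> \<delta>0" shows "exp (\<delta> * z) \<le> 1 + \<delta> / \<delta>0 * exp (\<delta>0 * z)"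
proof -
  define t where "t = \<delta> / \<delta>0"
  have t: "0 \<le> t" "t \<le> 1" using assms by (auto simp: t_def)
  have "exp ((1 - t) *\<^sub>R 0 + t *\<^sub>R (\<delta>0 * z)) \<le> (1 - t) * exp 0 + t * exp (\<delta>0 * z)"
    by (rule convex_onD[OF exp_convex]) (use t in auto)
  moreover have "t * \<delta>0 = \<delta>" using assms by (simp add: t_def)
  ultimately show ?thesis using t by (simp add: mult.assoc[symmetric] t_def[symmetric])
qed

lemma sq_le_exp_powr:
  fixes \<delta> \<gamma> :: real
  assumes "0 < \<delta>" "0 < \<gamma>"
  shows "\<exists>C\<ge>0. \<forall>z\<ge>0. z\<^sup>2 \<le> C * exp (\<delta> * z powr \<gamma>)"
proof -
  \<comment> \<open>An integer above \<open>2 / \<gamma>\<close> lets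
    \<open>(1 + y / j) ^ j \<le> exp y\<close> beat the power \<open>u powr (2 / \<gamma>)\<close>
    of \<open>u = z powr \<gamma>\<close>.\<close>
  obtain j :: nat where j: "2 / \<gamma> \<le> real j" using real_arch_simple by blast
  then have j0: "0 < j" using assms by (cases j) (auto simp: divide_le_0_iff)
  define C where "C = max 1 ((real j / \<delta>) ^ j)"
  have "z\<^sup>2 \<le> C * exp (\<delta> * z powr \<gamma>)" if z: "0 \<le> z" for z
  proof (cases "z \<le> 1")
    case True
    then have "z\<^sup>2 \<le> 1 * 1" using z by (simp add: power2_eq_square mult_le_one)
    also have "\<dots> \<le> C * exp (\<delta> * z powr \<gamma>)"
      using assms by (intro mult_mono) (auto simp: C_def)
    finally show ?thesis .
  next
    case False
    define u where "u = z powr \<gamma>"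
    have u: "1 \<le> u" using False assms by (simp add: u_def ge_one_powr_ge_zero)
    have "z\<^sup>2 = u powr (2 / \<gamma>)" using False assms by (simp add: u_def powr_powr)
    also have "\<dots> \<le> u powr real j" by (rule powr_mono[OF j u])
    also have "\<dots> = (real j / \<delta>) ^ j * (\<delta> * u / real j) ^ j"
      using u assms j0 by (simp add: powr_realpow power_mult_distrib[symmetric])
    also have "\<dots> \<le> (real j / \<delta>) ^ j * exp (\<delta> * u)"
    proof (rule mult_left_mono)
      have "(\<delta> * u / real j) ^ j \<le> (1 + \<delta> * u / real j) ^ j"
        using u assms by (intro power_mono) auto
      also have "\<dots> \<le> exp (\<delta> * u)"
        using u assms j0 by (intro exp_ge_one_plus_x_over_n_power_n) (auto intro: order_trans[of _ 0])
      finally show "(\<delta> * u / real j) ^ j \<le> exp (\<delta> * u)" .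
    qed (use assms in auto)
    also have "\<dots> \<le> C * exp (\<delta> * u)" by (intro mult_right_mono) (auto simp: C_def)
    finally show ?thesis by (simp add: u_def)
  qed
  then show ?thesis by (intro exI[of _ C]) (auto simp: C_def)
qed

definition exp_Lmat :: "real \<Rightarrow> real \<Rightarrow> real ^ 'n::finite ^ 'n \<Rightarrow> real" where
  "exp_Lmat \<gamma> \<delta> h = exp (\<delta> * ln (Lmat h) powr \<gamma>)"

lemma exp_Lmat_measurable: "(\<lambda>h. ennreal (exp_Lmat \<gamma> \<delta> h)) \<in> borel_measurable borel_G"
  unfolding exp_Lmat_def by measurable

text \<open>The condition \<open>\<gamma> \<le> 1\<close> enters here: \<open>powr\<close> with such
  an exponent is subadditive, and so is \<open>ln (Lmat h)\<close> under products.\<close>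

lemma exp_Lmat_mult:
  assumes g: "g \<in> Gmat" and h: "h \<in> Gmat" and "0 < \<gamma>" "\<gamma> \<le> 1" "0 \<le> \<delta>"
  shows "exp_Lmat \<gamma> \<delta> (g ** h) \<le> exp_Lmat \<gamma> \<delta> g * exp_Lmat \<gamma> \<delta> h"
proof -
  have nn: "0 \<le> ln (Lmat g)" "0 \<le> ln (Lmat h)" "0 \<le> ln (Lmat (g ** h))"
    using Lmat_ge_1[OF g] Lmat_ge_1[OF h] Lmat_ge_1[OF Gmat_mult[OF g h]] by auto
  have "ln (Lmat (g ** h)) powr \<gamma> \<le> (ln (Lmat g) + ln (Lmat h)) powr \<gamma>"
    using ln_Lmat_mult[OF g h] nn assms by (intro powr_mono2) auto
  also have "\<dots> \<le> ln (Lmat g) powr \<gamma> + ln (Lmat h) powr \<gamma>"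
    using nn assms by (intro powr_subadditive) auto
  finally have "\<delta> * ln (Lmat (g ** h)) powr \<gamma> \<le> \<delta> * (ln (Lmat g) powr \<gamma> + ln (Lmat h) powr \<gamma>)"
    using assms by (intro mult_left_mono) auto
  then show ?thesis unfolding exp_Lmat_def by (simp add: distrib_left flip: exp_add)
qed

context matrix_law
begin

lemma exp_Lmat_measurable_cp: "(\<lambda>h. ennreal (exp_Lmat \<gamma> \<delta> h)) \<in> borel_measurable (cp n)"
  unfolding measurable_cp by (rule exp_Lmat_measurable)

lemma exp_Lmat_finite:
  assumes \<gamma>: "0 < \<gamma>" "\<gamma> \<le> 1" "0 \<le> \<delta>" and fin: "(\<integral>\<^sup>+h. exp_Lmat \<gamma> \<delta> h \<partial>\<mu>) < \<infinity>"
  shows "(\<integral>\<^sup>+h. exp_Lmat \<gamma> \<delta> h \<partial>cp n) < \<infinity>"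
proof (induction n)
  case 0
  show ?case by (simp add: nn_integral_return Gmat_one exp_Lmat_measurable)
next
  case (Suc n)
  have "(\<integral>\<^sup>+h. exp_Lmat \<gamma> \<delta> h \<partial>cp (Suc n)) = (\<integral>\<^sup>+g. \<integral>\<^sup>+h. exp_Lmat \<gamma> \<delta> (g ** h) \<partial>cp n \<partial>\<mu>)"
    by (rule nn_integral_cp_Suc[OF exp_Lmat_measurable])
  also have "\<dots> \<le> (\<integral>\<^sup>+g. \<integral>\<^sup>+h. ennreal (exp_Lmat \<gamma> \<delta> g) * ennreal (exp_Lmat \<gamma> \<delta> h) \<partial>cp n \<partial>\<mu>)"
    by (intro nn_integral_mono)
       (auto simp: space_mu space_cp exp_Lmat_def[of _ _ "_ :: real^_^_"] simp flip: ennreal_mult intro!: ennreal_leI exp_Lmat_mult[OF _ _ \<gamma>, unfolded exp_Lmat_def])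
  also have "\<dots> = (\<integral>\<^sup>+g. exp_Lmat \<gamma> \<delta> g \<partial>\<mu>) * (\<integral>\<^sup>+h. exp_Lmat \<gamma> \<delta> h \<partial>cp n)"
    by (simp add: nn_integral_cmult nn_integral_multc measurable_cp measurable_mu exp_Lmat_measurable)
  also have "\<dots> < \<infinity>" using Suc fin by (simp add: ennreal_mult_less_top)
  finally show ?case .
qed

text \<open>If the product of the \<open>r\<close> factors applied first has comparable entries, then the distortion of the
  whole product is at most \<open>K\<close>, whatever the later factors are.\<close>

theorem uniform_exp_moment:
  assumes sc: "strictly_contracting \<mu>" and \<gamma>: "0 < \<gamma>" "\<gamma> \<le> 1" and em: "almost_exp_moment \<mu> \<gamma>"
  shows "\<exists>\<delta>>0. \<exists>C\<ge>0. \<forall>n. (\<integral>\<^sup>+h. exp_Lmat \<gamma> \<delta> h \<partial>cp n) \<le> ennreal C"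
proof -
  obtain \<delta>0 where \<delta>0: "0 < \<delta>0" "(\<integral>\<^sup>+h. exp_Lmat \<gamma> \<delta>0 h \<partial>\<mu>) < \<infinity>"
    using em unfolding almost_exp_moment_def exp_Lmat_def by blast
  obtain r K where r: "r \<ge> 1" and K: "1 \<le> K" and pos: "measure (cp r) (good K \<inter> Gmat) > 0"
    using ex_good[OF sc] by blast
  let ?A = "good K \<inter> Gmat :: (real^'n^'n) set"
  have A: "?A \<in> sets (cp r)" using good_sets by (simp add: sets_cp)
  define p where "p = measure (cp r) ?A"
  have p: "0 < p" "p \<le> 1" using pos by (auto simp: p_def)
  define I0 where "I0 = enn2real (\<integral>\<^sup>+h. exp_Lmat \<gamma> \<delta>0 h \<partial>cp r)"
  have I0: "0 \<le> I0" "(\<integral>\<^sup>+h. exp_Lmat \<gamma> \<delta>0 h \<partial>cp r) = ennreal I0"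
    using exp_Lmat_finite[OF \<gamma> less_imp_le[OF \<delta>0(1)] \<delta>0(2), of r] by (auto simp: I0_def less_top)
  \<comment> \<open>With this choice the part of the moment outside \<open>good K\<close> is at most
    \<open>1 - p + p / 2\<close>, strictly below 1.\<close>
  define \<delta> where "\<delta> = \<delta>0 * (p / (2 * (I0 + 1)))"
  have \<delta>: "0 < \<delta>" "\<delta> / \<delta>0 * I0 \<le> p / 2" "\<delta> \<le> \<delta>0"
  proof -
    show "0 < \<delta>" using \<delta>0 p I0 by (simp add: \<delta>_def)
    have "\<delta> / \<delta>0 * I0 = p * I0 / (2 * (I0 + 1))" using \<delta>0 by (simp add: \<delta>_def)
    also have "\<dots> \<le> p * (I0 + 1) / (2 * (I0 + 1))" using p I0 by (intro divide_right_mono mult_left_mono) auto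
    also have "\<dots> = p / 2" using I0(1) by (simp add: field_simps)
    finally show "\<delta> / \<delta>0 * I0 \<le> p / 2" .
    have "p / (2 * (I0 + 1)) \<le> 1" using p I0 by (simp add: divide_le_eq)
    then show "\<delta> \<le> \<delta>0" unfolding \<delta>_def using \<delta>0 by (intro mult_left_le) auto
  qed
  have beta: "(\<integral>\<^sup>+h. ennreal (exp_Lmat \<gamma> \<delta> h) * indicator (- ?A) h \<partial>cp r) \<le> ennreal (1 - p / 2)"
  proof -
    have "(\<integral>\<^sup>+h. ennreal (exp_Lmat \<gamma> \<delta> h) * indicator (- ?A) h \<partial>cp r)
      \<le> (\<integral>\<^sup>+h. indicator (space (cp r) - ?A) h + ennreal (\<delta> / \<delta>0) * ennreal (exp_Lmat \<gamma> \<delta>0 h) \<partial>cp r)"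
    proof (rule nn_integral_mono)
      fix h assume h: "h \<in> space (cp r)"
      have "ennreal (exp_Lmat \<gamma> \<delta> h) \<le> ennreal (1 + \<delta> / \<delta>0 * exp_Lmat \<gamma> \<delta>0 h)"
        unfolding exp_Lmat_def by (intro ennreal_leI exp_convex_bound \<delta>)
      also have "\<dots> = 1 + ennreal (\<delta> / \<delta>0) * ennreal (exp_Lmat \<gamma> \<delta>0 h)"
        using \<delta> \<delta>0 ennreal_mult[of "\<delta> / \<delta>0" "exp_Lmat \<gamma> \<delta>0 h"] by (simp add: ennreal_plus exp_Lmat_def)
      finally show "ennreal (exp_Lmat \<gamma> \<delta> h) * indicator (- ?A) h
        \<le> indicator (space (cp r) - ?A) h + ennreal (\<delta> / \<delta>0) * ennreal (exp_Lmat \<gamma> \<delta>0 h)"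
        using h by (auto split: split_indicator)
    qed
    also have "\<dots> = emeasure (cp r) (space (cp r) - ?A) + ennreal (\<delta> / \<delta>0) * ennreal I0"
      using A exp_Lmat_measurable_cp[of \<gamma> \<delta>0 r]
      by (subst nn_integral_add) (simp_all add: nn_integral_cmult I0(2) borel_measurable_indicator sets.compl_sets nn_integral_indicator)
    also have "\<dots> = ennreal (1 - p) + ennreal (\<delta> / \<delta>0 * I0)"
      using A \<delta> \<delta>0 I0 ennreal_mult[of "\<delta> / \<delta>0" I0] by (simp add: cp.emeasure_eq_measure cp.prob_compl p_def)
    also have "\<dots> = ennreal (1 - p + \<delta> / \<delta>0 * I0)"
      using p \<delta> \<delta>0 I0 by (intro ennreal_plus[symmetric]) auto
    also have "\<dots> \<le> ennreal (1 - p / 2)" by (intro ennreal_leI) (use \<delta>(2) in linarith)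
    finally show ?thesis .
  qed
  define K' where "K' = exp (\<delta> * ln K powr \<gamma>)"
  have step: "(\<integral>\<^sup>+h. exp_Lmat \<gamma> \<delta> h \<partial>cp (n + r)) \<le> ennreal K' + ennreal (1 - p / 2) * (\<integral>\<^sup>+h. exp_Lmat \<gamma> \<delta> h \<partial>cp n)" for n
  proof -
    have "(\<integral>\<^sup>+h. exp_Lmat \<gamma> \<delta> h \<partial>cp (n + r)) = (\<integral>\<^sup>+g. \<integral>\<^sup>+h. exp_Lmat \<gamma> \<delta> (g ** h) \<partial>cp r \<partial>cp n)"
      by (rule nn_integral_cp_add[OF exp_Lmat_measurable])
    also have "\<dots> \<le> (\<integral>\<^sup>+g. \<integral>\<^sup>+h. ennreal K' + ennreal (exp_Lmat \<gamma> \<delta> g) * (ennreal (exp_Lmat \<gamma> \<delta> h) * indicator (- ?A) h) \<partial>cp r \<partial>cp n)"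
    proof (intro nn_integral_mono)
      fix g h assume "g \<in> space (cp n)" "h \<in> space (cp r)"
      then have gh: "g \<in> Gmat" "h \<in> Gmat" by (auto simp: space_cp)
      show "ennreal (exp_Lmat \<gamma> \<delta> (g ** h)) \<le> ennreal K' + ennreal (exp_Lmat \<gamma> \<delta> g) * (ennreal (exp_Lmat \<gamma> \<delta> h) * indicator (- ?A) h)"
      proof (cases "h \<in> good K")
        case True
        have "ln (Lmat (g ** h)) powr \<gamma> \<le> ln K powr \<gamma>"
          using Lmat_mult_good[OF gh True] Lmat_ge_1[OF Gmat_mult[OF gh]] \<gamma> K
          by (intro powr_mono2) (auto intro!: ln_mono)
        then have "exp_Lmat \<gamma> \<delta> (g ** h) \<le> K'" unfolding exp_Lmat_def K'_def using \<delta> by simp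
        then show ?thesis by (simp add: add_increasing2 ennreal_leI)
      next
        case False
        have "ennreal (exp_Lmat \<gamma> \<delta> (g ** h)) \<le> ennreal (exp_Lmat \<gamma> \<delta> g * exp_Lmat \<gamma> \<delta> h)"
          by (intro ennreal_leI exp_Lmat_mult gh \<gamma> less_imp_le[OF \<delta>(1)])
        also have "\<dots> = ennreal (exp_Lmat \<gamma> \<delta> g) * ennreal (exp_Lmat \<gamma> \<delta> h)"
          by (rule ennreal_mult) (simp_all add: exp_Lmat_def)
        finally show ?thesis using False by (simp add: add_increasing)
      qed
    qed
    also have "\<dots> = ennreal K' + (\<integral>\<^sup>+g. ennreal (exp_Lmat \<gamma> \<delta> g) * (\<integral>\<^sup>+h. ennreal (exp_Lmat \<gamma> \<delta> h) * indicator (- ?A) h \<partial>cp r) \<partial>cp n)"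
    proof -
      have m: "(\<lambda>h. ennreal (exp_Lmat \<gamma> \<delta> h) * indicator (- ?A) h) \<in> borel_measurable (cp r)"
      proof -
        have "(\<lambda>h. ennreal (exp_Lmat \<gamma> \<delta> h) * indicator (space (cp r) - ?A) h) \<in> borel_measurable (cp r)"
          using A by (intro borel_measurable_times_ennreal borel_measurable_indicator exp_Lmat_measurable_cp sets.compl_sets)
        then show ?thesis by (rule measurable_cong[THEN iffD1, rotated]) (auto split: split_indicator)
      qed
      show ?thesis
        using m exp_Lmat_measurable_cp[of \<gamma> \<delta> n]
        by (simp add: nn_integral_add nn_integral_cmult nn_integral_multc cp.emeasure_space_1)
    qed
    also have "\<dots> \<le> ennreal K' + (\<integral>\<^sup>+g. ennreal (exp_Lmat \<gamma> \<delta> g) * ennreal (1 - p / 2) \<partial>cp n)"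
      by (intro add_left_mono nn_integral_mono mult_left_mono beta) auto
    also have "\<dots> = ennreal K' + ennreal (1 - p / 2) * (\<integral>\<^sup>+h. exp_Lmat \<gamma> \<delta> h \<partial>cp n)"
      by (simp add: nn_integral_multc measurable_cp exp_Lmat_measurable mult.commute)
    finally show ?thesis .
  qed
  have fin: "(\<integral>\<^sup>+h. exp_Lmat \<gamma> \<delta> h \<partial>cp n) < \<infinity>" for n
  proof (rule exp_Lmat_finite[OF \<gamma> less_imp_le[OF \<delta>(1)]])
    have "(\<integral>\<^sup>+h. exp_Lmat \<gamma> \<delta> h \<partial>\<mu>) \<le> (\<integral>\<^sup>+h. exp_Lmat \<gamma> \<delta>0 h \<partial>\<mu>)"
      unfolding exp_Lmat_def using \<delta> by (intro nn_integral_mono ennreal_leI) (auto intro!: mult_right_mono)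
    then show "(\<integral>\<^sup>+h. exp_Lmat \<gamma> \<delta> h \<partial>\<mu>) < \<infinity>" using \<delta>0(2) by (rule le_less_trans)
  qed
  \<comment> \<open>The sum covers the exponents below \<open>r\<close>; the inequality
    \<open>2 * K' / p \<le> C\<close> is equivalent to \<open>K' + (1 - p / 2) * C \<le> C\<close>,
    which closes the induction.\<close>
  define C where "C = (\<Sum>j<r. enn2real (\<integral>\<^sup>+h. exp_Lmat \<gamma> \<delta> h \<partial>cp j)) + 2 * K' / p"
  have sum0: "0 \<le> (\<Sum>j<r. enn2real (\<integral>\<^sup>+h. exp_Lmat \<gamma> \<delta> h \<partial>cp j))" by (intro sum_nonneg) auto
  have K'0: "0 < K'" by (simp add: K'_def)
  have C: "0 \<le> C" using sum0 K'0 p by (simp add: C_def)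
  have "(\<integral>\<^sup>+h. exp_Lmat \<gamma> \<delta> h \<partial>cp n) \<le> ennreal C" for n
  proof (induction n rule: less_induct)
    case (less n)
    show ?case
    proof (cases "n < r")
      case True
      have "(\<integral>\<^sup>+h. exp_Lmat \<gamma> \<delta> h \<partial>cp n) = ennreal (enn2real (\<integral>\<^sup>+h. exp_Lmat \<gamma> \<delta> h \<partial>cp n))"
        using fin[of n] by (simp add: less_top)
      also have "\<dots> \<le> ennreal C"
      proof (rule ennreal_leI)
        have "enn2real (\<integral>\<^sup>+h. exp_Lmat \<gamma> \<delta> h \<partial>cp n) \<le> (\<Sum>j<r. enn2real (\<integral>\<^sup>+h. exp_Lmat \<gamma> \<delta> h \<partial>cp j))"
          using True by (intro member_le_sum[where f="\<lambda>j. enn2real (\<integral>\<^sup>+h. exp_Lmat \<gamma> \<delta> h \<partial>cp j)"]) auto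
        then show "enn2real (\<integral>\<^sup>+h. exp_Lmat \<gamma> \<delta> h \<partial>cp n) \<le> C"
          using K'0 p by (simp add: C_def add_increasing2)
      qed
      finally show ?thesis .
    next
      case False
      have "(\<integral>\<^sup>+h. exp_Lmat \<gamma> \<delta> h \<partial>cp n) \<le> ennreal K' + ennreal (1 - p / 2) * (\<integral>\<^sup>+h. exp_Lmat \<gamma> \<delta> h \<partial>cp (n - r))"
        using step[of "n - r"] False by simp
      also have "\<dots> \<le> ennreal K' + ennreal (1 - p / 2) * ennreal C"
        using less[of "n - r"] False r by (intro add_left_mono mult_left_mono) auto
      also have "\<dots> = ennreal (K' + (1 - p / 2) * C)"
        using K'0 p C by (simp add: ennreal_plus ennreal_mult)
      also have "\<dots> \<le> ennreal C"
      proof (rule ennreal_leI)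
        have "2 * K' / p \<le> C" using sum0 by (simp add: C_def)
        then have "K' \<le> p / 2 * C" using p by (simp add: field_simps)
        then show "K' + (1 - p / 2) * C \<le> C" by (simp add: left_diff_distrib)
      qed
      finally show ?thesis .
    qed
  qed
  then show ?thesis using \<delta>(1) C by blast
qed

end

section \<open>The limit theorem\<close>

context matrix_law
begin

lemma ex_matrix_cocycle:
  assumes sc: "strictly_contracting \<mu>" and mom: "has_moment \<mu> 3"
  shows "\<exists>D B b m \<psi> k c d. matrix_cocycle \<mu> D B B b m \<psi> k c d"
proof -
  obtain D B b where mc: "markov_contraction \<mu> Pos (*v) D B B b ones"
    and dD: "\<And>x y. x \<in> Pos \<Longrightarrow> y \<in> Pos \<Longrightarrow> pgap x y \<le> D x y"
    using ex_markov_contraction[OF sc] by blast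
  interpret mk: markov_contraction \<mu> Pos "(*v)" D B B b ones by (rule mc)
  \<comment> \<open>The Lipschitz constant from \<open>sig_lip\<close>; it exceeds 1 and also
    dominates the size of the increment.\<close>
  define l where "l g = 2 + 4 * ln (Nmat g)" for g :: "real^'n^'n"
  have lnN: "0 \<le> ln (Nmat g)" if "g \<in> space \<mu>" for g
    using Nmat_ge_1[of g] that by (simp add: space_mu)
  have N3: "integrable \<mu> (\<lambda>g. ln (Nmat g) ^ 3)"
  proof (rule integrableI_bounded)
    show "(\<lambda>g. ln (Nmat g) ^ 3) \<in> borel_measurable \<mu>" unfolding measurable_mu by measurable
    have "(\<integral>\<^sup>+g. ennreal (norm (ln (Nmat g) ^ 3)) \<partial>\<mu>) = (\<integral>\<^sup>+g. ennreal (ln (Nmat g) powr 3) \<partial>\<mu>)"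
      by (rule nn_integral_cong) (simp add: lnN abs_of_nonneg)
    then show "(\<integral>\<^sup>+g. ennreal (norm (ln (Nmat g) ^ 3)) \<partial>\<mu>) < \<infinity>" using mom by (simp add: has_moment_def)
  qed
  have l3: "integrable \<mu> (\<lambda>g. l g ^ 3)"
  proof (rule Bochner_Integration.integrable_bound[where f="\<lambda>g. 32 + 256 * ln (Nmat g) ^ 3"])
    show "integrable \<mu> (\<lambda>g. 32 + 256 * ln (Nmat g) ^ 3)" using N3 by simp
    show "(\<lambda>g. l g ^ 3) \<in> borel_measurable \<mu>" unfolding measurable_mu l_def by measurable
    have "(2 + 4 * L) ^ 3 \<le> 32 + 256 * L ^ 3" if "0 \<le> L" for L :: real
    proof -
      \<comment> \<open>The identity \<open>4 * (x ^ 3 + y ^ 3) - (x + y) ^ 3 = 3 * (x + y) * (x -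
        y)\<^sup>2\<close> with \<open>x = 2\<close> and \<open>y = 4 * L\<close>.\<close>
      have "0 \<le> 3 * (2 + 4 * L) * (2 - 4 * L)\<^sup>2" using that by simp
      also have "\<dots> = 32 + 256 * L ^ 3 - (2 + 4 * L) ^ 3"
        by (simp add: power2_eq_square power3_eq_cube algebra_simps)
      finally show ?thesis by simp
    qed
    then show "AE g in \<mu>. norm (l g ^ 3) \<le> norm (32 + 256 * ln (Nmat g) ^ 3)"
      using lnN by (intro AE_I2) (simp add: l_def abs_of_nonneg)
  qed
  have sl: "\<bar>sig g x - sig g y\<bar> \<le> l g * D x y" if "g \<in> space \<mu>" "x \<in> Pos" "y \<in> Pos" for g x y
  proof -
    have "\<bar>sig g x - sig g y\<bar> \<le> l g * pgap x y"
      unfolding l_def using sig_lip[OF _ that(2,3)] that(1) by (simp add: space_mu)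
    also have "\<dots> \<le> l g * D x y"
      using dD[OF that(2,3)] lnN[OF that(1)] by (intro mult_left_mono) (auto simp: l_def)
    finally show ?thesis .
  qed
  have "\<exists>m \<psi> c d K. mk.lip c \<psi> \<and> (\<forall>x\<in>Pos. \<bar>\<psi> x\<bar> \<le> d) \<and>
    centered_cocycle \<mu> Pos (*v) D B B b ones (\<lambda>g x. sig g x - m + \<psi> (g *v x) - \<psi> x) (\<lambda>g. K * l g)"
  proof (rule mk.ex_centering)
    show "l \<in> borel_measurable \<mu>" unfolding measurable_mu l_def[abs_def] by measurable
    show "1 \<le> l g" if "g \<in> space \<mu>" for g using lnN[OF that] by (simp add: l_def)
    show "\<bar>sig g x\<bar> \<le> l g" if "g \<in> space \<mu>" "x \<in> Pos" for g and x :: "real^'n"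
      using abs_sig_le[of g x] lnN[OF that(1)] that by (simp add: l_def space_mu)
    show "(\<lambda>g. sig g x) \<in> borel_measurable \<mu>" for x :: "real^'n" unfolding measurable_mu by (rule sig_measurable)
  qed (use l3 sl in auto)
  then obtain m \<psi> c d K where res: "mk.lip c \<psi>" "\<And>x. x \<in> Pos \<Longrightarrow> \<bar>\<psi> x\<bar> \<le> d"
    "centered_cocycle \<mu> Pos (*v) D B B b ones (\<lambda>g x. sig g x - m + \<psi> (g *v x) - \<psi> x) (\<lambda>g. K * l g)"
    by blast
  have "matrix_cocycle \<mu> D B B b m \<psi> (\<lambda>g. K * l g) c d"
    by (intro matrix_cocycle.intro matrix_cocycle_axioms.intro res matrix_law_axioms)
  then show ?thesis by blast
qed

text \<open>The product of the earlier factors is a measurable function \<open>R n\<close> of the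
  coordinates in \<open>{1..n}\<close>, hence independent of \<open>Y (Suc n)\<close>. The joint law
  is then the product measure in the definition of \<open>conv_pow\<close>.\<close>

lemma rprod_law:
  assumes M: "prob_space M"
    and ind: "prob_space.indep_vars M (\<lambda>_. borel_G) Y {1..}"
    and law: "\<And>n. n \<ge> 1 \<Longrightarrow> distr M borel_G (Y n) = \<mu>"
  shows "rprod Y n \<in> measurable M borel_G \<and> distr M borel_G (rprod Y n) = cp n"
proof -
  interpret M: prob_space M by (rule M)
  have Ym: "Y i \<in> measurable M borel_G" if "i \<ge> 1" for i
    using ind that unfolding M.indep_vars_def2 by auto
  define R where "R n f = rprod (\<lambda>i f. f i) n f" for n and f :: "nat \<Rightarrow> real^'n^'n"
  have R: "R n (\<lambda>i\<in>{1..k}. Y i \<omega>) = rprod Y n \<omega>" if "n \<le> k" for n k \<omega>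
    using that by (induction n) (auto simp: R_def)
  have Rm: "R n \<in> measurable (PiM {1..k} (\<lambda>_. borel_G)) borel_G" if "n \<le> k" for n k
    using that
  proof (induction n)
    case 0
    show ?case by (simp add: R_def[abs_def] Gmat_one)
  next
    case (Suc n)
    then have "(\<lambda>f. f (Suc n) ** R n f) \<in> measurable (PiM {1..k} (\<lambda>_. borel_G)) borel_G"
      by (intro mult_measurable measurable_component_singleton) auto
    then show ?case by (simp add: R_def[abs_def])
  qed
  show ?thesis
  proof (induction n)
    case 0
    have "distr M borel_G (\<lambda>_. mat 1) = return borel_G (mat 1 :: real^'n^'n)"
      by (rule M.distr_const) (simp add: Gmat_one)
    moreover have "rprod Y 0 = (\<lambda>_. mat 1)" by (rule ext) simp
    ultimately show ?case by (simp add: Gmat_one)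
  next
    case (Suc n)
    have "M.indep_var (PiM {Suc n} (\<lambda>_. borel_G)) (\<lambda>\<omega>. \<lambda>i\<in>{Suc n}. Y i \<omega>) (PiM {1..n} (\<lambda>_. borel_G)) (\<lambda>\<omega>. \<lambda>i\<in>{1..n}. Y i \<omega>)"
      by (rule M.indep_var_restrict[OF ind]) auto
    then have "M.indep_var borel_G ((\<lambda>f. f (Suc n)) \<circ> (\<lambda>\<omega>. \<lambda>i\<in>{Suc n}. Y i \<omega>)) borel_G (R n \<circ> (\<lambda>\<omega>. \<lambda>i\<in>{1..n}. Y i \<omega>))"
      by (rule M.indep_var_compose[OF _ measurable_component_singleton Rm]) auto
    moreover have "(\<lambda>f. f (Suc n)) \<circ> (\<lambda>\<omega>. \<lambda>i\<in>{Suc n}. Y i \<omega>) = Y (Suc n)" by (rule ext) simp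
    moreover have "R n \<circ> (\<lambda>\<omega>. \<lambda>i\<in>{1..n}. Y i \<omega>) = rprod Y n" by (rule ext) (simp only: comp_def R order_refl)
    ultimately have "M.indep_var borel_G (Y (Suc n)) borel_G (rprod Y n)" by simp
    then have "distr M borel_G (Y (Suc n)) \<Otimes>\<^sub>M distr M borel_G (rprod Y n)
       = distr M (borel_G \<Otimes>\<^sub>M borel_G) (\<lambda>\<omega>. (Y (Suc n) \<omega>, rprod Y n \<omega>))"
      unfolding M.indep_var_distribution_eq by blast
    then have eq: "\<mu> \<Otimes>\<^sub>M cp n = distr M (borel_G \<Otimes>\<^sub>M borel_G) (\<lambda>\<omega>. (Y (Suc n) \<omega>, rprod Y n \<omega>))"
      using Suc law[of "Suc n"] by simp
    have m: "(\<lambda>\<omega>. (Y (Suc n) \<omega>, rprod Y n \<omega>)) \<in> measurable M (borel_G \<Otimes>\<^sub>M borel_G)"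
      using Suc Ym[of "Suc n"] by (intro measurable_Pair) auto
    have "cp (Suc n) = distr M borel_G ((\<lambda>(g, h). g ** h) \<circ> (\<lambda>\<omega>. (Y (Suc n) \<omega>, rprod Y n \<omega>)))"
      unfolding conv_pow.simps eq by (rule distr_distr[OF prod_meas m])
    moreover have "(\<lambda>(g, h). g ** h) \<circ> (\<lambda>\<omega>. (Y (Suc n) \<omega>, rprod Y n \<omega>)) = rprod Y (Suc n)" by (rule ext) simp
    moreover have "rprod Y (Suc n) = (\<lambda>\<omega>. Y (Suc n) \<omega> ** rprod Y n \<omega>)" by (rule ext) simp
    then have "rprod Y (Suc n) \<in> measurable M borel_G"
      using mult_measurable[OF Ym[of "Suc n"], of "rprod Y n"] Suc by simp
    ultimately show ?case by metis
  qed
qed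

text \<open>Markov's inequality: the threshold is the point where
  \<open>exp (\<delta> * z powr \<gamma>)\<close> equals \<open>n\<close>.\<close>

lemma Lmat_tail:
  assumes \<gamma>: "0 < \<gamma>" and \<delta>: "0 < \<delta>" and C: "0 \<le> C" "(\<integral>\<^sup>+h. exp_Lmat \<gamma> \<delta> h \<partial>cp n) \<le> ennreal C" and n: "n \<ge> 1"
  shows "measure (cp n) {h \<in> Gmat. ln (Lmat h) > (ln n / \<delta>) powr (1 / \<gamma>)} \<le> C / n"
proof -
  define S :: "(real ^ 'n ^ 'n) set" where "S = {h \<in> Gmat. ln (Lmat h) > (ln n / \<delta>) powr (1 / \<gamma>)}"
  have S: "S \<in> sets (cp n)"
  proof -
    have "{h \<in> space borel_G. ln (Lmat h) > (ln n / \<delta>) powr (1 / \<gamma>)} \<in> sets (borel_G :: (real^'n^'n) measure)"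
      by measurable
    then show ?thesis by (simp only: S_def sets_cp space_borel_G)
  qed
  have le: "ennreal n * indicator S h \<le> ennreal (exp_Lmat \<gamma> \<delta> h)" if "h \<in> space (cp n)" for h
  proof (cases "h \<in> S")
    case True
    have w: "0 \<le> ln n / \<delta>" using n \<delta> by simp
    have "q = (q powr (1 / \<gamma>)) powr \<gamma>" if "0 \<le> q" for q :: real
      using that \<gamma> by (simp add: powr_powr)
    then have "ln n / \<delta> = ((ln n / \<delta>) powr (1 / \<gamma>)) powr \<gamma>" using w by blast
    also have "\<dots> \<le> ln (Lmat h) powr \<gamma>" using True \<gamma> by (intro powr_mono2) (auto simp: S_def)
    finally have "ln n \<le> \<delta> * ln (Lmat h) powr \<gamma>" using \<delta> by (simp add: field_simps)
    then have "exp (ln (real n)) \<le> exp_Lmat \<gamma> \<delta> h" unfolding exp_Lmat_def by simp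
    then have "real n \<le> exp_Lmat \<gamma> \<delta> h" using n by simp
    then show ?thesis using True by (simp add: ennreal_leI flip: ennreal_of_nat_eq_real_of_nat)
  qed simp
  have "ennreal n * emeasure (cp n) S = (\<integral>\<^sup>+h. ennreal n * indicator S h \<partial>cp n)"
    using S by (simp add: nn_integral_cmult_indicator)
  also have "\<dots> \<le> (\<integral>\<^sup>+h. exp_Lmat \<gamma> \<delta> h \<partial>cp n)" by (intro nn_integral_mono le)
  also have "\<dots> \<le> ennreal C" by (rule C)
  finally have "ennreal (n * measure (cp n) S) \<le> ennreal C"
    by (simp add: cp.emeasure_eq_measure ennreal_mult)
  then have "n * measure (cp n) S \<le> C" using C by simp
  then have "measure (cp n) S \<le> C / n" using n by (simp add: field_simps)
  then show ?thesis by (simp only: S_def)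
qed

text \<open>Squares are dominated by the stretched exponential. The bound serves the mean-square
  comparison with the martingale, where \<open>d\<close> accommodates the bounded corrector.\<close>

lemma Lmat_second_moment:
  assumes \<gamma>: "0 < \<gamma>" and \<delta>: "0 < \<delta>" and C: "0 \<le> C" "\<And>n. (\<integral>\<^sup>+h. exp_Lmat \<gamma> \<delta> h \<partial>cp n) \<le> ennreal C" and d: "0 \<le> d"
  shows "\<exists>C2\<ge>0. \<forall>n. integrable (cp n) (\<lambda>h. (ln (Lmat h) + d)\<^sup>2) \<and> (\<integral>h. (ln (Lmat h) + d)\<^sup>2 \<partial>cp n) \<le> C2"
proof -
  obtain A where A: "0 \<le> A" "\<And>z. 0 \<le> z \<Longrightarrow> z\<^sup>2 \<le> A * exp (\<delta> * z powr \<gamma>)"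
    using sq_le_exp_powr[OF \<delta> \<gamma>] by blast
  define C2 where "C2 = 2 * A * C + 2 * d\<^sup>2"
  have C2: "0 \<le> C2" using A C by (simp add: C2_def)
  have "integrable (cp n) (\<lambda>h. (ln (Lmat h) + d)\<^sup>2) \<and> (\<integral>h. (ln (Lmat h) + d)\<^sup>2 \<partial>cp n) \<le> C2" for n
  proof -
    have b: "(\<integral>\<^sup>+h. ennreal ((ln (Lmat h) + d)\<^sup>2) \<partial>cp n) \<le> ennreal C2"
    proof -
      have "(\<integral>\<^sup>+h. ennreal ((ln (Lmat h) + d)\<^sup>2) \<partial>cp n) \<le> (\<integral>\<^sup>+h. ennreal (2 * A) * ennreal (exp_Lmat \<gamma> \<delta> h) + ennreal (2 * d\<^sup>2) \<partial>cp n)"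
      proof (rule nn_integral_mono)
        fix h assume "h \<in> space (cp n)"
        then have z: "0 \<le> ln (Lmat h)" using Lmat_ge_1[of h] by (simp add: space_cp)
        have "(ln (Lmat h) + d)\<^sup>2 \<le> 2 * (ln (Lmat h))\<^sup>2 + 2 * d\<^sup>2"
          using sum_squares_bound[of "ln (Lmat h)" d] by (simp add: power2_sum)
        also have "\<dots> \<le> 2 * A * exp_Lmat \<gamma> \<delta> h + 2 * d\<^sup>2" using A(2)[OF z] by (simp add: exp_Lmat_def)
        finally have "ennreal ((ln (Lmat h) + d)\<^sup>2) \<le> ennreal (2 * A * exp_Lmat \<gamma> \<delta> h + 2 * d\<^sup>2)" by (rule ennreal_leI)
        also have "\<dots> = ennreal (2 * A) * ennreal (exp_Lmat \<gamma> \<delta> h) + ennreal (2 * d\<^sup>2)"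
          using A(1) by (simp add: ennreal_plus ennreal_mult exp_Lmat_def)
        finally show "ennreal ((ln (Lmat h) + d)\<^sup>2) \<le> ennreal (2 * A) * ennreal (exp_Lmat \<gamma> \<delta> h) + ennreal (2 * d\<^sup>2)" .
      qed
      also have "\<dots> = ennreal (2 * A) * (\<integral>\<^sup>+h. exp_Lmat \<gamma> \<delta> h \<partial>cp n) + ennreal (2 * d\<^sup>2)"
        using exp_Lmat_measurable_cp[of \<gamma> \<delta> n] by (simp add: nn_integral_add nn_integral_cmult cp.emeasure_space_1)
      also have "\<dots> \<le> ennreal (2 * A) * ennreal C + ennreal (2 * d\<^sup>2)"
        by (intro add_right_mono mult_left_mono C) auto
      also have "\<dots> = ennreal C2" unfolding C2_def
        using A C by (subst ennreal_mult[symmetric]) (auto simp flip: ennreal_plus)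
      finally show ?thesis .
    qed
    have i: "integrable (cp n) (\<lambda>h. (ln (Lmat h) + d)\<^sup>2)"
    proof (rule integrableI_bounded)
      show "(\<lambda>h. (ln (Lmat h) + d)\<^sup>2) \<in> borel_measurable (cp n)" unfolding measurable_cp by measurable
      show "(\<integral>\<^sup>+h. ennreal (norm ((ln (Lmat h) + d)\<^sup>2)) \<partial>cp n) < \<infinity>"
        using le_less_trans[OF b, of \<infinity>] by simp
    qed
    moreover have "ennreal (\<integral>h. (ln (Lmat h) + d)\<^sup>2 \<partial>cp n) \<le> ennreal C2"
      using b nn_integral_eq_integral[OF i] by simp
    ultimately show ?thesis using C2 by simp
  qed
  then show ?thesis using C2 by blast
qed

end

context matrix_cocycle
begin

text \<open>\<open>Z\<close> and \<open>sig h ones\<close> lie in the same interval of length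
  \<open>ln (Lmat h)\<close>, and the two values of \<psi> add at most \<open>2 * b\<close>.\<close>

lemma mart_close:
  assumes h: "h \<in> Gmat" and Z: "ln (vmin h) \<le> Z" "Z \<le> ln (l1_onorm h)"
  shows "\<bar>Z - n * m - mart n h\<bar> \<le> ln (Lmat h) + 2 * b"
proof -
  have "ln (Lmat h) = ln (l1_onorm h) - ln (vmin h)"
    using onorm_pos[OF h] vmin_pos[OF h] by (simp add: Lmat_def ln_div)
  then have "\<bar>Z - sig h ones\<bar> \<le> ln (Lmat h)" using sig_bounds[OF h ones_Pos] Z by simp
  then show ?thesis
    using psi_bdd[OF ones_Pos] psi_bdd[OF h_ones[OF h]] by (simp add: mart_def)
qed

lemma b_nonneg: "0 \<le> b"
  using psi_bdd[OF ones_Pos] by (rule order_trans[OF abs_ge_zero])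

lemma mart_berry_esseen:
  assumes s2: "s2 > 0"
  shows "\<exists>K\<ge>0. \<forall>n\<ge>2. \<forall>x. \<bar>measure (cp n) {h \<in> Gmat. mart n h \<le> x * sqrt n} - cdf stdN (x / sqrt s2)\<bar> \<le> K * ln n / sqrt n"
proof -
  obtain c0 C where c0: "c0 > 0" and C: "C \<ge> 0" and ch: "\<And>\<theta> n. \<bar>\<theta>\<bar> \<le> c0 \<Longrightarrow>
    cmod ((\<integral>h. iexp (\<theta> * mart n h) \<partial>cp n) - of_real (exp (- s2 * \<theta>\<^sup>2 * n / 2)))
      \<le> C * (\<theta>\<^sup>2 + n * \<bar>\<theta>\<bar> ^ 3) * exp (- s2 * \<theta>\<^sup>2 * n / 4)"
    using mart_char[OF s2] by blast
  define N where "N n = distr (cp n) borel (\<lambda>h. mart n h / sqrt n)" for n :: nat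
  have Nm: "(\<lambda>h. mart n h / sqrt n) \<in> borel_measurable (cp n)" for n :: nat
    unfolding measurable_cp by measurable
  have ss: "(sqrt s2)\<^sup>2 = s2" using s2 by simp
  have "\<exists>K. \<forall>n\<ge>2. \<forall>x. \<bar>cdf (N n) x - cdf stdN (x / sqrt s2)\<bar> \<le> K * ln n / sqrt n"
  proof (rule berry_esseen_rate[OF _ _ c0 C])
    show "real_distribution (N n)" for n unfolding N_def by (rule cp.real_distribution_distr[OF Nm])
    show "0 < sqrt s2" using s2 by simp
    fix n :: nat and t :: real assume n: "n \<ge> 1" and t: "\<bar>t\<bar> \<le> c0 * sqrt n"
    define \<theta> where "\<theta> = t / sqrt n"
    have sn: "0 < sqrt n" using n by simp
    have \<theta>: "\<bar>\<theta>\<bar> \<le> c0" using t sn by (simp add: \<theta>_def abs_div_pos[symmetric] pos_divide_le_eq del: real_sqrt_gt_0_iff)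
    have \<theta>2: "\<theta>\<^sup>2 = t\<^sup>2 / n" using n by (simp add: \<theta>_def power_divide)
    have \<theta>3: "n * \<bar>\<theta>\<bar> ^ 3 = \<bar>t\<bar> ^ 3 / sqrt n"
      using n by (simp add: \<theta>_def abs_div_pos[symmetric] power_divide power3_eq_cube field_simps)
    have "char (N n) t = (\<integral>h. iexp (\<theta> * mart n h) \<partial>cp n)"
      unfolding char_def N_def \<theta>_def by (subst integral_distr[OF Nm]) auto
    moreover have "s2 * \<theta>\<^sup>2 * n = s2 * t\<^sup>2" using n by (simp add: \<theta>2)
    ultimately show "cmod (char (N n) t - of_real (exp (- (sqrt s2 * t)\<^sup>2 / 2)))
      \<le> C * (t\<^sup>2 / n + \<bar>t\<bar> ^ 3 / sqrt n) * exp (- ((sqrt s2)\<^sup>2 / 4) * t\<^sup>2)"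
      using ch[OF \<theta>, of n] unfolding \<theta>3 unfolding \<theta>2 power_mult_distrib ss using n by simp
  qed
  then obtain K where K: "\<And>n x. n \<ge> 2 \<Longrightarrow> \<bar>cdf (N n) x - cdf stdN (x / sqrt s2)\<bar> \<le> K * ln n / sqrt n" by blast
  have "\<bar>measure (cp n) {h \<in> Gmat. mart n h \<le> x * sqrt n} - cdf stdN (x / sqrt s2)\<bar> \<le> max 0 K * ln n / sqrt n"
    if n: "n \<ge> 2" for n :: nat and x
  proof -
    have "(\<lambda>h. mart n h / sqrt n) -` {..x} \<inter> space (cp n) = {h \<in> Gmat. mart n h \<le> x * sqrt n}"
      using n by (auto simp: space_cp pos_divide_le_eq)
    then have "cdf (N n) x = measure (cp n) {h \<in> Gmat. mart n h \<le> x * sqrt n}"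
      unfolding cdf_def N_def by (subst measure_distr[OF Nm]) auto
    moreover have "K * ln n / sqrt n \<le> max 0 K * ln n / sqrt n"
      using n by (intro divide_right_mono mult_right_mono) auto
    ultimately show ?thesis using K[OF n, of x] by simp
  qed
  then show ?thesis by (intro exI[of _ "max 0 K"]) auto
qed

text \<open>Off the event \<open>S\<close> of large distortion, \<open>Z\<close> differs from the
  martingale by at most \<open>w\<close>, so its event is sandwiched between two shifted events for
  \<open>mart\<close>. The constant is chosen before \<open>Z\<close>, so one bound serves
  \<open>vmin\<close> and \<open>kappa\<close>.\<close>

theorem kolmogorov_bound:
  assumes s2: "s2 > 0" and \<gamma>: "0 < \<gamma>" "\<gamma> \<le> 1" and \<delta>: "0 < \<delta>" and C: "0 \<le> C" "\<And>n. (\<integral>\<^sup>+h. exp_Lmat \<gamma> \<delta> h \<partial>cp n) \<le> ennreal C"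
  shows "\<exists>K. \<forall>Z. Z \<in> borel_measurable borel_G \<longrightarrow> (\<forall>h\<in>Gmat. ln (vmin h) \<le> Z h \<and> Z h \<le> ln (l1_onorm h)) \<longrightarrow>
    (\<forall>n\<ge>3. \<forall>t. \<bar>measure (cp n) {h \<in> Gmat. Z h - n * m \<le> t * sqrt n} - cdf stdN (t / sqrt s2)\<bar>
      \<le> K * (ln n powr (1 / \<gamma>) / sqrt n))"
proof -
  obtain K1 where K1: "K1 \<ge> 0" "\<And>n x. n \<ge> 2 \<Longrightarrow>
      \<bar>measure (cp n) {h \<in> Gmat. mart n h \<le> x * sqrt n} - cdf stdN (x / sqrt s2)\<bar> \<le> K1 * ln n / sqrt n"
    using mart_berry_esseen[OF s2] by blast
  \<comment> \<open>The threshold \<open>(ln n / \<delta>) powr (1 / \<gamma>)\<close> is a constant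
    times \<open>ln n powr (1 / \<gamma>)\<close>; the corrector bound \<open>2 * b\<close> is
    absorbed because that power is at least 1.\<close>
  define A where "A = (1 / \<delta>) powr (1 / \<gamma>) + 2 * b"
  define K where "K = A / sqrt s2 + K1 + C"
  have "\<bar>measure (cp n) {h \<in> Gmat. Z h - n * m \<le> t * sqrt n} - cdf stdN (t / sqrt s2)\<bar> \<le> K * (ln n powr (1 / \<gamma>) / sqrt n)"
    if Z: "Z \<in> borel_measurable borel_G" "\<And>h. h \<in> Gmat \<Longrightarrow> ln (vmin h) \<le> Z h \<and> Z h \<le> ln (l1_onorm h)" and n: "n \<ge> 3" for Z n t
  proof -
    define L where "L = ln n powr (1 / \<gamma>)"
    \<comment> \<open>From \<open>n \<ge> 3\<close> on, \<open>ln n \<ge> 1\<close>, and therefore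
      \<open>ln n \<le> ln n powr (1 / \<gamma>)\<close>: the smoothing error fits into the claimed
      rate.\<close>
    have "exp 1 \<le> real n" using n exp_le by (simp add: order_trans[of _ 3])
    then have ln1: "1 \<le> ln n" using n by (subst ln_ge_iff) auto
    have g1: "1 \<le> 1 / \<gamma>" using \<gamma> by simp
    have L: "1 \<le> L" "ln n \<le> L"
    proof -
      have "ln n powr 1 \<le> ln n powr (1 / \<gamma>)" using ln1 g1 by (intro powr_mono) auto
      then show "ln n \<le> L" using ln1 by (simp add: L_def)
      then show "1 \<le> L" using ln1 by simp
    qed
    have sn: "0 < sqrt n" "sqrt n \<le> n" using n by (auto intro!: real_le_lsqrt simp: power2_eq_square)
    define w where "w = (ln n / \<delta>) powr (1 / \<gamma>) + 2 * b"
    have w: "w \<le> A * L" "0 \<le> w"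
    proof -
      have "(ln n / \<delta>) powr (1 / \<gamma>) = L * (1 / \<delta>) powr (1 / \<gamma>)"
        using ln1 \<delta> unfolding L_def by (subst powr_mult[symmetric]) auto
      moreover have "2 * b * 1 \<le> 2 * b * L" using b_nonneg L by (intro mult_left_mono) auto
      ultimately show "w \<le> A * L" by (simp add: w_def A_def algebra_simps)
      show "0 \<le> w" using b_nonneg by (simp add: w_def)
    qed
    define S :: "(real ^ 'n ^ 'n) set" where "S = {h \<in> Gmat. ln (Lmat h) > (ln n / \<delta>) powr (1 / \<gamma>)}"
    have S: "measure (cp n) S \<le> C / n"
      unfolding S_def by (rule Lmat_tail[OF \<gamma>(1) \<delta> C(1) C(2)]) (use n in simp)
    have sets: "{h \<in> Gmat. f h} \<in> sets (cp n)" if "Measurable.pred borel_G f" for f :: "real ^ 'n ^ 'n \<Rightarrow> bool"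
      using that unfolding pred_def by (simp only: sets_cp space_borel_G)
    have S_sets: "S \<in> sets (cp n)" unfolding S_def by (rule sets) measurable
    have Z_sets: "{h \<in> Gmat. Z h - n * m \<le> y} \<in> sets (cp n)" for y by (rule sets) (use Z(1) in measurable)
    have M_sets: "{h \<in> Gmat. mart n h \<le> y} \<in> sets (cp n)" for y by (rule sets) measurable
    have close: "\<bar>Z h - n * m - mart n h\<bar> \<le> w" if "h \<in> Gmat" "h \<notin> S" for h :: "real ^ 'n ^ 'n"
      using mart_close[OF that(1), of "Z h" n] Z(2)[OF that(1)] that by (simp add: S_def w_def)
    have lip: "cdf stdN ((t + u) / sqrt s2) \<le> cdf stdN (t / sqrt s2) + u / sqrt s2" if "0 \<le> u" for t u
      using cdf_stdN_lipschitz[of "t / sqrt s2" "(t + u) / sqrt s2"] that s2 by (simp add: divide_right_mono add_divide_distrib)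
    let ?u = "w / sqrt n"
    have uw: "(t + ?u) * sqrt n = t * sqrt n + w" "(t - ?u) * sqrt n = t * sqrt n - w"
      using n by (simp_all add: distrib_right left_diff_distrib)
    have err: "?u / sqrt s2 + K1 * ln n / sqrt n + C / n \<le> K * (L / sqrt n)"
    proof -
      have "?u / sqrt s2 \<le> A * L / sqrt n / sqrt s2" using w sn s2 by (intro divide_right_mono) auto
      moreover have "K1 * ln n / sqrt n \<le> K1 * L / sqrt n" using L K1 sn by (intro divide_right_mono mult_left_mono) auto
      moreover have "C / n \<le> C * L / sqrt n"
      proof -
        have "C / n \<le> C / sqrt n" using sn C n by (intro divide_left_mono) auto
        also have "\<dots> \<le> C * L / sqrt n" using L C sn mult_left_mono[of 1 L C] by (intro divide_right_mono) auto
        finally show ?thesis .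
      qed
      moreover have "K * (L / sqrt n) = A * L / sqrt n / sqrt s2 + K1 * L / sqrt n + C * L / sqrt n"
        by (simp add: K_def distrib_right add_divide_distrib mult.commute[of "sqrt s2"])
      ultimately show ?thesis by linarith
    qed
    have up: "measure (cp n) {h \<in> Gmat. Z h - n * m \<le> t * sqrt n} \<le> cdf stdN (t / sqrt s2) + K * (L / sqrt n)"
    proof -
      have "measure (cp n) {h \<in> Gmat. Z h - n * m \<le> t * sqrt n} \<le> measure (cp n) ({h \<in> Gmat. mart n h \<le> (t + ?u) * sqrt n} \<union> S)"
      proof (rule cp.finite_measure_mono)
        show "{h \<in> Gmat. Z h - n * m \<le> t * sqrt n} \<subseteq> {h \<in> Gmat. mart n h \<le> (t + ?u) * sqrt n} \<union> S"
        proof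
          fix h assume "h \<in> {h \<in> Gmat. Z h - n * m \<le> t * sqrt n}"
          then show "h \<in> {h \<in> Gmat. mart n h \<le> (t + ?u) * sqrt n} \<union> S"
            unfolding uw using close[of h] by (cases "h \<in> S") (auto simp: abs_le_iff)
        qed
        show "{h \<in> Gmat. mart n h \<le> (t + ?u) * sqrt n} \<union> S \<in> cp.events n"
          by (rule sets.Un[OF M_sets S_sets])
      qed
      also have "\<dots> \<le> measure (cp n) {h \<in> Gmat. mart n h \<le> (t + ?u) * sqrt n} + measure (cp n) S"
        by (rule measure_Un_le[OF M_sets S_sets])
      also have "measure (cp n) {h \<in> Gmat. mart n h \<le> (t + ?u) * sqrt n} \<le> cdf stdN ((t + ?u) / sqrt s2) + K1 * ln n / sqrt n"
        using K1(2)[of n "t + ?u"] n by (simp add: abs_le_iff)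
      also have "cdf stdN ((t + ?u) / sqrt s2) \<le> cdf stdN (t / sqrt s2) + ?u / sqrt s2"
        by (rule lip) (use w in simp)
      finally show ?thesis using S err by simp
    qed
    have "cdf stdN (t / sqrt s2) - K * (L / sqrt n) \<le> measure (cp n) {h \<in> Gmat. Z h - n * m \<le> t * sqrt n}"
    proof -
      have "cdf stdN (t / sqrt s2) \<le> cdf stdN ((t - ?u) / sqrt s2) + ?u / sqrt s2"
        using lip[of ?u "t - ?u"] w by simp
      also have "cdf stdN ((t - ?u) / sqrt s2) \<le> measure (cp n) {h \<in> Gmat. mart n h \<le> (t - ?u) * sqrt n} + K1 * ln n / sqrt n"
        using K1(2)[of n "t - ?u"] n by (simp add: abs_le_iff)
      also have "measure (cp n) {h \<in> Gmat. mart n h \<le> (t - ?u) * sqrt n} \<le> measure (cp n) ({h \<in> Gmat. Z h - n * m \<le> t * sqrt n} \<union> S)"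
      proof (rule cp.finite_measure_mono)
        show "{h \<in> Gmat. mart n h \<le> (t - ?u) * sqrt n} \<subseteq> {h \<in> Gmat. Z h - n * m \<le> t * sqrt n} \<union> S"
        proof
          fix h assume "h \<in> {h \<in> Gmat. mart n h \<le> (t - ?u) * sqrt n}"
          then show "h \<in> {h \<in> Gmat. Z h - n * m \<le> t * sqrt n} \<union> S"
            unfolding uw using close[of h] by (cases "h \<in> S") (auto simp: abs_le_iff)
        qed
        show "{h \<in> Gmat. Z h - n * m \<le> t * sqrt n} \<union> S \<in> cp.events n"
          by (rule sets.Un[OF Z_sets S_sets])
      qed
      also have "\<dots> \<le> measure (cp n) {h \<in> Gmat. Z h - n * m \<le> t * sqrt n} + measure (cp n) S"
        by (rule measure_Un_le[OF Z_sets S_sets])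
      finally show ?thesis using S err by simp
    qed
    then show ?thesis using up by (simp add: L_def abs_le_iff)
  qed
  then show ?thesis by blast
qed

end

section \<open>Identification of the Lyapunov exponent and of the variance\<close>

lemma tendsto_const_div_sqrt: "(\<lambda>n. C / sqrt (real n)) \<longlonglongrightarrow> 0"
  by (intro tendsto_divide_0[OF tendsto_const] filterlim_at_top_imp_at_infinity
      filterlim_compose[OF sqrt_at_top filterlim_real_sequentially])

context matrix_cocycle
begin

abbreviation "rem h \<equiv> ln (Lmat h) + 2 * b"

lemma transfer_integrable:
  fixes f :: "_ \<Rightarrow> real"
  assumes A: "A \<in> measurable M borel_G" "distr M borel_G A = cp n" and f: "integrable (cp n) f" "f \<in> borel_measurable borel_G"
  shows "integrable M (\<lambda>\<omega>. f (A \<omega>))" "(\<integral>\<omega>. f (A \<omega>) \<partial>M) = (\<integral>h. f h \<partial>cp n)"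
  using integrable_distr_eq[OF A(1) f(2)] integral_distr[OF A(1) f(2)] f(1) A(2) by simp_all

text \<open>With \<open>T\<close> the martingale and \<open>R\<close> the remainder,
  \<open>\<bar>U\<^sup>2 - T\<^sup>2\<bar> \<le> R\<^sup>2 + 2 * R * \<bar>T\<bar>\<close>, and the
  mixed term is split with weight \<open>q = sqrt n\<close>. The bounded moment of \<open>R\<close>
  is multiplied by \<open>q\<close> and the moment of \<open>T\<close>, of order \<open>n\<close>,
  divided by it, so the second moments differ by \<open>O(sqrt n)\<close>.\<close>

lemma second_moment_limit:
  assumes M: "prob_space M" and A: "\<And>n. A n \<in> measurable M borel_G" "\<And>n. distr M borel_G (A n) = cp n"
    and C2: "\<And>n. integrable (cp n) (\<lambda>h. (rem h)\<^sup>2)" "\<And>n. (\<integral>h. (rem h)\<^sup>2 \<partial>cp n) \<le> C2"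
    and Um: "\<And>n. U n \<in> borel_measurable M"
    and U_close: "\<And>n \<omega>. \<omega> \<in> space M \<Longrightarrow> \<bar>U n \<omega> - mart n (A n \<omega>)\<bar> \<le> rem (A n \<omega>)"
  shows "\<And>n. n > 0 \<Longrightarrow> integrable M (\<lambda>\<omega>. (U n \<omega>)\<^sup>2)"
    and "(\<lambda>n. (\<integral>\<omega>. (U n \<omega>)\<^sup>2 \<partial>M) / real n) \<longlonglongrightarrow> s2"
proof -
  interpret M: prob_space M by (rule M)
  define Q0 where "Q0 = 2 * C2 + s2 + 2 * (2 * K 2 * B / (1 - a))"
  have main: "integrable M (\<lambda>\<omega>. (U n \<omega>)\<^sup>2) \<and> norm ((\<integral>\<omega>. (U n \<omega>)\<^sup>2 \<partial>M) / real n - s2) \<le> Q0 / sqrt n"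
    if n: "0 < n" for n
  proof -
    define q where "q = sqrt n"
    have q: "1 \<le> q" "q * q = n" using n by (auto simp: q_def)
    define K0 where "K0 = 2 * K 2 * B / (1 - a)"
    define I where "I = (\<integral>h. (mart n h)\<^sup>2 \<partial>cp n)"
    define J where "J = (\<integral>h. (rem h)\<^sup>2 \<partial>cp n)"
    have mi: "integrable M (\<lambda>\<omega>. (mart n (A n \<omega>))\<^sup>2)" "(\<integral>\<omega>. (mart n (A n \<omega>))\<^sup>2 \<partial>M) = I"
      unfolding I_def by (rule transfer_integrable[OF A]; use mart_sq[of n] in simp)+
    have ri: "integrable M (\<lambda>\<omega>. (rem (A n \<omega>))\<^sup>2)" "(\<integral>\<omega>. (rem (A n \<omega>))\<^sup>2 \<partial>M) = J"
      unfolding J_def by (rule transfer_integrable[OF A C2(1)], measurable)+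
    have pw: "\<bar>(U n \<omega>)\<^sup>2 - (mart n (A n \<omega>))\<^sup>2\<bar> \<le> (1 + q) * (rem (A n \<omega>))\<^sup>2 + (mart n (A n \<omega>))\<^sup>2 / q"
      if \<omega>: "\<omega> \<in> space M" for \<omega>
    proof -
      let ?R = "rem (A n \<omega>)" and ?T = "mart n (A n \<omega>)" and ?u = "U n \<omega>"
      have c: "\<bar>?u - ?T\<bar> \<le> ?R" by (rule U_close[OF \<omega>])
      have R: "0 \<le> ?R" using c by simp
      have "\<bar>?u\<^sup>2 - ?T\<^sup>2\<bar> = \<bar>?u - ?T\<bar> * \<bar>?u + ?T\<bar>"
        by (simp add: power2_eq_square algebra_simps flip: abs_mult)
      also have "\<dots> \<le> ?R * (?R + 2 * \<bar>?T\<bar>)" using c R by (intro mult_mono) auto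
      also have "\<dots> = ?R\<^sup>2 + 2 * ?R * \<bar>?T\<bar>" by (simp add: power2_eq_square algebra_simps)
      also have "2 * ?R * \<bar>?T\<bar> \<le> q * ?R\<^sup>2 + ?T\<^sup>2 / q"
      proof -
        have "2 * r * t \<le> q * r\<^sup>2 + t\<^sup>2 / q" for r t :: real
        proof -
          have "0 \<le> (q * r - t)\<^sup>2 / q" using q by simp
          also have "\<dots> = q * r\<^sup>2 + t\<^sup>2 / q - 2 * r * t"
            using q(1) by (simp add: power2_eq_square field_simps)
          finally show ?thesis by simp
        qed
        from this[of ?R "\<bar>?T\<bar>"] show ?thesis by simp
      qed
      finally show ?thesis by (simp add: algebra_simps)
    qed
    have dom: "integrable M (\<lambda>\<omega>. (1 + q) * (rem (A n \<omega>))\<^sup>2 + (mart n (A n \<omega>))\<^sup>2 / q)"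
      using mi ri by simp
    have di: "integrable M (\<lambda>\<omega>. (U n \<omega>)\<^sup>2 - (mart n (A n \<omega>))\<^sup>2)"
    proof (rule Bochner_Integration.integrable_bound[OF dom])
      show "(\<lambda>\<omega>. (U n \<omega>)\<^sup>2 - (mart n (A n \<omega>))\<^sup>2) \<in> borel_measurable M"
        using Um measurable_compose[OF A(1) mart_meas] by measurable
      show "AE \<omega> in M. norm ((U n \<omega>)\<^sup>2 - (mart n (A n \<omega>))\<^sup>2) \<le> norm ((1 + q) * (rem (A n \<omega>))\<^sup>2 + (mart n (A n \<omega>))\<^sup>2 / q)"
        by (intro AE_I2) (use pw in \<open>auto intro: order_trans[OF _ abs_ge_self]\<close>)
    qed
    then have ui: "integrable M (\<lambda>\<omega>. (U n \<omega>)\<^sup>2)"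
      using Bochner_Integration.integrable_add[OF di mi(1)] by simp
    have "\<bar>(\<integral>\<omega>. (U n \<omega>)\<^sup>2 \<partial>M) - I\<bar> = norm (\<integral>\<omega>. (U n \<omega>)\<^sup>2 - (mart n (A n \<omega>))\<^sup>2 \<partial>M)"
      using ui mi by simp
    also have "\<dots> \<le> (\<integral>\<omega>. (1 + q) * (rem (A n \<omega>))\<^sup>2 + (mart n (A n \<omega>))\<^sup>2 / q \<partial>M)"
      by (rule order_trans[OF integral_norm_bound]) (intro integral_mono integrable_norm di dom, use pw in simp)
    also have "\<dots> = (1 + q) * J + I / q" using mi ri by simp
    finally have d1: "\<bar>(\<integral>\<omega>. (U n \<omega>)\<^sup>2 \<partial>M) - I\<bar> \<le> (1 + q) * J + I / q" .
    have J: "J \<le> C2" "0 \<le> J" unfolding J_def using C2(2)[of n] by simp_all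
    have K0: "0 \<le> K0" unfolding K0_def using K_nonneg[of 2] B_nonneg a by simp
    have I: "\<bar>I - n * s2\<bar> \<le> K0" unfolding I_def K0_def by (rule mart_variance)
    have "(1 + q) * J \<le> (q + q) * C2" using q J by (intro mult_mono) auto
    moreover have "I / q \<le> (n * s2 + K0) / q" using I q by (intro divide_right_mono) (auto simp: abs_le_iff)
    moreover have "(n * s2 + K0) / q = q * s2 + K0 / q" using q by (simp add: add_divide_distrib flip: q(2))
    moreover have "K0 / q \<le> q * K0" "K0 \<le> q * K0"
    proof -
      show k: "K0 \<le> q * K0" using mult_right_mono[OF q(1) K0] by simp
      have "K0 / q \<le> K0 / 1" using q K0 by (intro divide_left_mono) auto
      then show "K0 / q \<le> q * K0" using k by simp
    qed
    ultimately have "\<bar>(\<integral>\<omega>. (U n \<omega>)\<^sup>2 \<partial>M) - n * s2\<bar> \<le> q * Q0"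
      using d1 I unfolding Q0_def K0_def[symmetric] by (simp add: distrib_left distrib_right abs_le_iff)
    then have "\<bar>(\<integral>\<omega>. (U n \<omega>)\<^sup>2 \<partial>M) - n * s2\<bar> / n \<le> q * Q0 / n" by (intro divide_right_mono) auto
    moreover have "\<bar>(\<integral>\<omega>. (U n \<omega>)\<^sup>2 \<partial>M) - n * s2\<bar> / n = \<bar>(\<integral>\<omega>. (U n \<omega>)\<^sup>2 \<partial>M) / n - s2\<bar>"
    proof -
      have "(\<integral>\<omega>. (U n \<omega>)\<^sup>2 \<partial>M) / n - s2 = ((\<integral>\<omega>. (U n \<omega>)\<^sup>2 \<partial>M) - n * s2) / n"
        using n by (simp add: diff_divide_distrib)
      then show ?thesis by (simp only: abs_divide abs_of_nat)
    qed
    moreover have "q * Q0 / n = Q0 / sqrt n" using q by (simp add: q_def[symmetric] flip: q(2))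
    ultimately show ?thesis using ui by simp
  qed
  show "integrable M (\<lambda>\<omega>. (U n \<omega>)\<^sup>2)" if "n > 0" for n using main[OF that] ..
  have "(\<lambda>n. (\<integral>\<omega>. (U n \<omega>)\<^sup>2 \<partial>M) / real n - s2) \<longlonglongrightarrow> 0"
    by (rule Lim_null_comparison[OF eventually_mono[OF eventually_gt_at_top[of 0]] tendsto_const_div_sqrt[of Q0]])
       (use main in blast)
  then show "(\<lambda>n. (\<integral>\<omega>. (U n \<omega>)\<^sup>2 \<partial>M) / real n) \<longlonglongrightarrow> s2" by (rule LIM_zero_cancel)
qed

text \<open>The mean-square limit of the normalised logarithms is \<open>m\<close>, the almost sure
  limit is \<open>lam\<close>. Truncation at 1 makes dominated convergence applicable, and both
  limits are read off from the same bounded integrals.\<close>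

lemma lyapunov_exponent_eq:
  assumes M: "prob_space M" and A: "\<And>n. A n \<in> measurable M borel_G" "\<And>n. distr M borel_G (A n) = cp n"
    and C2: "\<And>n. integrable (cp n) (\<lambda>h. (rem h)\<^sup>2)" "\<And>n. (\<integral>h. (rem h)\<^sup>2 \<partial>cp n) \<le> C2"
    and lim: "AE \<omega> in M. (\<lambda>n. ln (l1_onorm (A n \<omega>)) / real n) \<longlonglongrightarrow> lam"
  shows "m = lam"
proof -
  interpret M: prob_space M by (rule M)
  define U where "U n \<omega> = ln (l1_onorm (A n \<omega>)) - real n * m" for n \<omega>
  define f where "f n \<omega> = min 1 ((U n \<omega> / n)\<^sup>2)" for n \<omega>
  have AG: "A n \<omega> \<in> Gmat" if "\<omega> \<in> space M" for n \<omega> using measurable_space[OF A(1) that] by simp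
  have Um: "U n \<in> borel_measurable M" for n
    unfolding U_def using measurable_compose[OF A(1) onorm_measurable] by measurable
  have fm: "f n \<in> borel_measurable M" for n unfolding f_def using Um by measurable
  have close: "\<bar>U n \<omega> - mart n (A n \<omega>)\<bar> \<le> rem (A n \<omega>)" if "\<omega> \<in> space M" for n \<omega>
    unfolding U_def using AG[OF that, of n] by (intro mart_close) (auto intro!: ln_mono vmin_le_onorm vmin_pos)
  have U1: "integrable M (\<lambda>\<omega>. (U n \<omega>)\<^sup>2)" if "n > 0" for n
    by (rule second_moment_limit(1)[OF M A C2 Um close that])
  have U2: "(\<lambda>n. (\<integral>\<omega>. (U n \<omega>)\<^sup>2 \<partial>M) / real n) \<longlonglongrightarrow> s2"
    by (rule second_moment_limit(2)[OF M A C2 Um close])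
  have "(\<lambda>n. \<integral>\<omega>. f n \<omega> \<partial>M) \<longlonglongrightarrow> (\<integral>\<omega>. min 1 ((lam - m)\<^sup>2) \<partial>M)"
  proof (rule integral_dominated_convergence[where w="\<lambda>_. 1"])
    show "AE \<omega> in M. (\<lambda>n. f n \<omega>) \<longlonglongrightarrow> min 1 ((lam - m)\<^sup>2)"
      using lim
    proof eventually_elim
      case (elim \<omega>)
      then have "(\<lambda>n. min 1 ((ln (l1_onorm (A n \<omega>)) / real n - m)\<^sup>2)) \<longlonglongrightarrow> min 1 ((lam - m)\<^sup>2)"
        by (intro tendsto_intros)
      then show ?case
        by (rule Lim_transform_eventually[OF _ eventually_mono[OF eventually_gt_at_top[of 0]]])
           (simp add: f_def U_def diff_divide_distrib)
    qed
  qed (auto simp: fm, auto simp: f_def)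
  moreover have "(\<lambda>n. \<integral>\<omega>. f n \<omega> \<partial>M) \<longlonglongrightarrow> 0"
  proof (rule Lim_null_comparison)
    show "(\<lambda>n. (\<integral>\<omega>. (U n \<omega>)\<^sup>2 \<partial>M) / real n * (1 / real n)) \<longlonglongrightarrow> 0"
      using tendsto_mult[OF U2 lim_1_over_n] by simp
    show "\<forall>\<^sub>F n in sequentially. norm (\<integral>\<omega>. f n \<omega> \<partial>M) \<le> (\<integral>\<omega>. (U n \<omega>)\<^sup>2 \<partial>M) / real n * (1 / real n)"
      using eventually_gt_at_top[of "0::nat"]
    proof eventually_elim
      case (elim n)
      have "(\<integral>\<omega>. f n \<omega> \<partial>M) \<le> (\<integral>\<omega>. (U n \<omega>)\<^sup>2 / n\<^sup>2 \<partial>M)"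
      proof (rule integral_mono)
        show "integrable M (f n)" by (rule M.integrable_const_bound[where B=1]) (auto simp: fm, auto simp: f_def)
      qed (use U1[OF elim] in \<open>auto simp: f_def power_divide\<close>)
      then show ?case by (simp add: power2_eq_square f_def abs_of_nonneg)
    qed
  qed
  ultimately have "(\<integral>\<omega>. min 1 ((lam - m)\<^sup>2) \<partial>M) = 0" by (rule LIMSEQ_unique)
  then have "min 1 ((lam - m)\<^sup>2) = 0" by (simp add: M.prob_space)
  then show ?thesis by (simp add: min_def split: if_splits)
qed

text \<open>A starting vector in the simplex has norm 1, so its cocycle lies between the logarithms
  of \<open>vmin\<close> and of the norm of the product for every outcome. It therefore stays within
  \<open>rem\<close> of the martingale.\<close>

lemma asymptotic_variance_eq:
  assumes M: "prob_space M" and A: "\<And>n. A n \<in> measurable M borel_G" "\<And>n. distr M borel_G (A n) = cp n"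
    and C2: "\<And>n. integrable (cp n) (\<lambda>h. (rem h)\<^sup>2)" "\<And>n. (\<integral>h. (rem h)\<^sup>2 \<partial>cp n) \<le> C2"
    and W: "\<And>j. (\<lambda>\<omega>. W \<omega> $ j) \<in> borel_measurable M" "\<And>\<omega>. \<omega> \<in> space M \<Longrightarrow> W \<omega> \<in> Splus"
    and lim: "(\<lambda>n. (\<integral>\<omega>. (cocycle (A n \<omega>) (W \<omega>) - real n * m)\<^sup>2 \<partial>M) / real n) \<longlonglongrightarrow> v"
  shows "v = s2"
proof -
  interpret M: prob_space M by (rule M)
  have AG: "A n \<omega> \<in> Gmat" if "\<omega> \<in> space M" for n \<omega> using measurable_space[OF A(1) that] by simp
  define U where "U n \<omega> = cocycle (A n \<omega>) (W \<omega>) - real n * m" for n \<omega>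
  have Um: "U n \<in> borel_measurable M" for n
    unfolding U_def cocycle_def
    by (intro borel_measurable_diff borel_measurable_ln l1norm_measurable mv_measurable A W(1) borel_measurable_const)
  have U_close: "\<bar>U n \<omega> - mart n (A n \<omega>)\<bar> \<le> rem (A n \<omega>)" if \<omega>: "\<omega> \<in> space M" for n \<omega>
  proof -
    note g = AG[OF \<omega>, of n]
    have w: "l1norm (W \<omega>) = 1" using W(2)[OF \<omega>] by (simp add: Splus_def)
    have b1: "vmin (A n \<omega>) \<le> l1norm (A n \<omega> *v W \<omega>)"
      using l1norm_mv_ge_vmin[OF g Splus_nonneg[OF W(2)[OF \<omega>]]] w by simp
    moreover have "l1norm (A n \<omega> *v W \<omega>) \<le> l1_onorm (A n \<omega>)"
      using l1norm_mv_le_onorm[OF g, of "W \<omega>"] w by simp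
    ultimately show ?thesis
      unfolding U_def cocycle_def using vmin_pos[OF g] by (intro mart_close g) auto
  qed
  have "(\<lambda>n. (\<integral>\<omega>. (U n \<omega>)\<^sup>2 \<partial>M) / real n) \<longlonglongrightarrow> s2"
    by (rule second_moment_limit(2)[OF M A C2 Um U_close])
  then show ?thesis using LIMSEQ_unique lim unfolding U_def by blast
qed

end

text \<open>A real supremum carries information only for a bounded family; boundedness holds from
  \<open>k\<close> on, and nonnegativity disposes of the norm around the supremum.\<close>

lemma bigo_SUP_I:
  fixes f :: "nat \<Rightarrow> real \<Rightarrow> real"
  assumes nn: "\<And>n t. 0 \<le> f n t" and le: "\<And>n t. n \<ge> k \<Longrightarrow> f n t \<le> C * g n"
  shows "(\<lambda>n. SUP t. f n t) \<in> O(g)"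
proof (rule bigoI[where c="\<bar>C\<bar>"])
  show "\<forall>\<^sub>F n in at_top. norm (SUP t. f n t) \<le> \<bar>C\<bar> * norm (g n)"
    using eventually_ge_at_top[of k]
  proof eventually_elim
    case (elim n)
    have "bdd_above (range (f n))" using le[OF elim] by (auto intro!: bdd_aboveI)
    then have "0 \<le> (SUP t. f n t)" using nn[of n 0] by (meson cSUP_upper UNIV_I order_trans)
    moreover have "(SUP t. f n t) \<le> C * g n" by (rule cSUP_least) (use le[OF elim] in auto)
    moreover have "C * g n \<le> \<bar>C\<bar> * \<bar>g n\<bar>" by (metis abs_ge_self abs_mult)
    ultimately show ?case by simp
  qed
qed

theorem proposition7p3:
  fixes \<mu> :: "(real ^ 'n::finite ^ 'n) measure"
    and \<nu> :: "(real ^ 'n) measure"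
    and M :: "'w measure"
    and Y :: "nat \<Rightarrow> 'w \<Rightarrow> real ^ 'n ^ 'n"
    and W\<^sub>0 :: "'w \<Rightarrow> real ^ 'n"
    and \<gamma> lam s2 :: real
  assumes dim: "CARD('n) \<ge> 2"
    and mu: "prob_space \<mu>" "sets \<mu> = sets borel_G"
    and nu: "prob_space \<nu>" "sets \<nu> = sets borel_Splus" "invariant_measure \<mu> \<nu>"
    and M: "prob_space M"
    and Y_indep: "prob_space.indep_vars M (\<lambda>_. borel_G) Y {1..}"
    and Y_law: "\<And>n. n \<ge> 1 \<Longrightarrow> distr M borel_G (Y n) = \<mu>"
    and W_meas: "W\<^sub>0 \<in> measurable M borel_Splus"
    and W_law: "distr M borel_Splus W\<^sub>0 = \<nu>"
    and W_indep: "prob_space.indep_set M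
        (sets (vimage_algebra (space M) W\<^sub>0 borel_Splus))
        (sets (vimage_algebra (space M) (\<lambda>\<omega>. \<lambda>n\<in>{1..}. Y n \<omega>) (Pi\<^sub>M {1..} (\<lambda>_. borel_G))))"
    and gamma: "0 < \<gamma>" "\<gamma> \<le> 1"
    and contracting: "strictly_contracting \<mu>"
    and moment3: "has_moment \<mu> 3"
    and exp_moment: "almost_exp_moment \<mu> \<gamma>"
    and lyapunov: "AE \<omega> in M. (\<lambda>n. ln (l1_onorm (rprod Y n \<omega>)) / real n) \<longlonglongrightarrow> lam"
    and variance: "(\<lambda>n. (\<integral>\<omega>. (cocycle (rprod Y n \<omega>) (W\<^sub>0 \<omega>) - real n * lam)\<^sup>2 \<partial>M) / real n)
        \<longlonglongrightarrow> s2"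
    and s2_pos: "s2 > 0"
  shows "(\<lambda>n. SUP t::real. \<bar>measure M {\<omega> \<in> space M.
              ln (vmin (rprod Y n \<omega>)) - real n * lam \<le> t * sqrt (real n)}
            - cdf std_normal_distribution (t / sqrt s2)\<bar>)
          \<in> O(\<lambda>n. ln (real n) powr (1 / \<gamma>) / sqrt (real n))
       \<and> (\<lambda>n. SUP t::real. \<bar>measure M {\<omega> \<in> space M.
              ln (kappa (rprod Y n \<omega>)) - real n * lam \<le> t * sqrt (real n)}
            - cdf std_normal_distribution (t / sqrt s2)\<bar>)
          \<in> O(\<lambda>n. ln (real n) powr (1 / \<gamma>) / sqrt (real n))"
proof -
  interpret matrix_law \<mu> by (rule matrix_law.intro) (fact mu)+
  obtain D B b0 m \<psi> k c b where coc: "matrix_cocycle \<mu> D B B b0 m \<psi> k c b"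
    using ex_matrix_cocycle[OF contracting moment3] by blast
  interpret C: matrix_cocycle \<mu> D B B b0 m \<psi> k c b by (rule coc)
  obtain \<delta> C where \<delta>: "\<delta> > 0" and C: "C \<ge> 0" "\<And>n. (\<integral>\<^sup>+h. exp_Lmat \<gamma> \<delta> h \<partial>cp n) \<le> ennreal C"
    using uniform_exp_moment[OF contracting gamma exp_moment] by blast
  \<comment> \<open>The corrector enters at both ends of the orbit, hence
    \<open>2 * b\<close>.\<close>
  obtain C2 where C2: "\<And>n. integrable (cp n) (\<lambda>h. (C.rem h)\<^sup>2)" "\<And>n. (\<integral>h. (C.rem h)\<^sup>2 \<partial>cp n) \<le> C2"
    using Lmat_second_moment[OF gamma(1) \<delta> C, of "2 * b"] C.b_nonneg by auto
  have A: "rprod Y n \<in> measurable M borel_G" "distr M borel_G (rprod Y n) = cp n" for n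
    using rprod_law[OF M Y_indep Y_law] by blast+
  \<comment> \<open>Here the constant from the Poisson equation meets the prescribed exponent. The
    variance hypothesis is stated with \<open>lam\<close>, so this has to precede its identification
    with the martingale variance.\<close>
  have m: "m = lam" by (rule C.lyapunov_exponent_eq[OF M A C2 lyapunov])
  have W: "(\<lambda>\<omega>. W\<^sub>0 \<omega> $ j) \<in> borel_measurable M" for j
    by (rule measurable_compose[OF W_meas borel_Splus_measurable])
  have WS: "W\<^sub>0 \<omega> \<in> Splus" if "\<omega> \<in> space M" for \<omega>
    using measurable_space[OF W_meas that] by (simp add: space_borel_Splus)
  have s2: "s2 = C.s2"
    by (rule C.asymptotic_variance_eq[OF M A C2 W WS]) (use variance m in simp_all)
  have "C.s2 > 0" using s2_pos s2 by simp
  then obtain K where K: "\<forall>Z. Z \<in> borel_measurable borel_G \<longrightarrow> (\<forall>h\<in>Gmat. ln (vmin h) \<le> Z h \<and> Z h \<le> ln (l1_onorm h)) \<longrightarrow>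
    (\<forall>n\<ge>3. \<forall>t. \<bar>measure (cp n) {h \<in> Gmat. Z h - n * m \<le> t * sqrt n} - cdf stdN (t / sqrt C.s2)\<bar>
      \<le> K * (ln n powr (1 / \<gamma>) / sqrt n))"
    by (rule exE[OF C.kolmogorov_bound[OF _ gamma \<delta> C]])
  have main: "(\<lambda>n. SUP t::real. \<bar>measure M {\<omega> \<in> space M. Z (rprod Y n \<omega>) - real n * lam \<le> t * sqrt (real n)}
            - cdf stdN (t / sqrt s2)\<bar>) \<in> O(\<lambda>n. ln (real n) powr (1 / \<gamma>) / sqrt (real n))"
    if Z: "Z \<in> borel_measurable borel_G" "\<And>h. h \<in> Gmat \<Longrightarrow> ln (vmin h) \<le> Z h \<and> Z h \<le> ln (l1_onorm h)" for Z
  proof (rule bigo_SUP_I[where k=3 and C=K])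
    fix n :: nat and t :: real assume n: "n \<ge> 3"
    have S: "{h \<in> Gmat. Z h - n * m \<le> t * sqrt n} \<in> sets borel_G"
    proof -
      have "{h \<in> space borel_G. Z h - n * m \<le> t * sqrt n} \<in> sets borel_G" using Z(1) by measurable
      then show ?thesis by (simp only: space_borel_G)
    qed
    have "rprod Y n -` {h \<in> Gmat. Z h - n * m \<le> t * sqrt n} \<inter> space M = {\<omega> \<in> space M. Z (rprod Y n \<omega>) - n * lam \<le> t * sqrt n}"
      using measurable_space[OF A(1)] m by auto
    then have "measure (cp n) {h \<in> Gmat. Z h - n * m \<le> t * sqrt n} = measure M {\<omega> \<in> space M. Z (rprod Y n \<omega>) - n * lam \<le> t * sqrt n}"
      unfolding A(2)[symmetric] by (subst measure_distr[OF A(1) S]) simp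
    then show "\<bar>measure M {\<omega> \<in> space M. Z (rprod Y n \<omega>) - real n * lam \<le> t * sqrt (real n)} - cdf stdN (t / sqrt s2)\<bar>
       \<le> K * (ln (real n) powr (1 / \<gamma>) / sqrt (real n))"
      using K[rule_format, OF Z n, of t] unfolding s2 by simp
  qed simp
  have kap: "ln (vmin h) \<le> ln (kappa h) \<and> ln (kappa h) \<le> ln (l1_onorm h)" if "h \<in> Gmat" for h :: "real ^ 'n ^ 'n"
    using kappa_bounds[OF that] vmin_pos[OF that] by auto
  show ?thesis
  proof (rule conjI)
    show "(\<lambda>n. SUP t::real. \<bar>measure M {\<omega> \<in> space M. ln (vmin (rprod Y n \<omega>)) - real n * lam \<le> t * sqrt (real n)}
            - cdf stdN (t / sqrt s2)\<bar>) \<in> O(\<lambda>n. ln (real n) powr (1 / \<gamma>) / sqrt (real n))"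
      by (rule main[of "\<lambda>h. ln (vmin h)"]) (auto intro!: borel_measurable_ln ln_mono vmin_le_onorm vmin_pos)
    show "(\<lambda>n. SUP t::real. \<bar>measure M {\<omega> \<in> space M. ln (kappa (rprod Y n \<omega>)) - real n * lam \<le> t * sqrt (real n)}
            - cdf stdN (t / sqrt s2)\<bar>) \<in> O(\<lambda>n. ln (real n) powr (1 / \<gamma>) / sqrt (real n))"
      by (rule main[of "\<lambda>h. ln (kappa h)"]) (use kap in \<open>auto intro!: borel_measurable_ln\<close>)
  qed
qed



end
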